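(* Suppose $\Theta$ is a finite set and the following six assumptions hold (notation as in the context). (1) $Y_1,Y_2,\ldots$ are independent with a common density $m$ on $\mathscr{Y}$, and $K(m,m')<\infty$ for all $m'\in\mathbb{M}=\bigcup_{\theta\in\Theta}\mathbb{M}_\theta$. (2) The weight sequence satisfies $\sum_n w_n=\infty$ and $\sum_n w_n^2<\infty$. (3) The set $\overline{\mathbb{F}}$ is compact with respect to the weak topology. (4) The mapping $u\mapsto p(y\mid\theta,u)$ is bounded and continuous for all $(y,\theta)$. (5) For each pair $(\theta_1,\theta_2)\in\Theta\times\Theta$ there exists $A=A(\theta_1,\theta_2)<\infty$ such that $$\sup_{u_1,u_2\in\mathscr{U}}\int\Bigl\{\frac{p(y\mid\theta_1,u_1)}{p(y\mid\theta_2,u_2)}\Bigr\}^2 m(y)\,dy\le A.$$ (6) For each $\theta\in\Theta$ there exists $B=B_\theta<\infty$ such that the density $m_{f,\theta}\in\mathbb{M}_\theta$ at which the infimum $K^\star(\theta)=\inf\{K(m,m_{f,\theta}):f\in\overline{\mathbb{F}}\}$ is attained satisfies $$\int\Bigl\{\log\frac{m(y)}{m_{f,\theta}(y)}\Bigr\}^2 m(y)\,dy\le B.$$ Let $\Theta^\star=\{\theta'\in\Theta:K^\star(\theta')=\inf_{\theta\in\Theta}K^\star(\theta)\}$, and let $\hat\theta_n=\arg\max_{\theta\in\Theta}L_n(\theta)$, where $L_n(\theta)=\prod_{i=1}^n m_{i-1,\theta}(Y_i)$ is the predictive recursion marginal likelihood. Then, almost surely, $\hat\theta_n\in\Theta^\star$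 for all sufficiently large $n$. In particular, if $\Theta^\star=\{\theta^\star\}$, then $\hat\theta_n\to\theta^\star$ almost surely.
   Context: Setting. $\mathscr{Y}$ is the sample space, with densities on it taken with respect to a fixed dominating measure written $dy$. $\mathscr{U}$ is a space carrying a $\sigma$-finite Borel measure $\mu$, and $\Theta$ is a parameter set. For each $(\theta,u)\in\Theta\times\mathscr{U}$, $y\mapsto p(y\mid\theta,u)$ is a known probability density on $\mathscr{Y}$ (the kernel). $\mathbb{F}$ is the set of all probability densities on $\mathscr{U}$ with respect to $\mu$ (identified with the probability measures they define), and $\overline{\mathbb{F}}$ is its closure in the weak topology (weak convergence of probability measures on $\mathscr{U}$). Elements of $\overline{\mathbb{F}}$ are also denoted $f$, although they need not have a density with respect to $\mu$. Mixtures. For $f\in\overline{\mathbb{F}}$ and $\theta\in\Theta$, $m_{f,\theta}(y)=\int p(y\mid\theta,u)f(u)\,d\mu(u)$ (interpreted as $\int p(y\mid\theta,u)\,f(du)$ when $f$ has no density). $\mathbb{M}_\theta=\{m_{f,\theta}:f\in\overline{\mathbb{F}}\}$. Kullback--Leibler divergence. $K(m,m')=\int\log\{m(y)/m'(y)\}\,m(y)\,dy$, and $K^\star(\theta)=\inf\{K(m,m_{f,\theta}):f\in\overline{\mathbb{F}}\}$. (Under assumptions (3) and (4) this infimum is attained.) Predictive recursion. Fix weights $w_1,w_2,\ldots\in(0,1)$ and, for each $\theta$, an initial guess $f_{0,\theta}\in\mathbb{F}$. For $i\ge1$ define $$f_{i,\theta}(u)=(1-w_i)f_{i-1,\theta}(u)+w_i\frac{p(Y_i\mid\theta,u)f_{i-1,\theta}(u)}{\int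 p(Y_i\mid\theta,u')f_{i-1,\theta}(u')\,d\mu(u')},\quad u\in\mathscr{U},$$ and, for $i\ge0$, $m_{i,\theta}(y)=\int p(y\mid\theta,u)f_{i,\theta}(u)\,d\mu(u)$. Here $\hat\theta_n$ denotes a maximizer of $L_n$ over $\Theta$.
   Formalization: Each initial guess f_{0,θ} is additionally assumed positive μ-almost everywhere; without this the claim fails, since predictive recursion never leaves the support of f_{0,θ}. The space U is read as a separable metric space. *)

theory Defs
  imports "HOL-Probability.Probability"
begin

definition is_density :: "'a measure \<Rightarrow> ('a \<Rightarrow> real) \<Rightarrow> bool" where
  "is_density M f \<longleftrightarrow>
     f \<in> borel_measurable M \<and> (\<forall>x\<in>space M. 0 \<le> f x) \<and> (\<integral>\<^sup>+x. ennreal (f x) \<partial>M) = 1"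

(* The coarsest topology on the Borel probability measures that makes every map
   P \<mapsto> integral of g with respect to P continuous, for g bounded and continuous. *)
definition weak_topology :: "'a::topological_space measure topology" where
  "weak_topology = topology_generated_by
     {{P \<in> space (prob_algebra borel). (\<integral>x. g x \<partial>P) \<in> V} | (g :: 'a \<Rightarrow> real) V.
        continuous_on UNIV g \<and> bounded (range g) \<and> open V}"

definition mixing_densities :: "'u measure \<Rightarrow> 'u measure set" where
  "mixing_densities \<mu> = {density \<mu> (\<lambda>u. ennreal (f u)) | f. is_density \<mu> f}"

definition mixing_closure :: "'u::topological_space measure \<Rightarrow> 'u measure set" where
  "mixing_closure \<mu> = weak_topology closure_of mixing_densities \<mu>"

text \<open>A kernel \<open>k u y\<close> is a density in \<open>y\<close> for every \<open>u\<close>.\<close>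

definition mixture :: "('u \<Rightarrow> 'y \<Rightarrow> real) \<Rightarrow> 'u measure \<Rightarrow> 'y \<Rightarrow> real" where
  "mixture k Q y = (\<integral>u. k u y \<partial>Q)"

(* log (a / b) for a, b \<ge> 0, infinite for b = 0 < a. It is only integrated against
   a density that vanishes where a = 0, so its values for a = 0 do not matter. *)
definition log_ratio :: "real \<Rightarrow> real \<Rightarrow> ereal" where
  "log_ratio a b = (if b = 0 then \<infinity> else ereal (ln (a / b)))"

(* Integral of the positive part minus integral of the negative part (e2ennreal maps
   negative numbers to 0). KL_divergence from the library is real-valued and does not
   represent infinite divergences. *)
definition kl_div :: "'y measure \<Rightarrow> ('y \<Rightarrow> real) \<Rightarrow> ('y \<Rightarrow> real) \<Rightarrow> ereal" where
  "kl_div N m m' =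
     enn2ereal (\<integral>\<^sup>+y. e2ennreal (log_ratio (m y) (m' y)) * ennreal (m y) \<partial>N)
     - enn2ereal (\<integral>\<^sup>+y. e2ennreal (- log_ratio (m y) (m' y)) * ennreal (m y) \<partial>N)"

definition min_kl ::
  "'y measure \<Rightarrow> 'u::topological_space measure \<Rightarrow> ('y \<Rightarrow> real) \<Rightarrow> ('u \<Rightarrow> 'y \<Rightarrow> real) \<Rightarrow> ereal" where
  "min_kl N \<mu> m k = (INF Q\<in>mixing_closure \<mu>. kl_div N m (mixture k Q))"

definition best_params ::
  "'y measure \<Rightarrow> 'u::topological_space measure \<Rightarrow> ('y \<Rightarrow> real) \<Rightarrow>
     ('t \<Rightarrow> 'u \<Rightarrow> 'y \<Rightarrow> real) \<Rightarrow> 't set \<Rightarrow> 't set" where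
  "best_params N \<mu> m p \<Theta> =
     {\<theta>'\<in>\<Theta>. min_kl N \<mu> m (p \<theta>') = (INF \<theta>\<in>\<Theta>. min_kl N \<mu> m (p \<theta>))}"

text \<open>Predictive recursion along a sequence \<open>y\<close>. Observations and weights are indexed from 1;
  \<open>y 0\<close> and \<open>w 0\<close> are not used.\<close>

primrec pr_density ::
  "'u measure \<Rightarrow> ('u \<Rightarrow> 'y \<Rightarrow> real) \<Rightarrow> (nat \<Rightarrow> real) \<Rightarrow> ('u \<Rightarrow> real) \<Rightarrow> (nat \<Rightarrow> 'y) \<Rightarrow>
     nat \<Rightarrow> 'u \<Rightarrow> real" where
  "pr_density \<mu> k w f\<^sub>0 y 0 = f\<^sub>0"
| "pr_density \<mu> k w f\<^sub>0 y (Suc i) =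
     (\<lambda>u. (1 - w (Suc i)) * pr_density \<mu> k w f\<^sub>0 y i u
        + w (Suc i) * (k u (y (Suc i)) * pr_density \<mu> k w f\<^sub>0 y i u
            / (\<integral>u'. k u' (y (Suc i)) * pr_density \<mu> k w f\<^sub>0 y i u' \<partial>\<mu>)))"

definition pr_mixture ::
  "'u measure \<Rightarrow> ('u \<Rightarrow> 'y \<Rightarrow> real) \<Rightarrow> (nat \<Rightarrow> real) \<Rightarrow> ('u \<Rightarrow> real) \<Rightarrow> (nat \<Rightarrow> 'y) \<Rightarrow>
     nat \<Rightarrow> 'y \<Rightarrow> real" where
  "pr_mixture \<mu> k w f\<^sub>0 y i z = (\<integral>u. k u z * pr_density \<mu> k w f\<^sub>0 y i u \<partial>\<mu>)"

definition pr_marginal_likelihood ::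
  "'u measure \<Rightarrow> ('u \<Rightarrow> 'y \<Rightarrow> real) \<Rightarrow> (nat \<Rightarrow> real) \<Rightarrow> ('u \<Rightarrow> real) \<Rightarrow> (nat \<Rightarrow> 'y) \<Rightarrow>
     nat \<Rightarrow> real" where
  "pr_marginal_likelihood \<mu> k w f\<^sub>0 y n = (\<Prod>i=1..n. pr_mixture \<mu> k w f\<^sub>0 y (i - 1) (y i))"

end

(* Fix theta. Let P be the law of an observation, nu the initial guess, g_n the nu-density of f_n,
   and ell g = int ln (m_g / rho) dP, where rho is the mixture of a reference parameter. Then
   K(m, m_f) = K(m, rho) - ell f. One step is g_(n+1) = (1 - w) g_n + w h, where h is the Bayes
   update of g_n, so ln (1 + x) >= x - O(x^2) bounds increments from below:
   - ell g_n increases in conditional mean up to O(w^2), because int int (m_h / m_(g_n)) >= 1 by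
     Cauchy-Schwarz; with martingale convergence, ell g_n converges almost surely.
   - For a bounded density g, int g ln g_n dnu is bounded above and increases in conditional mean by
     at least w (ell g - ell g_n) - O(w^2). As the weights have an infinite sum, lim ell g_n >= ell g.
   Thus ell g_n tends to the supremum of ell over bounded densities. This is the supremum over the
   weak closure: at a near-maximizer g, concavity bounds the directional derivative
   u -> int k(u, y) / m_g(y) dP by 1 + eps, and truncations of it are bounded continuous functions
   of u, so the bound passes to weak limits. The strong law for the martingale differences
   ln (m_(i-1) / rho)(Y_i) - ell g_(i-1) then gives (1/n) ln (L_n(theta) / prod_i rho(Y_i)) the limit
   K(m, rho) - K*(theta), and rho does not depend on theta. *)

theory Submission
  imports Defs
begin

section \<open>Series and integrals\<close>

text \<open>All almost-sure statements are proved on a countable product of copies of the law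
  \<open>P\<close>, where the past is a set of coordinates and a conditional expectation is an
  integral over one resampled coordinate; they are carried back along the shifted data. The two
  drift arguments need each other: divergent weights alone only prevent \<open>ell (G z n)\<close>
  from staying below \<open>ell h\<close> by a fixed amount, and the monotonicity of
  \<open>ell\<close> up to summable errors is what makes it converge. Every error term is paid for
  by one constant: \<open>A5\<close> bounds second moments of ratios of kernels, and convexity of
  the square and of the inverse square extends the same bound to ratios of mixtures. The recursion
  only produces bounded multiples of the initial guess, while the infimum runs over limits of
  arbitrary \<mu>-densities; the initial guess is therefore positive \<mu>-almost everywhere, which
  makes its null sets those of \<mu>. Weak continuity of the divergence is not at hand, so the
  passage to the closure uses an inequality that is linear in the mixing measure.\<close>

lemma cesaro_mean:
  fixes s :: "nat \<Rightarrow> real"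
  assumes s: "s \<longlonglongrightarrow> L"
  shows "(\<lambda>n. (\<Sum>i<n. s i) / real n) \<longlonglongrightarrow> L"
  unfolding LIMSEQ_iff real_norm_def
proof (intro allI impI)
  fix r :: real assume "0 < r"
  then obtain n0 where n0: "\<And>n. n \<ge> n0 \<Longrightarrow> \<bar>s n - L\<bar> < r / 2"
    using s unfolding LIMSEQ_iff real_norm_def by (metis half_gt_zero)
  define C where "C = (\<Sum>i<n0. \<bar>s i - L\<bar>)"
  show "\<exists>no. \<forall>n\<ge>no. \<bar>(\<Sum>i<n. s i) / real n - L\<bar> < r"
  proof (intro exI allI impI)
    fix n assume n: "n \<ge> Suc (n0 + nat \<lceil>2 * C / r\<rceil>)"
    have "2 * C / r < real n" using n by linarith
    then have Cn: "C < r / 2 * real n" using \<open>0 < r\<close> by (simp add: field_simps)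
    have "\<bar>(\<Sum>i<n. s i) - real n * L\<bar> = \<bar>\<Sum>i<n. s i - L\<bar>" by (simp add: sum_subtractf)
    also have "\<dots> \<le> (\<Sum>i<n. \<bar>s i - L\<bar>)" by (rule sum_abs)
    also have "\<dots> = C + (\<Sum>i=n0..<n. \<bar>s i - L\<bar>)"
      unfolding C_def lessThan_atLeast0 using n by (subst sum.atLeastLessThan_concat) auto
    also have "\<dots> \<le> C + (\<Sum>i=n0..<n. r / 2)"
      using n0 by (intro add_left_mono sum_mono) (auto intro: less_imp_le)
    also have "\<dots> \<le> C + real n * (r / 2)"
      using \<open>0 < r\<close> n by (auto simp: of_nat_diff intro!: mult_right_mono)
    also have "\<dots> < real n * r" using Cn by (simp add: field_simps)
    finally have "\<bar>(\<Sum>i<n. s i) - real n * L\<bar> < real n * r" .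
    moreover have "(\<Sum>i<n. s i) / real n - L = ((\<Sum>i<n. s i) - real n * L) / real n"
      using n by (simp add: field_simps)
    ultimately show "\<bar>(\<Sum>i<n. s i) / real n - L\<bar> < r"
      using n by (simp add: abs_divide divide_less_eq mult.commute)
  qed
qed

text \<open>Summation by parts: the partial sum of \<open>x\<close> is \<open>n\<close> times the
  partial sum \<open>s n\<close> of the weighted series minus the sum of the earlier values of
  \<open>s\<close>. Divided by \<open>n\<close>, this is \<open>s n\<close> minus a Cesaro mean of
  \<open>s\<close>, and both have the same limit.\<close>

lemma kronecker_lemma:
  fixes x :: "nat \<Rightarrow> real"
  assumes "summable (\<lambda>i. x i / real (Suc i))"
  shows "(\<lambda>n. (\<Sum>i<n. x i) / real n) \<longlonglongrightarrow> 0"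
proof -
  define s where "s n = (\<Sum>i<n. x i / real (Suc i))" for n
  obtain L where s: "s \<longlonglongrightarrow> L"
    using assms unfolding s_def summable_iff_convergent convergent_def by blast
  have x_eq: "x n = real (Suc n) * (s (Suc n) - s n)" for n
    by (simp add: s_def)
  have sum: "(\<Sum>i<n. x i) = real n * s n - (\<Sum>i<n. s i)" for n
    by (induction n) (simp_all add: x_eq algebra_simps)
  have "(\<lambda>n. s n - (\<Sum>i<n. s i) / real n) \<longlonglongrightarrow> L - L"
    by (intro tendsto_diff s cesaro_mean)
  moreover have "\<forall>\<^sub>F n in sequentially. s n - (\<Sum>i<n. s i) / real n = (\<Sum>i<n. x i) / real n"
    using eventually_gt_at_top[of 0] by eventually_elim (simp add: sum diff_divide_distrib)
  ultimately show ?thesis by (simp add: tendsto_cong)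
qed

lemma summable_bounded_partial_sums:
  fixes b :: "nat \<Rightarrow> real"
  assumes "summable b"
  shows "\<exists>C. \<forall>n. \<bar>\<Sum>i<n. b i\<bar> \<le> C"
proof -
  have "Bseq (\<lambda>n. \<Sum>i<n. b i)"
    using assms by (intro convergent_imp_Bseq) (simp add: summable_iff_convergent)
  then show ?thesis unfolding Bseq_def by auto
qed

text \<open>Deterministic half of a submartingale argument: after subtraction of the partial sums of
  \<open>b\<close> the sequence is increasing and bounded above.\<close>

lemma convergent_of_increments:
  fixes e b :: "nat \<Rightarrow> real"
  assumes b: "summable b" and inc: "\<And>i. b i \<le> e (Suc i) - e i" and le: "\<And>i. e i \<le> C"
  shows "convergent e"
proof -
  obtain B where B: "\<And>n. \<bar>\<Sum>i<n. b i\<bar> \<le> B" using summable_bounded_partial_sums[OF b] by blast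
  define d where "d n = e n - (\<Sum>i<n. b i)" for n
  have "incseq d" unfolding d_def by (rule incseq_SucI) (use inc in \<open>simp add: algebra_simps\<close>)
  moreover have "d n \<le> C + B" for n
    using le[of n] B[of n] unfolding d_def by linarith
  ultimately obtain L where L: "d \<longlonglongrightarrow> L" using incseq_convergent[of d "C + B"] by blast
  have "(\<lambda>n. \<Sum>i<n. b i) \<longlonglongrightarrow> suminf b" using b by (rule summable_LIMSEQ)
  then have "(\<lambda>n. d n + (\<Sum>i<n. b i)) \<longlonglongrightarrow> L + suminf b" by (rule tendsto_add[OF L])
  then show ?thesis by (auto simp: d_def convergent_def)
qed

text \<open>A positive limit of \<open>d\<close> would make the drift at least
  \<open>w i * (\<delta> / 2)\<close> from some index on; since \<open>D\<close> is bounded above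
  and \<open>s\<close> is summable, \<open>w\<close> would be summable.\<close>

lemma drift_limit_nonpos:
  fixes D s w d :: "nat \<Rightarrow> real"
  assumes s: "summable s" and inc: "\<And>i. s i + w i * d i \<le> D (Suc i) - D i" and le: "\<And>i. D i \<le> C"
    and w: "\<And>i. 0 \<le> w i" "\<not> summable w" and d: "d \<longlonglongrightarrow> \<delta>"
  shows "\<delta> \<le> 0"
proof (rule ccontr)
  assume "\<not> \<delta> \<le> 0"
  then have "0 < \<delta>" by simp
  obtain B where B: "\<And>n. \<bar>\<Sum>i<n. s i\<bar> \<le> B" using summable_bounded_partial_sums[OF s] by blast
  define E where "E n = D n - (\<Sum>i<n. s i)" for n
  have incE: "w i * d i \<le> E (Suc i) - E i" for i
    using inc[of i] by (simp add: E_def)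
  have leE: "E n \<le> C + B" for n using le[of n] B[of n] unfolding E_def by linarith
  have "\<forall>\<^sub>F i in sequentially. \<delta> / 2 < d i"
    using d \<open>0 < \<delta>\<close> by (intro order_tendstoD(1)) auto
  then obtain N where N: "\<And>i. N \<le> i \<Longrightarrow> \<delta> / 2 < d i" by (auto simp: eventually_sequentially)
  have sum: "(\<Sum>i<n. w (i + N) * (\<delta> / 2)) \<le> E (n + N) - E N" for n
  proof (induction n)
    case (Suc n)
    have "w (n + N) * (\<delta> / 2) \<le> w (n + N) * d (n + N)"
      using N[of "n + N"] w(1) by (intro mult_left_mono) auto
    also have "\<dots> \<le> E (Suc n + N) - E (n + N)" using incE[of "n + N"] by simp
    finally show ?case using Suc by simp
  qed simp
  have "summable (\<lambda>i. w (i + N) * (\<delta> / 2))"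
  proof (rule summableI_nonneg_bounded)
    show "(\<Sum>i<n. w (i + N) * (\<delta> / 2)) \<le> C + B - E N" for n
      using sum[of n] leE[of "n + N"] by linarith
  qed (use w \<open>0 < \<delta>\<close> in auto)
  from summable_mult2[OF this, of "2 / \<delta>"] have "summable (\<lambda>i. w (i + N))"
    using \<open>0 < \<delta>\<close> by simp
  then show False using w(2) summable_iff_shift[of w N] by blast
qed

section \<open>Jensen inequalities with possibly infinite right-hand sides, and bounds for the
  logarithm\<close>

lemma integral_le_nn_integral:
  fixes f :: "'a \<Rightarrow> real"
  assumes "integrable M f"
  shows "ennreal (\<integral>x. f x \<partial>M) \<le> (\<integral>\<^sup>+x. ennreal (f x) \<partial>M)"
proof -
  have int: "integrable M (\<lambda>x. max 0 (f x))" using assms by simp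
  have "(\<integral>x. f x \<partial>M) \<le> (\<integral>x. max 0 (f x) \<partial>M)"
    using assms int by (intro integral_mono) auto
  then have "ennreal (\<integral>x. f x \<partial>M) \<le> ennreal (\<integral>x. max 0 (f x) \<partial>M)" by (rule ennreal_leI)
  also have "\<dots> = (\<integral>\<^sup>+x. ennreal (max 0 (f x)) \<partial>M)"
    using int by (intro nn_integral_eq_integral[symmetric]) auto
  also have "\<dots> = (\<integral>\<^sup>+x. ennreal (f x) \<partial>M)"
    by (intro nn_integral_cong) (simp add: max_def ennreal_neg)
  finally show ?thesis .
qed

text \<open>Integrates the tangent of the square at the expectation. \<open>ennreal\<close> cuts the
  tangent off at 0, which only increases its integral, so the bound also makes sense for an infinite
  second moment.\<close>

lemma (in prob_space) square_expectation_le: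
  fixes f :: "'a \<Rightarrow> real"
  assumes "integrable M f"
  shows "ennreal ((\<integral>x. f x \<partial>M)\<^sup>2) \<le> (\<integral>\<^sup>+x. ennreal ((f x)\<^sup>2) \<partial>M)"
proof -
  define I where "I = (\<integral>x. f x \<partial>M)"
  have "ennreal (\<integral>x. 2 * I * f x - I\<^sup>2 \<partial>M) \<le> (\<integral>\<^sup>+x. ennreal (2 * I * f x - I\<^sup>2) \<partial>M)"
    using assms by (intro integral_le_nn_integral) auto
  also have "\<dots> \<le> (\<integral>\<^sup>+x. ennreal ((f x)\<^sup>2) \<partial>M)"
  proof (intro nn_integral_mono ennreal_leI)
    show "2 * I * f x - I\<^sup>2 \<le> (f x)\<^sup>2" for x
      using zero_le_power2[of "f x - I"] by (simp add: power2_diff algebra_simps)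
  qed
  also have "(\<integral>x. 2 * I * f x - I\<^sup>2 \<partial>M) = I\<^sup>2"
    using assms by (simp add: prob_space I_def[symmetric] power2_eq_square)
  finally show ?thesis by (simp add: I_def)
qed

text \<open>From the tangent of \<open>x \<mapsto> 1/x\<^sup>2\<close> at the expectation. In \<^typ>\<open>ennreal\<close>, \<open>c / 0\<close> is \<open>\<infinity>\<close>
  for \<open>c > 0\<close>.\<close>

lemma (in prob_space) square_divide_expectation_le:
  fixes f :: "'a \<Rightarrow> real"
  assumes int: "integrable M f" and nonneg: "AE x in M. 0 \<le> f x"
  shows "(ennreal c / ennreal (\<integral>x. f x \<partial>M))\<^sup>2 \<le> (\<integral>\<^sup>+x. (ennreal c / ennreal (f x))\<^sup>2 \<partial>M)"
proof (cases "0 < c")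
  case False
  then show ?thesis by (simp add: ennreal_neg)
next
  case c: True
  define I where "I = (\<integral>x. f x \<partial>M)"
  have I: "0 \<le> I" unfolding I_def using nonneg by (rule integral_nonneg_AE)
  show ?thesis
  proof (cases "I = 0")
    case True
    then have "AE x in M. f x = 0"
      using integral_nonneg_eq_0_iff_AE[OF int nonneg] by (simp add: I_def)
    then have "(\<integral>\<^sup>+x. (ennreal c / ennreal (f x))\<^sup>2 \<partial>M) = (\<integral>\<^sup>+x. \<top> \<partial>M)"
      using c by (intro nn_integral_cong_AE)
        (auto simp: divide_ennreal_def ennreal_mult_top power2_eq_square)
    also have "\<dots> = \<top>" by (simp add: emeasure_space_1)
    finally show ?thesis by simp
  next
    case False
    then have I: "0 < I" using I by simp
    have "(\<integral>x. c\<^sup>2 * (3 / I\<^sup>2 - 2 * f x / I ^ 3) \<partial>M) = c\<^sup>2 * (3 / I\<^sup>2 - 2 * I / I ^ 3)"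
      using int by (simp add: prob_space I_def[symmetric])
    also have "\<dots> = (c / I)\<^sup>2"
    proof -
      have "2 * I / I ^ 3 = 2 / I\<^sup>2" using I by (simp add: power2_eq_square power3_eq_cube)
      then have "3 / I\<^sup>2 - 2 * I / I ^ 3 = 1 / I\<^sup>2" by (simp add: diff_divide_distrib[symmetric])
      then show ?thesis by (simp add: power_divide)
    qed
    finally have "(ennreal c / ennreal I)\<^sup>2 = ennreal (\<integral>x. c\<^sup>2 * (3 / I\<^sup>2 - 2 * f x / I ^ 3) \<partial>M)"
      using I c by (simp add: divide_ennreal ennreal_power less_imp_le)
    also have "\<dots> \<le> (\<integral>\<^sup>+x. ennreal (c\<^sup>2 * (3 / I\<^sup>2 - 2 * f x / I ^ 3)) \<partial>M)"
      using int by (intro integral_le_nn_integral) auto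
    also have "\<dots> \<le> (\<integral>\<^sup>+x. (ennreal c / ennreal (f x))\<^sup>2 \<partial>M)"
    proof (rule nn_integral_mono_AE, use nonneg in eventually_elim)
      fix x assume "0 \<le> f x"
      show "ennreal (c\<^sup>2 * (3 / I\<^sup>2 - 2 * f x / I ^ 3)) \<le> (ennreal c / ennreal (f x))\<^sup>2"
      proof (cases "f x = 0")
        case True
        then show ?thesis using c by (simp add: divide_ennreal_def ennreal_mult_top power2_eq_square)
      next
        case False
        \<comment> \<open>Rescaling by \<open>I\<close> moves the point of tangency to 1, where the
          tangent inequality is \<open>3 - 2 * t \<le> 1 / t\<^sup>2\<close>.\<close>
        define t where "t = f x / I"
        have t: "0 < t" using False \<open>0 \<le> f x\<close> I by (simp add: t_def)
        have "(3 - 2 * t) * t\<^sup>2 \<le> 1"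
        proof -
          have "1 - (3 - 2 * t) * t\<^sup>2 = (t - 1)\<^sup>2 * (2 * t + 1)"
            by (simp add: power2_eq_square algebra_simps)
          moreover have "0 \<le> (t - 1)\<^sup>2 * (2 * t + 1)" using t by simp
          ultimately show ?thesis by simp
        qed
        then have "3 - 2 * t \<le> 1 / t\<^sup>2" using t by (simp add: field_simps)
        then have "c\<^sup>2 / I\<^sup>2 * (3 - 2 * t) \<le> c\<^sup>2 / I\<^sup>2 * (1 / t\<^sup>2)"
          by (intro mult_left_mono) auto
        also have "c\<^sup>2 / I\<^sup>2 * (3 - 2 * t) = c\<^sup>2 * (3 / I\<^sup>2 - 2 * f x / I ^ 3)"
        proof -
          have "2 * f x / I ^ 3 = 2 * t / I\<^sup>2" using I by (simp add: t_def power2_eq_square power3_eq_cube)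
          then show ?thesis by (simp add: diff_divide_distrib[symmetric])
        qed
        also have "c\<^sup>2 / I\<^sup>2 * (1 / t\<^sup>2) = (c / f x)\<^sup>2"
          using I by (simp add: t_def power_divide)
        finally show ?thesis
          using False \<open>0 \<le> f x\<close> c by (simp add: divide_ennreal ennreal_power ennreal_leI)
      qed
    qed
    finally show ?thesis by (simp add: I_def)
  qed
qed

text \<open>Combines \<open>ln v \<ge> 1 - 1 / v\<close> with \<open>1 + w * x \<ge> 1 - w\<close>.
  It is applied to a likelihood ratio minus one, which is where the restriction
  \<open>-1 \<le> x\<close> comes from.\<close>

lemma ln_one_plus_ge:
  fixes x w :: real
  assumes "0 \<le> w" "w < 1" "-1 \<le> x"
  shows "w * x - w\<^sup>2 / (1 - w) * x\<^sup>2 \<le> ln (1 + w * x)"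
proof -
  have "w * (- 1) \<le> w * x" using assms by (intro mult_left_mono) auto
  then have wx: "1 - w \<le> 1 + w * x" by simp
  then have pos: "0 < 1 + w * x" using assms by simp
  have "w * x - w\<^sup>2 / (1 - w) * x\<^sup>2 \<le> w * x - (w * x)\<^sup>2 / (1 + w * x)"
  proof -
    have "(w * x)\<^sup>2 / (1 + w * x) \<le> (w * x)\<^sup>2 / (1 - w)"
      using wx assms pos by (intro divide_left_mono) auto
    then show ?thesis by (simp add: power_mult_distrib)
  qed
  also have "\<dots> = 1 - 1 / (1 + w * x)"
    using pos by (simp add: field_simps power2_eq_square)
  also have "\<dots> \<le> ln (1 + w * x)"
    using ln_le_minus_one[of "1 / (1 + w * x)"] pos by (simp add: ln_div)
  finally show ?thesis .
qed

text \<open>Above 1 the logarithm is controlled by \<open>x\<close>, below 1 by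
  \<open>1 / x\<close>; second moments of a mixture and of its reciprocal thus bound that of its
  logarithm.\<close>

lemma square_ln_le:
  fixes x :: real
  assumes "0 < x"
  shows "(ln x)\<^sup>2 \<le> x\<^sup>2 + (1 / x)\<^sup>2"
proof (cases "1 \<le> x")
  case True
  then have "(ln x)\<^sup>2 \<le> x\<^sup>2"
    using ln_le_minus_one[of x] by (intro power_mono) auto
  then show ?thesis by (simp add: add_increasing2)
next
  case False
  then have "(ln (1 / x))\<^sup>2 \<le> (1 / x)\<^sup>2"
    using ln_le_minus_one[of "1 / x"] assms by (intro power_mono) (auto simp: ln_div)
  then show ?thesis using assms by (simp add: ln_div add_increasing)
qed

lemma integrable_mult_of_squares:
  fixes f g :: "_ \<Rightarrow> real"
  assumes [measurable]: "f \<in> borel_measurable M" "g \<in> borel_measurable M"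
    and "integrable M (\<lambda>x. (f x)\<^sup>2)" "integrable M (\<lambda>x. (g x)\<^sup>2)"
  shows "integrable M (\<lambda>x. f x * g x)"
proof (rule Bochner_Integration.integrable_bound)
  show "integrable M (\<lambda>x. (f x)\<^sup>2 + (g x)\<^sup>2)" using assms by simp
  have "\<bar>a * b\<bar> \<le> a\<^sup>2 + b\<^sup>2" for a b :: real
  proof -
    have "2 * (\<bar>a\<bar> * \<bar>b\<bar>) \<le> a\<^sup>2 + b\<^sup>2" using sum_squares_bound[of "\<bar>a\<bar>" "\<bar>b\<bar>"] by simp
    then show ?thesis by (simp add: abs_mult) (smt (verit) mult_nonneg_nonneg abs_ge_zero)
  qed
  then show "AE x in M. norm (f x * g x) \<le> norm ((f x)\<^sup>2 + (g x)\<^sup>2)" by simp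
qed simp

section \<open>From the observations to a product space\<close>

lemma (in prob_space) indep_sets_reindex:
  assumes t: "inj_on t I" and indep: "indep_sets F (t ` I)"
  shows "indep_sets (\<lambda>i. F (t i)) I"
proof (rule indep_setsI)
  show "F (t i) \<subseteq> events" if "i \<in> I" for i
    using indep that by (auto simp: indep_sets_def)
  fix A J assume J: "J \<noteq> {}" "J \<subseteq> I" "finite J" and A: "\<forall>j\<in>J. A j \<in> F (t j)"
  let ?B = "\<lambda>j. A (the_inv_into I t j)"
  have inv: "the_inv_into I t (t j) = j" if "j \<in> J" for j
    using that J(2) t by (auto intro: the_inv_into_f_f)
  have inj: "inj_on t J" using t J(2) by (rule inj_on_subset)
  have "prob (\<Inter>j\<in>t ` J. ?B j) = (\<Prod>j\<in>t ` J. prob (?B j))"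
    by (rule indep_setsD[OF indep]) (use J A inv in auto)
  moreover have "(\<Inter>j\<in>t ` J. ?B j) = (\<Inter>j\<in>J. A j)" using inv by simp
  moreover have "(\<Prod>j\<in>t ` J. prob (?B j)) = (\<Prod>j\<in>J. prob (A j))"
    using inv by (simp add: prod.reindex[OF inj])
  ultimately show "prob (\<Inter>j\<in>J. A j) = (\<Prod>j\<in>J. prob (A j))" by simp
qed

lemma (in prob_space) indep_vars_reindex:
  assumes "inj_on t I" "indep_vars M' X (t ` I)"
  shows "indep_vars (\<lambda>i. M' (t i)) (\<lambda>i. X (t i)) I"
  using assms indep_sets_reindex[of t I "\<lambda>i. {X i -` A \<inter> space M | A. A \<in> sets (M' i)}"]
  unfolding indep_vars_def2 by simp

text \<open>The shift turns observations numbered from 1 into coordinates numbered from 0, so that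
  almost-sure statements on the product space pull back to the original one.\<close>

lemma (in prob_space) distr_shift_eq_PiM:
  fixes Y :: "nat \<Rightarrow> 'a \<Rightarrow> 'y"
  assumes indep: "indep_vars (\<lambda>_. N) Y {1..}"
    and distr: "\<And>i. i \<ge> 1 \<Longrightarrow> distr M N (Y i) = P"
  shows "(\<lambda>\<omega> i. Y (Suc i) \<omega>) \<in> M \<rightarrow>\<^sub>M (\<Pi>\<^sub>M i\<in>UNIV. N)"
    "distr M (\<Pi>\<^sub>M i\<in>UNIV. N) (\<lambda>\<omega> i. Y (Suc i) \<omega>) = (\<Pi>\<^sub>M i\<in>UNIV. P)"
proof -
  have "Suc ` UNIV = {1..}" by (auto simp: image_iff Suc_le_eq gr0_conv_Suc)
  then have shift: "indep_vars (\<lambda>_. N) (\<lambda>i. Y (Suc i)) UNIV"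
    using indep_vars_reindex[of Suc UNIV "\<lambda>_. N" Y] indep by simp
  then have rv: "random_variable N (Y (Suc i))" for i by (simp add: indep_vars_def2)
  show "(\<lambda>\<omega> i. Y (Suc i) \<omega>) \<in> M \<rightarrow>\<^sub>M (\<Pi>\<^sub>M i\<in>UNIV. N)"
  proof -
    have "(\<lambda>\<omega>. \<lambda>i\<in>UNIV. Y (Suc i) \<omega>) \<in> M \<rightarrow>\<^sub>M (\<Pi>\<^sub>M i\<in>UNIV. N)"
      by (rule measurable_restrict) (rule rv)
    then show ?thesis by (simp add: restrict_def)
  qed
  have "distr M (\<Pi>\<^sub>M i\<in>UNIV. N) (\<lambda>\<omega>. \<lambda>i\<in>UNIV. Y (Suc i) \<omega>)
      = (\<Pi>\<^sub>M i\<in>UNIV. distr M N (Y (Suc i)))"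
    using shift by (subst (asm) indep_vars_iff_distr_eq_PiM) (simp_all add: rv)
  then show "distr M (\<Pi>\<^sub>M i\<in>UNIV. N) (\<lambda>\<omega> i. Y (Suc i) \<omega>) = (\<Pi>\<^sub>M i\<in>UNIV. P)"
    by (simp add: distr restrict_def)
qed

section \<open>Martingale differences on a product space\<close>

text \<open>Stands in for measurability with respect to the first \<open>n\<close> coordinates,
  \<open>0\<close> to \<open>n - 1\<close>. Being pointwise, it lets a resampling of coordinate
  \<open>n\<close> or of a later one leave \<open>H\<close> exactly unchanged.\<close>

definition depends_on_past :: "nat \<Rightarrow> ((nat \<Rightarrow> 'y) \<Rightarrow> 'a) \<Rightarrow> bool" where
  "depends_on_past n H \<longleftrightarrow> (\<forall>z z'. (\<forall>j<n. z j = z' j) \<longrightarrow> H z = H z')"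

lemma depends_on_pastD:
  "depends_on_past n H \<Longrightarrow> (\<And>j. j < n \<Longrightarrow> z j = z' j) \<Longrightarrow> H z = H z'"
  unfolding depends_on_past_def by blast

lemma depends_on_past_fun_upd:
  "depends_on_past n H \<Longrightarrow> n \<le> i \<Longrightarrow> H (z(i := y)) = H z"
  by (erule depends_on_pastD) auto

locale iid_sequence = prob_space P for P :: "'y measure"
begin

abbreviation S :: "(nat \<Rightarrow> 'y) measure" where
  "S \<equiv> Pi\<^sub>M UNIV (\<lambda>_. P)"

lemma prob_space_S: "prob_space S"
  by (intro prob_space_PiM prob_space_axioms)

sublocale S: prob_space S by (rule prob_space_S)
sublocale PS: pair_prob_space S P ..

lemma measurable_resample [measurable]:
  "(\<lambda>(z, y). z(i := y)) \<in> S \<Otimes>\<^sub>M P \<rightarrow>\<^sub>M S"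
proof -
  have "(\<lambda>p. (fst p)(i := snd p)) \<in> S \<Otimes>\<^sub>M P \<rightarrow>\<^sub>M Pi\<^sub>M (insert i UNIV) (\<lambda>_. P)"
    by (rule measurable_fun_upd[where J=UNIV]) auto
  then show ?thesis by (simp add: case_prod_beta')
qed

text \<open>Coordinate \<open>i\<close> has law \<open>P\<close> and is independent of the others,
  so a fresh copy in its place does not change the joint law. Together with Fubini this plays the
  part of the tower property.\<close>

lemma distr_resample: "distr (S \<Otimes>\<^sub>M P) S (\<lambda>(z, y). z(i := y)) = S"
proof -
  interpret PS': pair_prob_space P S ..
  have "distr (P \<Otimes>\<^sub>M S) S (\<lambda>(y, z). z(i := y)) = S"
    using distr_pair_PiM_eq_PiM[of UNIV "\<lambda>_. P" i] prob_space_axioms by simp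
  moreover have "distr (P \<Otimes>\<^sub>M S) S (\<lambda>(y, z). z(i := y))
      = distr (S \<Otimes>\<^sub>M P) S (\<lambda>(z, y). z(i := y))"
    by (subst PS.distr_pair_swap[symmetric] | subst PS'.distr_pair_swap, subst distr_distr)
       (auto simp: comp_def case_prod_beta' intro!: arg_cong[where f="distr _ _"])
  ultimately show ?thesis by simp
qed

lemma nn_integral_resample:
  assumes [measurable]: "f \<in> borel_measurable S"
  shows "(\<integral>\<^sup>+z. f z \<partial>S) = (\<integral>\<^sup>+z. \<integral>\<^sup>+y. f (z(i := y)) \<partial>P \<partial>S)"
proof -
  have "(\<integral>\<^sup>+z. f z \<partial>S) = (\<integral>\<^sup>+z. f z \<partial>distr (S \<Otimes>\<^sub>M P) S (\<lambda>(z, y). z(i := y)))"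
    by (simp add: distr_resample)
  also have "\<dots> = (\<integral>\<^sup>+p. f ((fst p)(i := snd p)) \<partial>(S \<Otimes>\<^sub>M P))"
    by (subst nn_integral_distr) (auto simp: case_prod_beta')
  also have "\<dots> = (\<integral>\<^sup>+z. \<integral>\<^sup>+y. f (z(i := y)) \<partial>P \<partial>S)"
    by (subst nn_integral_fst[symmetric]) (use measurable_resample[of i] in \<open>auto simp: case_prod_beta'\<close>)
  finally show ?thesis .
qed

lemma integral_resample:
  fixes f :: "_ \<Rightarrow> real"
  assumes "integrable S f"
  shows "(\<integral>z. f z \<partial>S) = (\<integral>z. \<integral>y. f (z(i := y)) \<partial>P \<partial>S)"
proof -
  have [measurable]: "f \<in> borel_measurable S" using assms by auto
  have int: "integrable (S \<Otimes>\<^sub>M P) (\<lambda>(z, y). f (z(i := y)))"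
    using assms by (subst (asm) distr_resample[of i, symmetric])
      (subst (asm) integrable_distr_eq, auto simp: case_prod_beta')
  have "(\<integral>z. f z \<partial>S) = (\<integral>z. f z \<partial>distr (S \<Otimes>\<^sub>M P) S (\<lambda>(z, y). z(i := y)))"
    by (simp add: distr_resample)
  also have "\<dots> = (\<integral>p. f ((fst p)(i := snd p)) \<partial>(S \<Otimes>\<^sub>M P))"
    by (subst integral_distr) (auto simp: case_prod_beta')
  also have "\<dots> = (\<integral>z. \<integral>y. f (z(i := y)) \<partial>P \<partial>S)"
    using PS.integral_fst'[OF int[unfolded case_prod_beta']] by simp
  finally show ?thesis .
qed

text \<open>A martingale difference: on the product space, the conditional expectation given the first \<open>n\<close>
  coordinates is the integral over a resampled coordinate \<open>n\<close>, the later ones being irrelevant.\<close>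

definition innovation :: "nat \<Rightarrow> ((nat \<Rightarrow> 'y) \<Rightarrow> real) \<Rightarrow> bool" where
  "innovation n X \<longleftrightarrow> X \<in> borel_measurable S \<and> integrable S (\<lambda>z. (X z)\<^sup>2) \<and>
     depends_on_past (Suc n) X \<and> (\<forall>z\<in>space S. (\<integral>y. X (z(n := y)) \<partial>P) = 0)"

text \<open>Resampling coordinate \<open>n\<close> fixes \<open>H\<close>, and the inner integral of
  \<open>X\<close> vanishes.\<close>

lemma innovation_orthogonal:
  assumes X: "innovation n X" and [measurable]: "H \<in> borel_measurable S"
    and "integrable S (\<lambda>z. (H z)\<^sup>2)" and past: "depends_on_past n H"
  shows "integrable S (\<lambda>z. H z * X z)" "(\<integral>z. H z * X z \<partial>S) = 0"
proof -
  have [measurable]: "X \<in> borel_measurable S" using X by (simp add: innovation_def)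
  show int: "integrable S (\<lambda>z. H z * X z)"
    using X assms(3) by (intro integrable_mult_of_squares) (auto simp: innovation_def)
  have "(\<integral>z. H z * X z \<partial>S) = (\<integral>z. \<integral>y. H (z(n := y)) * X (z(n := y)) \<partial>P \<partial>S)"
    by (rule integral_resample[OF int])
  also have "\<dots> = (\<integral>z. H z * (\<integral>y. X (z(n := y)) \<partial>P) \<partial>S)"
    by (simp add: depends_on_past_fun_upd[OF past])
  also have "\<dots> = (\<integral>z. 0 \<partial>S)"
    using X by (intro Bochner_Integration.integral_cong) (auto simp: innovation_def)
  finally show "(\<integral>z. H z * X z \<partial>S) = 0" by simp
qed

text \<open>A martingale transform by predictable switches \<open>A i\<close>: the mixed terms
  vanish by orthogonality, and the switches only remove parts of the squares.\<close>

lemma innovation_transform_square: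
  assumes X: "\<And>i. innovation i (X i)"
    and A [measurable]: "\<And>i. Measurable.pred S (A i)" and past: "\<And>i. depends_on_past i (A i)"
  shows "integrable S (\<lambda>z. (\<Sum>i<n. if A i z then X i z else 0)\<^sup>2) \<and>
    (\<integral>z. (\<Sum>i<n. if A i z then X i z else 0)\<^sup>2 \<partial>S) \<le> (\<Sum>i<n. \<integral>z. (X i z)\<^sup>2 \<partial>S)"
proof (induction n)
  case (Suc n)
  have Xm [measurable]: "X i \<in> borel_measurable S" for i using X by (simp add: innovation_def)
  define T where "T z = (\<Sum>i<n. if A i z then X i z else 0)" for z
  have [measurable]: "T \<in> borel_measurable S" unfolding T_def by measurable
  \<comment> \<open>The switch of the new term is moved into the past factor, which gives the mixed
    term the form required by \<open>innovation_orthogonal\<close>.\<close>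
  define H where "H z = (if A n z then T z else 0)" for z
  have [measurable]: "H \<in> borel_measurable S" unfolding H_def by measurable
  have T2: "integrable S (\<lambda>z. (T z)\<^sup>2)" and Tle: "(\<integral>z. (T z)\<^sup>2 \<partial>S) \<le> (\<Sum>i<n. \<integral>z. (X i z)\<^sup>2 \<partial>S)"
    using Suc by (auto simp: T_def)
  have H2: "integrable S (\<lambda>z. (H z)\<^sup>2)"
    by (rule Bochner_Integration.integrable_bound[OF T2]) (auto simp: H_def)
  have X2: "integrable S (\<lambda>z. (X n z)\<^sup>2)" using X by (simp add: innovation_def)
  have XA2: "integrable S (\<lambda>z. (if A n z then X n z else 0)\<^sup>2)"
    by (rule Bochner_Integration.integrable_bound[OF X2]) auto
  have XAle: "(\<integral>z. (if A n z then X n z else 0)\<^sup>2 \<partial>S) \<le> (\<integral>z. (X n z)\<^sup>2 \<partial>S)"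
    by (rule integral_mono[OF XA2 X2]) auto
  have pastH: "depends_on_past n H"
    unfolding depends_on_past_def
  proof (intro allI impI)
    fix z z' assume eq: "\<forall>j<n. z j = (z' j :: 'y)"
    have "A i z = A i z'" if "i \<le> n" for i
      using eq that by (intro depends_on_pastD[OF past[of i]]) auto
    moreover have "X i z = X i z'" if "i < n" for i
      using eq that X[of i] unfolding innovation_def by (intro depends_on_pastD[of "Suc i" "X i"]) auto
    ultimately have "T z = T z'" "A n z = A n z'"
      unfolding T_def by (auto intro!: sum.cong)
    then show "H z = H z'" by (simp add: H_def)
  qed
  note orth = innovation_orthogonal[OF X[of n] _ H2 pastH]
  have eq: "(\<Sum>i<Suc n. if A i z then X i z else 0)\<^sup>2
      = (T z)\<^sup>2 + 2 * (H z * X n z) + (if A n z then X n z else 0)\<^sup>2" for z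
    by (simp add: T_def H_def power2_sum algebra_simps)
  have "integrable S (\<lambda>z. (T z)\<^sup>2 + 2 * (H z * X n z) + (if A n z then X n z else 0)\<^sup>2)"
    using T2 orth(1) XA2 by simp
  moreover have "(\<integral>z. (T z)\<^sup>2 + 2 * (H z * X n z) + (if A n z then X n z else 0)\<^sup>2 \<partial>S)
      = (\<integral>z. (T z)\<^sup>2 \<partial>S) + (\<integral>z. (if A n z then X n z else 0)\<^sup>2 \<partial>S)"
    using T2 orth XA2 by simp
  ultimately show ?case using Tle XAle unfolding eq by simp
qed simp

text \<open>\<open>T\<close> is the sum stopped at the first deviation of size
  \<open>\<epsilon>\<close>, written as a transform. On the event it keeps that deviation, so the
  second-moment bound for transforms and Markov's inequality give the estimate.\<close>

lemma kolmogorov_inequality: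
  assumes X: "\<And>i. innovation i (X i)" and "0 < \<epsilon>"
  defines "s \<equiv> \<lambda>j z. \<Sum>i<j. X i z"
  shows "S.prob {z\<in>space S. \<exists>j\<in>{m..n}. \<epsilon> \<le> \<bar>s j z - s m z\<bar>}
    \<le> (\<Sum>i=m..<n. \<integral>z. (X i z)\<^sup>2 \<partial>S) / \<epsilon>\<^sup>2"
proof -
  have Xm [measurable]: "X i \<in> borel_measurable S" for i using X by (simp add: innovation_def)
  have [measurable]: "s j \<in> borel_measurable S" for j unfolding s_def by measurable
  have pasts: "depends_on_past j (s j)" for j
    unfolding depends_on_past_def s_def
  proof (intro allI impI sum.cong refl)
    fix z z' i assume "\<forall>l<j. z l = (z' l :: 'y)" "i \<in> {..<j}"
    then show "X i z = X i z'"
      using X[of i] unfolding innovation_def by (intro depends_on_pastD[of "Suc i" "X i"]) auto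
  qed
  \<comment> \<open>\<open>s i\<close> involves only the coordinates below \<open>i\<close>, so the
    switch may include \<open>j = i\<close> and is still determined by the past of
    \<open>i\<close>.\<close>
  define A where "A i z \<longleftrightarrow> m \<le> i \<and> (\<forall>j\<in>{m..i}. \<bar>s j z - s m z\<bar> < \<epsilon>)" for i z
  have [measurable]: "Measurable.pred S (A i)" for i unfolding A_def by measurable
  have pastA: "depends_on_past i (A i)" for i
    unfolding depends_on_past_def
  proof (intro allI impI)
    fix z z' assume eq: "\<forall>j<i. z j = (z' j :: 'y)"
    have "s j z = s j z'" if "j \<le> i" for j
      using eq that by (intro depends_on_pastD[OF pasts]) auto
    then show "A i z = A i z'" by (auto simp: A_def)
  qed
  define T where "T z = (\<Sum>i<n. if A i z then X i z else 0)" for z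
  have [measurable]: "T \<in> borel_measurable S" unfolding T_def by measurable
  \<comment> \<open>Erasing the terms before \<open>m\<close> leaves \<open>T\<close> unchanged and
    restricts the variance sum to \<open>m \<le> i\<close>.\<close>
  define X' where "X' i = (\<lambda>z. if m \<le> i then X i z else 0)" for i
  have X': "innovation i (X' i)" for i
  proof (cases "m \<le> i")
    case True
    then show ?thesis using X[of i] by (simp add: X'_def)
  next
    case False
    then show ?thesis by (simp add: X'_def innovation_def depends_on_past_def)
  qed
  have T_X': "T z = (\<Sum>i<n. if A i z then X' i z else 0)" for z
    unfolding T_def X'_def by (intro sum.cong) (auto simp: A_def)
  have "integrable S (\<lambda>z. (T z)\<^sup>2)" and "(\<integral>z. (T z)\<^sup>2 \<partial>S) \<le> (\<Sum>i<n. \<integral>z. (X' i z)\<^sup>2 \<partial>S)"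
    using innovation_transform_square[of X' A n] X' pastA unfolding T_X' by auto
  moreover have "(\<Sum>i<n. \<integral>z. (X' i z)\<^sup>2 \<partial>S) = (\<Sum>i=m..<n. \<integral>z. (X i z)\<^sup>2 \<partial>S)"
  proof (rule sum.mono_neutral_cong_right)
    show "\<forall>i\<in>{..<n} - {m..<n}. (\<integral>z. (X' i z)\<^sup>2 \<partial>S) = 0"
    proof
      fix i assume "i \<in> {..<n} - {m..<n}"
      then have "\<not> m \<le> i" by auto
      then show "(\<integral>z. (X' i z)\<^sup>2 \<partial>S) = 0" by (simp add: X'_def)
    qed
  qed (simp_all add: X'_def subset_eq)
  ultimately have T2: "integrable S (\<lambda>z. (T z)\<^sup>2)"
    and Tle: "(\<integral>z. (T z)\<^sup>2 \<partial>S) \<le> (\<Sum>i=m..<n. \<integral>z. (X i z)\<^sup>2 \<partial>S)" by auto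
  have "\<epsilon>\<^sup>2 \<le> (T z)\<^sup>2" if ex: "\<exists>j\<in>{m..n}. \<epsilon> \<le> \<bar>s j z - s m z\<bar>" for z
  proof -
    define \<tau> where "\<tau> = (LEAST j. m \<le> j \<and> \<epsilon> \<le> \<bar>s j z - s m z\<bar>)"
    obtain j where j: "m \<le> j" "j \<le> n" "\<epsilon> \<le> \<bar>s j z - s m z\<bar>" using ex by auto
    have \<tau>: "m \<le> \<tau>" "\<epsilon> \<le> \<bar>s \<tau> z - s m z\<bar>"
      using LeastI[of "\<lambda>j. m \<le> j \<and> \<epsilon> \<le> \<bar>s j z - s m z\<bar>" j] j unfolding \<tau>_def by auto
    have "\<tau> \<le> n"
      using Least_le[of "\<lambda>j. m \<le> j \<and> \<epsilon> \<le> \<bar>s j z - s m z\<bar>" j] j unfolding \<tau>_def by auto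
    \<comment> \<open>The switches are on exactly from \<open>m\<close> up to the first deviation,
      excluded, so \<open>T\<close> telescopes to \<open>s \<tau> z - s m z\<close>.\<close>
    have "A i z \<longleftrightarrow> i \<in> {m..<\<tau>}" for i
    proof
      assume "A i z"
      then have "m \<le> i" and "\<And>j. j \<in> {m..i} \<Longrightarrow> \<bar>s j z - s m z\<bar> < \<epsilon>"
        by (auto simp: A_def)
      from this(2)[of \<tau>] this(1) show "i \<in> {m..<\<tau>}"
        using \<tau> by (cases "\<tau> \<le> i") auto
    next
      assume i: "i \<in> {m..<\<tau>}"
      have "\<bar>s j z - s m z\<bar> < \<epsilon>" if "j \<in> {m..i}" for j
        using not_less_Least[of j "\<lambda>j. m \<le> j \<and> \<epsilon> \<le> \<bar>s j z - s m z\<bar>"] i that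
        unfolding \<tau>_def[symmetric] by auto
      then show "A i z" using i by (auto simp: A_def)
    qed
    then have "T z = (\<Sum>i\<in>{..<n}. if i \<in> {m..<\<tau>} then X i z else 0)"
      unfolding T_def by simp
    also have "\<dots> = (\<Sum>i\<in>{..<n} \<inter> {m..<\<tau>}. X i z)"
      by (rule sum.inter_restrict[symmetric]) simp
    also have "{..<n} \<inter> {m..<\<tau>} = {m..<\<tau>}" using \<open>\<tau> \<le> n\<close> by auto
    also have "(\<Sum>i\<in>{m..<\<tau>}. X i z) = s \<tau> z - s m z"
      unfolding s_def lessThan_atLeast0 using sum_diff_nat_ivl[of 0 m \<tau> "\<lambda>i. X i z"] \<tau> by simp
    finally have "\<epsilon> \<le> \<bar>T z\<bar>" using \<tau> by simp
    then show ?thesis using \<open>0 < \<epsilon>\<close> by (metis abs_le_square_iff abs_of_pos)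
  qed
  then have "S.prob {z\<in>space S. \<exists>j\<in>{m..n}. \<epsilon> \<le> \<bar>s j z - s m z\<bar>} \<le> S.prob {z\<in>space S. \<epsilon>\<^sup>2 \<le> (T z)\<^sup>2}"
    by (intro S.finite_measure_mono) auto
  also have "\<dots> \<le> (\<integral>z. (T z)\<^sup>2 \<partial>S) / \<epsilon>\<^sup>2"
    using integral_Markov_inequality_measure[OF T2, of "{}" "\<epsilon>\<^sup>2"] \<open>0 < \<epsilon>\<close> by simp
  also have "\<dots> \<le> (\<Sum>i=m..<n. \<integral>z. (X i z)\<^sup>2 \<partial>S) / \<epsilon>\<^sup>2"
    using Tle by (simp add: divide_right_mono)
  finally show ?thesis .
qed

text \<open>By the maximal inequality, a deviation of at least \<open>\<epsilon>\<close> from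
  \<open>s m\<close> after \<open>m\<close> has probability at most a tail of the variance series
  over \<open>\<epsilon>\<^sup>2\<close>; letting \<open>m\<close> grow, the partial sums are almost
  surely Cauchy.\<close>

lemma innovation_series_converges:
  assumes X: "\<And>i. innovation i (X i)" and var: "summable (\<lambda>i. \<integral>z. (X i z)\<^sup>2 \<partial>S)"
  shows "AE z in S. summable (\<lambda>i. X i z)"
proof -
  have Xm [measurable]: "X i \<in> borel_measurable S" for i using X by (simp add: innovation_def)
  define s where "s j z = (\<Sum>i<j. X i z)" for j z
  have [measurable]: "s j \<in> borel_measurable S" for j unfolding s_def by measurable
  let ?V = "\<lambda>i. \<integral>z. (X i z)\<^sup>2 \<partial>S"
  define B where "B \<epsilon> m n = {z\<in>space S. \<exists>j\<in>{m..n}. \<epsilon> \<le> \<bar>s j z - s m z\<bar>}" for \<epsilon> m n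
  have B [measurable]: "B \<epsilon> m n \<in> sets S" for \<epsilon> m n unfolding B_def by measurable
  have B_mono: "B \<epsilon> m n \<subseteq> B \<epsilon> m n'" if "n \<le> n'" for \<epsilon> m n n'
  proof
    fix z assume "z \<in> B \<epsilon> m n"
    then obtain j where "z \<in> space S" "j \<in> {m..n}" "\<epsilon> \<le> \<bar>s j z - s m z\<bar>"
      by (auto simp: B_def)
    then show "z \<in> B \<epsilon> m n'"
      using that unfolding B_def by (intro CollectI conjI bexI[of _ j]) auto
  qed
  have prob_B: "S.prob (\<Union>n. B \<epsilon> m n) \<le> (\<Sum>i. ?V (i + m)) / \<epsilon>\<^sup>2" if "0 < \<epsilon>" for \<epsilon> m
  proof (rule LIMSEQ_le_const2)
    show "(\<lambda>n. S.prob (B \<epsilon> m n)) \<longlonglongrightarrow> S.prob (\<Union>n. B \<epsilon> m n)"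
      by (intro S.finite_Lim_measure_incseq) (auto simp: incseq_def dest: B_mono[THEN subsetD])
    have "S.prob (B \<epsilon> m n) \<le> (\<Sum>i. ?V (i + m)) / \<epsilon>\<^sup>2" for n
    proof -
      have "S.prob (B \<epsilon> m n) \<le> (\<Sum>i=m..<n. ?V i) / \<epsilon>\<^sup>2"
        using kolmogorov_inequality[OF X that, of m n] by (simp add: B_def s_def)
      also have "(\<Sum>i=m..<n. ?V i) \<le> (\<Sum>i<n. ?V (i + m))"
      proof (cases "m \<le> n")
        case True
        have "(\<Sum>i=m..<n. ?V i) = (\<Sum>i=0..<n - m. ?V (i + m))"
          using sum.shift_bounds_nat_ivl[of ?V 0 m "n - m"] True by simp
        also have "\<dots> \<le> (\<Sum>i<n. ?V (i + m))" by (intro sum_mono2) auto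
        finally show ?thesis .
      qed (simp add: sum_nonneg)
      also have "\<dots> \<le> (\<Sum>i. ?V (i + m))"
        using var by (intro sum_le_suminf) (auto simp: summable_iff_shift[of ?V])
      finally show ?thesis by (simp add: divide_right_mono)
    qed
    then show "\<exists>N. \<forall>n\<ge>N. S.prob (B \<epsilon> m n) \<le> (\<Sum>i. ?V (i + m)) / \<epsilon>\<^sup>2" by blast
  qed
  have "AE z in S. \<exists>m. \<forall>n. z \<notin> B \<epsilon> m n" if "0 < \<epsilon>" for \<epsilon>
  proof -
    have "S.prob (\<Inter>m. \<Union>n. B \<epsilon> m n) \<le> (\<Sum>i. ?V (i + m)) / \<epsilon>\<^sup>2" for m
    proof -
      have "S.prob (\<Inter>m. \<Union>n. B \<epsilon> m n) \<le> S.prob (\<Union>n. B \<epsilon> m n)"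
        by (intro S.finite_measure_mono) auto
      also note prob_B[OF that, of m]
      finally show ?thesis .
    qed
    moreover have "(\<lambda>m. (\<Sum>i. ?V (i + m)) / \<epsilon>\<^sup>2) \<longlonglongrightarrow> 0 / \<epsilon>\<^sup>2"
      using that by (intro tendsto_divide suminf_exist_split2[OF var]) auto
    ultimately have "S.prob (\<Inter>m. \<Union>n. B \<epsilon> m n) \<le> 0 / \<epsilon>\<^sup>2"
      by (intro LIMSEQ_le_const) auto
    then have "S.prob (\<Inter>m. \<Union>n. B \<epsilon> m n) = 0" by (simp add: measure_le_0_iff)
    moreover have "(\<Inter>m. \<Union>n. B \<epsilon> m n) \<in> sets S" by measurable
    ultimately have "AE z in S. z \<notin> (\<Inter>m. \<Union>n. B \<epsilon> m n)"
      using S.prob_eq_0 by blast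
    then show ?thesis by simp
  qed
  then have "AE z in S. \<forall>k::nat. \<exists>m. \<forall>n. z \<notin> B (1 / real (Suc k)) m n"
    by (subst AE_all_countable) simp
  with AE_space show ?thesis
  proof eventually_elim
    case (elim z)
    have "Cauchy (\<lambda>j. s j z)"
      unfolding Cauchy_altdef2
    proof (intro allI impI)
      fix e :: real assume "0 < e"
      then obtain k where k: "1 / real (Suc k) < e" using nat_approx_posE by blast
      obtain m where m: "\<And>n. z \<notin> B (1 / real (Suc k)) m n"
        using elim(2)[rule_format, of k] by auto
      have "dist (s j z) (s m z) < e" if "m \<le> j" for j
      proof -
        have "\<not> 1 / real (Suc k) \<le> \<bar>s j z - s m z\<bar>"
          using m[of j] that elim(1) unfolding B_def by (metis (mono_tags, lifting) CollectI atLeastAtMost_iff order_refl)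
        then show ?thesis using k by (simp add: dist_real_def)
      qed
      then show "\<exists>N. \<forall>n\<ge>N. dist (s n z) (s N z) < e" by blast
    qed
    then show ?case
      unfolding s_def by (simp add: Cauchy_convergent_iff summable_iff_convergent)
  qed
qed

text \<open>\<open>F i z\<close> is a function chosen by the past and then evaluated at the new
  coordinate \<open>z i\<close>; centring it gives an innovation of variance at most
  \<open>(c i)\<^sup>2 * C\<close>. The scale \<open>c\<close> is the weight sequence in the drift
  estimates and \<open>1 / real (Suc i)\<close> in the strong law.\<close>

lemma centred_series_converges:
  fixes F :: "nat \<Rightarrow> (nat \<Rightarrow> 'y) \<Rightarrow> 'y \<Rightarrow> real" and c :: "nat \<Rightarrow> real"
  assumes F [measurable]: "\<And>i. (\<lambda>(z, y). F i z y) \<in> borel_measurable (S \<Otimes>\<^sub>M P)"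
    and past: "\<And>i. depends_on_past i (F i)"
    and bound: "\<And>i z. z \<in> space S \<Longrightarrow> (\<integral>\<^sup>+y. ennreal ((F i z y)\<^sup>2) \<partial>P) \<le> ennreal C"
    and c: "summable (\<lambda>i. (c i)\<^sup>2)" and "0 \<le> C"
  shows "AE z in S. summable (\<lambda>i. c i * (F i z (z i) - (\<integral>y. F i z y \<partial>P)))"
proof -
  have Fy [measurable]: "F i z \<in> borel_measurable P" if "z \<in> space S" for i z
    using measurable_Pair2[OF F that, of i] by simp
  have F2: "integrable P (\<lambda>y. (F i z y)\<^sup>2)" if z: "z \<in> space S" for i z
    using le_less_trans[OF bound[OF z, of i]] Fy[OF z] by (intro integrableI_nonneg) auto
  have Fi: "integrable P (F i z)" if z: "z \<in> space S" for i z
    using Fy[OF z] F2[OF z] by (rule square_integrable_imp_integrable)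
  have F2le: "(\<integral>y. (F i z y)\<^sup>2 \<partial>P) \<le> C" if z: "z \<in> space S" for i z
    using bound[OF z, of i] F2[OF z, of i] \<open>0 \<le> C\<close>
    by (simp add: nn_integral_eq_integral ennreal_le_iff)
  define E where "E i z = (\<integral>y. F i z y \<partial>P)" for i z
  have [measurable]: "E i \<in> borel_measurable S" for i
    unfolding E_def by measurable
  define X where "X i z = c i * (F i z (z i) - E i z)" for i z
  have Fz [measurable]: "(\<lambda>z. F i z (z i)) \<in> borel_measurable S" for i
    using measurable_compose[OF _ F[of i], of "\<lambda>z. (z, z i)" S] by simp
  have [measurable]: "X i \<in> borel_measurable S" for i unfolding X_def by measurable
  have Fu: "F i (z(i := y)) = F i z" for i z y
    by (rule depends_on_past_fun_upd[OF past]) simp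
  have X_upd: "X i (z(i := y)) = c i * (F i z y - E i z)" for i z y
    by (simp add: X_def E_def Fu)
  have var: "(\<integral>\<^sup>+z. ennreal ((X i z)\<^sup>2) \<partial>S) \<le> ennreal ((c i)\<^sup>2 * C)" for i
  proof -
    have "(\<integral>\<^sup>+z. ennreal ((X i z)\<^sup>2) \<partial>S) = (\<integral>\<^sup>+z. \<integral>\<^sup>+y. ennreal ((c i * (F i z y - E i z))\<^sup>2) \<partial>P \<partial>S)"
      by (subst nn_integral_resample[of _ i]) (auto simp: X_upd)
    also have "\<dots> \<le> (\<integral>\<^sup>+z. ennreal ((c i)\<^sup>2 * C) \<partial>S)"
    proof (rule nn_integral_mono)
      fix z assume z: "z \<in> space S"
      have "integrable P (\<lambda>y. (F i z y - E i z)\<^sup>2)"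
        unfolding power2_diff using F2[OF z] Fi[OF z] by simp
      then have "(\<integral>\<^sup>+y. ennreal ((c i * (F i z y - E i z))\<^sup>2) \<partial>P)
          = ennreal ((c i)\<^sup>2 * (\<integral>y. (F i z y - E i z)\<^sup>2 \<partial>P))"
        by (subst nn_integral_eq_integral) (auto simp: power_mult_distrib)
      also have "(\<integral>y. (F i z y - E i z)\<^sup>2 \<partial>P) = (\<integral>y. (F i z y)\<^sup>2 \<partial>P) - (E i z)\<^sup>2"
        unfolding E_def using variance_eq[OF Fi[OF z] F2[OF z]] .
      also have "ennreal ((c i)\<^sup>2 * ((\<integral>y. (F i z y)\<^sup>2 \<partial>P) - (E i z)\<^sup>2)) \<le> ennreal ((c i)\<^sup>2 * C)"
        using F2le[OF z, of i] by (intro ennreal_leI mult_left_mono) (auto simp: algebra_simps add_increasing2)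
      finally show "(\<integral>\<^sup>+y. ennreal ((c i * (F i z y - E i z))\<^sup>2) \<partial>P) \<le> ennreal ((c i)\<^sup>2 * C)" .
    qed
    also have "\<dots> = ennreal ((c i)\<^sup>2 * C)" by (simp add: S.emeasure_space_1)
    finally show ?thesis .
  qed
  have X2: "integrable S (\<lambda>z. (X i z)\<^sup>2)" for i
    using le_less_trans[OF var[of i]] by (intro integrableI_nonneg) auto
  have X2le: "(\<integral>z. (X i z)\<^sup>2 \<partial>S) \<le> (c i)\<^sup>2 * C" for i
    using var[of i] X2[of i] \<open>0 \<le> C\<close> by (simp add: nn_integral_eq_integral ennreal_le_iff)
  have "innovation i (X i)" for i
    unfolding innovation_def
  proof (intro conjI ballI X2)
    show "depends_on_past (Suc i) (X i)"
      unfolding depends_on_past_def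
    proof (intro allI impI)
      fix z z' assume eq: "\<forall>j<Suc i. z j = (z' j :: 'y)"
      then have "F i z = F i z'" by (intro depends_on_pastD[OF past]) auto
      then show "X i z = X i z'" using eq by (simp add: X_def E_def)
    qed
    fix z assume z: "z \<in> space S"
    show "(\<integral>y. X i (z(i := y)) \<partial>P) = 0"
      unfolding X_upd using Fi[OF z] by (simp add: E_def[symmetric] prob_space)
  qed simp
  moreover have "summable (\<lambda>i. \<integral>z. (X i z)\<^sup>2 \<partial>S)"
    by (rule summable_comparison_test'[OF summable_mult2[OF c, of C], of 0]) (use X2le in auto)
  ultimately show ?thesis
    using innovation_series_converges[of X] by (simp add: X_def E_def)
qed

text \<open>The expectation of the whole series is finite by monotone convergence. Only first
  moments enter, which is what is available for the quadratic error terms.\<close>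

lemma nonneg_series_converges:
  fixes F :: "nat \<Rightarrow> (nat \<Rightarrow> 'y) \<Rightarrow> 'y \<Rightarrow> real" and c :: "nat \<Rightarrow> real"
  assumes F [measurable]: "\<And>i. (\<lambda>(z, y). F i z y) \<in> borel_measurable (S \<Otimes>\<^sub>M P)"
    and past: "\<And>i. depends_on_past i (F i)"
    and nonneg: "\<And>i z y. 0 \<le> F i z y"
    and bound: "\<And>i z. z \<in> space S \<Longrightarrow> (\<integral>\<^sup>+y. ennreal (F i z y) \<partial>P) \<le> ennreal C"
    and c: "summable c" "\<And>i. 0 \<le> c i" and "0 \<le> C"
  shows "AE z in S. summable (\<lambda>i. c i * F i z (z i))"
proof -
  have Fz [measurable]: "(\<lambda>z. F i z (z i)) \<in> borel_measurable S" for i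
    using measurable_compose[OF _ F[of i], of "\<lambda>z. (z, z i)" S] by simp
  have Fu: "F i (z(i := y)) = F i z" for i z y
    by (rule depends_on_past_fun_upd[OF past]) simp
  have le: "(\<integral>\<^sup>+z. ennreal (c i * F i z (z i)) \<partial>S) \<le> ennreal (c i * C)" for i
  proof -
    have "(\<integral>\<^sup>+z. ennreal (c i * F i z (z i)) \<partial>S) = (\<integral>\<^sup>+z. \<integral>\<^sup>+y. ennreal (c i * F i z y) \<partial>P \<partial>S)"
      by (subst nn_integral_resample[of _ i]) (auto simp: Fu)
    also have "\<dots> \<le> (\<integral>\<^sup>+z. ennreal (c i * C) \<partial>S)"
    proof (rule nn_integral_mono)
      fix z assume z: "z \<in> space S"
      have "(\<integral>\<^sup>+y. ennreal (c i * F i z y) \<partial>P) = ennreal (c i) * (\<integral>\<^sup>+y. ennreal (F i z y) \<partial>P)"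
        using c(2) nonneg measurable_Pair2[OF F z, of i]
        by (subst nn_integral_cmult[symmetric]) (auto simp: ennreal_mult)
      also have "\<dots> \<le> ennreal (c i * C)"
        using bound[OF z, of i] c(2) \<open>0 \<le> C\<close> by (auto simp: ennreal_mult intro!: mult_left_mono)
      finally show "(\<integral>\<^sup>+y. ennreal (c i * F i z y) \<partial>P) \<le> ennreal (c i * C)" .
    qed
    also have "\<dots> = ennreal (c i * C)" by (simp add: S.emeasure_space_1)
    finally show ?thesis .
  qed
  have "(\<integral>\<^sup>+z. (\<Sum>i. ennreal (c i * F i z (z i))) \<partial>S) = (\<Sum>i. \<integral>\<^sup>+z. ennreal (c i * F i z (z i)) \<partial>S)"
    by (rule nn_integral_suminf) simp
  also have "\<dots> \<le> (\<Sum>i. ennreal (c i * C))"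
    by (intro suminf_le le) auto
  also have "\<dots> = ennreal (\<Sum>i. c i * C)"
    using c \<open>0 \<le> C\<close> by (intro suminf_ennreal2 summable_mult2) auto
  also have "\<dots> < \<infinity>" by simp
  finally have "AE z in S. (\<Sum>i. ennreal (c i * F i z (z i))) \<noteq> \<infinity>"
    by (intro nn_integral_PInf_AE) auto
  then show ?thesis
    by eventually_elim (use c nonneg in \<open>auto intro!: summable_suminf_not_top\<close>)
qed

end

section \<open>Mixtures of a kernel with square-integrable ratios\<close>

text \<open>\<open>k\<close> is a kernel already divided by a reference mixture, so
  \<open>k_square\<close> and \<open>k_inverse\<close> are the ratio bound against the reference in
  its two directions.\<close>

locale mixture_kernel = iid_sequence P + nu: prob_space \<nu>
  for P :: "'y measure" and \<nu> :: "'u measure" +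
  fixes k :: "'u \<Rightarrow> 'y \<Rightarrow> real" and A :: real
  assumes k_measurable [measurable]: "(\<lambda>(u, y). k u y) \<in> borel_measurable (\<nu> \<Otimes>\<^sub>M P)"
    and k_nonneg: "y \<in> space P \<Longrightarrow> 0 \<le> k u y"
    and k_bounded: "y \<in> space P \<Longrightarrow> \<exists>B. \<forall>u. k u y \<le> B"
    and k_pos: "y \<in> space P \<Longrightarrow> AE u in \<nu>. 0 < k u y"
    and k_ratio: "(\<integral>\<^sup>+y. (ennreal (k u\<^sub>1 y) / ennreal (k u\<^sub>2 y))\<^sup>2 \<partial>P) \<le> ennreal A"
    and k_square: "(\<integral>\<^sup>+y. ennreal ((k u y)\<^sup>2) \<partial>P) \<le> ennreal A"
    and k_inverse: "(\<integral>\<^sup>+y. (1 / ennreal (k u y))\<^sup>2 \<partial>P) \<le> ennreal A"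
    and A_nonneg: "0 \<le> A"
    and space_nu: "space \<nu> = UNIV"
begin

text \<open>Boundedness makes \<open>k u y * g u\<close> bounded in \<open>u\<close> for each
  \<open>y\<close>, so that every \<open>mix g y\<close> is a finite integral. It is preserved by
  Bayes updates and convex combinations, and holds for the constant 1 with which the recursion
  starts.\<close>

definition dens :: "('u \<Rightarrow> real) \<Rightarrow> bool" where
  "dens g \<longleftrightarrow> g \<in> borel_measurable \<nu> \<and> (\<forall>u. 0 \<le> g u) \<and> (\<exists>B. \<forall>u. g u \<le> B) \<and> (\<integral>u. g u \<partial>\<nu>) = 1"

definition mix :: "('u \<Rightarrow> real) \<Rightarrow> 'y \<Rightarrow> real" where
  "mix g y = (\<integral>u. k u y * g u \<partial>\<nu>)"

lemma k_measurable_left [measurable]: "k u \<in> borel_measurable P"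
  using measurable_Pair2[OF k_measurable, of u] by (simp add: space_nu)

lemma k_measurable_right [measurable]: "y \<in> space P \<Longrightarrow> (\<lambda>u. k u y) \<in> borel_measurable \<nu>"
  using measurable_Pair1[OF k_measurable, of y] by simp

lemma dens_measurable [measurable_dest]: "dens g \<Longrightarrow> g \<in> borel_measurable \<nu>"
  by (simp add: dens_def)

lemma dens_nonneg: "dens g \<Longrightarrow> 0 \<le> g u"
  by (simp add: dens_def)

lemma dens_integral: "dens g \<Longrightarrow> (\<integral>u. g u \<partial>\<nu>) = 1"
  by (simp add: dens_def)

lemma integrable_bounded:
  fixes f :: "'u \<Rightarrow> real"
  assumes "f \<in> borel_measurable \<nu>" "\<And>u. 0 \<le> f u" "\<And>u. f u \<le> B"
  shows "integrable \<nu> f"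
  using assms by (intro nu.integrable_const_bound[of _ B]) auto

lemma dens_integrable:
  assumes "dens g"
  shows "integrable \<nu> g"
proof -
  obtain B where "\<And>u. g u \<le> B" using assms by (auto simp: dens_def)
  then show ?thesis using assms by (intro integrable_bounded[of g B]) (auto simp: dens_def)
qed

lemma k_dens_bounded:
  assumes "dens g" "y \<in> space P"
  shows "\<exists>B. \<forall>u. k u y * g u \<le> B"
proof -
  obtain B C where "\<And>u. k u y \<le> B" "\<And>u. g u \<le> C"
    using assms k_bounded[of y] by (auto simp: dens_def)
  then have "k u y * g u \<le> B * C" for u
    using assms k_nonneg[of y u] by (intro mult_mono) (auto simp: dens_def intro: order_trans)
  then show ?thesis by blast
qed

lemma k_dens_integrable:
  assumes "dens g" "y \<in> space P"
  shows "integrable \<nu> (\<lambda>u. k u y * g u)"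
proof -
  have [measurable]: "g \<in> borel_measurable \<nu>" "(\<lambda>u. k u y) \<in> borel_measurable \<nu>" using assms by auto
  obtain B where "\<And>u. k u y * g u \<le> B" using k_dens_bounded[OF assms] by blast
  then show ?thesis
    using assms by (intro integrable_bounded[where B=B]) (auto simp: dens_nonneg k_nonneg)
qed

lemma mix_measurable [measurable]:
  assumes "dens g"
  shows "mix g \<in> borel_measurable P"
proof -
  have [measurable]: "g \<in> borel_measurable \<nu>" using assms by auto
  have "(\<lambda>y. \<integral>u. k u y * g u \<partial>\<nu>) \<in> borel_measurable P" by measurable
  then show ?thesis by (simp add: mix_def[abs_def])
qed

lemma mix_pos:
  assumes g: "dens g" and y: "y \<in> space P"
  shows "0 < mix g y"
proof -
  have "0 \<le> mix g y"
    unfolding mix_def using assms by (intro integral_nonneg_AE) (auto simp: dens_nonneg k_nonneg)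
  moreover have "mix g y \<noteq> 0"
  proof
    assume "mix g y = 0"
    then have "AE u in \<nu>. k u y * g u = 0"
      using integral_nonneg_eq_0_iff_AE[OF k_dens_integrable[OF g y]] assms
      by (auto simp: mix_def dens_nonneg k_nonneg)
    with k_pos[OF y] have "AE u in \<nu>. g u = 0" by eventually_elim auto
    then have "(\<integral>u. g u \<partial>\<nu>) = 0" by (simp add: integral_eq_zero_AE)
    with dens_integral[OF g] show False by simp
  qed
  ultimately show ?thesis by simp
qed

section \<open>Second moments of ratios of mixtures\<close>

lemma prob_space_dens:
  assumes "dens g" shows "prob_space (density \<nu> (\<lambda>u. ennreal (g u)))"
proof (rule prob_spaceI)
  have "(\<integral>\<^sup>+u. ennreal (g u) \<partial>\<nu>) = ennreal (\<integral>u. g u \<partial>\<nu>)"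
    using assms by (intro nn_integral_eq_integral) (auto simp: dens_integrable dens_nonneg)
  then show "emeasure (density \<nu> (\<lambda>u. ennreal (g u))) (space (density \<nu> (\<lambda>u. ennreal (g u)))) = 1"
    using assms by (simp add: emeasure_density dens_integral cong: nn_integral_cong)
qed

lemma mix_eq_integral_density:
  assumes "dens g" "y \<in> space P"
  shows "mix g y = (\<integral>u. k u y \<partial>density \<nu> (\<lambda>u. ennreal (g u)))"
    and "integrable (density \<nu> (\<lambda>u. ennreal (g u))) (\<lambda>u. k u y)"
  using assms k_dens_integrable[OF assms]
  by (auto simp: mix_def integral_density integrable_density dens_nonneg mult.commute)

lemma nn_integral_average_le:
  assumes g: "dens g" and [measurable]: "(\<lambda>(y, u). F y u) \<in> borel_measurable (P \<Otimes>\<^sub>M \<nu>)"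
    and le: "\<And>u. (\<integral>\<^sup>+y. F y u \<partial>P) \<le> ennreal C"
  shows "(\<integral>\<^sup>+y. \<integral>\<^sup>+u. F y u \<partial>density \<nu> (\<lambda>u. ennreal (g u)) \<partial>P) \<le> ennreal C"
proof -
  have [measurable]: "g \<in> borel_measurable \<nu>" using g by auto
  interpret Q: prob_space "density \<nu> (\<lambda>u. ennreal (g u))" by (rule prob_space_dens[OF g])
  interpret PQ: pair_sigma_finite P "density \<nu> (\<lambda>u. ennreal (g u))" ..
  have "(\<integral>\<^sup>+y. \<integral>\<^sup>+u. F y u \<partial>density \<nu> (\<lambda>u. ennreal (g u)) \<partial>P)
      = (\<integral>\<^sup>+u. \<integral>\<^sup>+y. F y u \<partial>P \<partial>density \<nu> (\<lambda>u. ennreal (g u)))"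
    by (rule PQ.Fubini'[symmetric]) (simp cong: measurable_cong_sets sets_pair_measure_cong)
  also have "\<dots> \<le> (\<integral>\<^sup>+u. ennreal C \<partial>density \<nu> (\<lambda>u. ennreal (g u)))"
    by (intro nn_integral_mono le)
  also have "\<dots> = ennreal C" by (simp only: nn_integral_const Q.emeasure_space_1 mult_1_right)
  finally show ?thesis .
qed

text \<open>Jensen for the inverse square under the probability with density \<open>g\<close> moves
  the averaging out of the denominator; Tonelli then averages a bound that is uniform in
  \<open>u\<close>.\<close>

lemma divide_mix_le:
  fixes c :: "'y \<Rightarrow> real"
  assumes g: "dens g" and [measurable]: "c \<in> borel_measurable P"
    and nonneg: "\<And>y. y \<in> space P \<Longrightarrow> 0 \<le> c y"
    and le: "\<And>u. (\<integral>\<^sup>+y. (ennreal (c y) / ennreal (k u y))\<^sup>2 \<partial>P) \<le> ennreal A"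
  shows "(\<integral>\<^sup>+y. ennreal ((c y / mix g y)\<^sup>2) \<partial>P) \<le> ennreal A"
proof -
  interpret Q: prob_space "density \<nu> (\<lambda>u. ennreal (g u))" by (rule prob_space_dens[OF g])
  have "(\<integral>\<^sup>+y. ennreal ((c y / mix g y)\<^sup>2) \<partial>P) = (\<integral>\<^sup>+y. (ennreal (c y) / ennreal (mix g y))\<^sup>2 \<partial>P)"
    using nonneg mix_pos[OF g]
    by (intro nn_integral_cong) (simp add: divide_ennreal ennreal_power less_imp_le)
  also have "\<dots> \<le> (\<integral>\<^sup>+y. \<integral>\<^sup>+u. (ennreal (c y) / ennreal (k u y))\<^sup>2 \<partial>density \<nu> (\<lambda>u. ennreal (g u)) \<partial>P)"
    using g by (intro nn_integral_mono)
      (simp add: mix_eq_integral_density Q.square_divide_expectation_le k_nonneg)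
  also have "\<dots> \<le> ennreal A"
    by (rule nn_integral_average_le[OF g _ le]) measurable
  finally show ?thesis .
qed

text \<open>The counterpart of \<open>divide_mix_le\<close> for numerators, by Jensen for the
  square. The factor \<open>c\<close> is an \<open>ennreal\<close> because it will be the squared
  reciprocal of a kernel that may vanish.\<close>

lemma mix_times_le:
  fixes c :: "'y \<Rightarrow> ennreal"
  assumes g: "dens g" and [measurable]: "c \<in> borel_measurable P"
    and le: "\<And>u. (\<integral>\<^sup>+y. ennreal ((k u y)\<^sup>2) * c y \<partial>P) \<le> ennreal A"
  shows "(\<integral>\<^sup>+y. ennreal ((mix g y)\<^sup>2) * c y \<partial>P) \<le> ennreal A"
proof -
  interpret Q: prob_space "density \<nu> (\<lambda>u. ennreal (g u))" by (rule prob_space_dens[OF g])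
  have "(\<integral>\<^sup>+y. ennreal ((mix g y)\<^sup>2) * c y \<partial>P)
      \<le> (\<integral>\<^sup>+y. (\<integral>\<^sup>+u. ennreal ((k u y)\<^sup>2) \<partial>density \<nu> (\<lambda>u. ennreal (g u))) * c y \<partial>P)"
    using g by (intro nn_integral_mono mult_right_mono)
      (simp_all add: mix_eq_integral_density Q.square_expectation_le)
  also have "\<dots> = (\<integral>\<^sup>+y. \<integral>\<^sup>+u. ennreal ((k u y)\<^sup>2) * c y \<partial>density \<nu> (\<lambda>u. ennreal (g u)) \<partial>P)"
    by (intro nn_integral_cong nn_integral_multc[symmetric]) simp
  also have "\<dots> \<le> ennreal A"
    by (rule nn_integral_average_le[OF g _ le]) measurable
  finally show ?thesis .
qed

lemma square_mix_le: "dens g \<Longrightarrow> (\<integral>\<^sup>+y. ennreal ((mix g y)\<^sup>2) \<partial>P) \<le> ennreal A"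
  using mix_times_le[of g "\<lambda>_. 1"] k_square by simp

lemma inverse_square_mix_le: "dens g \<Longrightarrow> (\<integral>\<^sup>+y. ennreal ((1 / mix g y)\<^sup>2) \<partial>P) \<le> ennreal A"
  using divide_mix_le[of g "\<lambda>_. 1"] k_inverse by simp

lemma k_divide_mix_le: "dens g \<Longrightarrow> (\<integral>\<^sup>+y. ennreal ((k u y / mix g y)\<^sup>2) \<partial>P) \<le> ennreal A"
  using divide_mix_le[of g "k u"] k_ratio k_nonneg by simp

text \<open>Denominator and numerator are replaced by kernels one after the other, each by a
  convexity inequality, so the constant stays \<open>A\<close>.\<close>

lemma mix_divide_mix_le:
  assumes "dens g" "dens h"
  shows "(\<integral>\<^sup>+y. ennreal ((mix h y / mix g y)\<^sup>2) \<partial>P) \<le> ennreal A"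
proof (rule divide_mix_le[OF assms(1)])
  fix u
  have sq: "(ennreal a / b)\<^sup>2 = ennreal (a\<^sup>2) * (inverse b)\<^sup>2" if "0 \<le> a" for a b
    using that by (simp add: divide_ennreal_def power_mult_distrib ennreal_power)
  have "(\<integral>\<^sup>+y. ennreal ((mix h y)\<^sup>2) * (inverse (ennreal (k u y)))\<^sup>2 \<partial>P) \<le> ennreal A"
  proof (rule mix_times_le[OF assms(2)])
    fix u'
    show "(\<integral>\<^sup>+y. ennreal ((k u' y)\<^sup>2) * (inverse (ennreal (k u y)))\<^sup>2 \<partial>P) \<le> ennreal A"
      using k_ratio[of u' u] by (simp add: sq k_nonneg cong: nn_integral_cong)
  qed simp
  then show "(\<integral>\<^sup>+y. (ennreal (mix h y) / ennreal (k u y))\<^sup>2 \<partial>P) \<le> ennreal A"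
    using mix_pos[OF assms(2)] by (simp add: sq less_imp_le cong: nn_integral_cong)
qed (use assms mix_pos in \<open>auto simp: less_imp_le\<close>)

lemma square_integrable_le:
  fixes f :: "'y \<Rightarrow> real"
  assumes [measurable]: "f \<in> borel_measurable P" and le: "(\<integral>\<^sup>+y. ennreal ((f y)\<^sup>2) \<partial>P) \<le> ennreal C"
    and "0 \<le> C"
  shows "integrable P (\<lambda>y. (f y)\<^sup>2)" "(\<integral>y. (f y)\<^sup>2 \<partial>P) \<le> C" "integrable P f"
proof -
  show int: "integrable P (\<lambda>y. (f y)\<^sup>2)"
    using le_less_trans[OF le] by (intro integrableI_nonneg) auto
  then show "(\<integral>y. (f y)\<^sup>2 \<partial>P) \<le> C"
    using le \<open>0 \<le> C\<close> by (simp add: nn_integral_eq_integral)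
  show "integrable P f" by (rule square_integrable_imp_integrable[OF _ int]) simp
qed

lemma square_ln_mix_le:
  assumes "dens g"
  shows "(\<integral>\<^sup>+y. ennreal ((ln (mix g y))\<^sup>2) \<partial>P) \<le> ennreal (2 * A)"
proof -
  have "(\<integral>\<^sup>+y. ennreal ((ln (mix g y))\<^sup>2) \<partial>P)
      \<le> (\<integral>\<^sup>+y. ennreal ((mix g y)\<^sup>2) + ennreal ((1 / mix g y)\<^sup>2) \<partial>P)"
    using mix_pos[OF assms]
    by (intro nn_integral_mono) (simp add: ennreal_plus[symmetric] square_ln_le ennreal_leI del: ennreal_plus)
  also have "\<dots> \<le> ennreal A + ennreal A"
    using assms by (subst nn_integral_add)
      (auto intro!: add_mono square_mix_le inverse_square_mix_le)
  finally show ?thesis using A_nonneg by (simp add: ennreal_plus[symmetric] del: ennreal_plus)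
qed

section \<open>The expected log mixture as a concave functional\<close>

definition ell :: "('u \<Rightarrow> real) \<Rightarrow> real" where
  "ell g = (\<integral>y. ln (mix g y) \<partial>P)"

lemma ln_mix_integrable: "dens g \<Longrightarrow> integrable P (\<lambda>y. ln (mix g y))"
  by (rule square_integrable_le(3)[OF _ square_ln_mix_le]) (use A_nonneg in auto)

lemma mix_ratio:
  assumes "dens g" "dens h"
  shows "integrable P (\<lambda>y. mix h y / mix g y)" "integrable P (\<lambda>y. (mix h y / mix g y)\<^sup>2)"
    "(\<integral>y. (mix h y / mix g y)\<^sup>2 \<partial>P) \<le> A"
proof -
  have [measurable]: "mix g \<in> borel_measurable P" "mix h \<in> borel_measurable P"
    using assms by (auto intro: mix_measurable)
  have m: "(\<lambda>y. mix h y / mix g y) \<in> borel_measurable P" by measurable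
  note * = square_integrable_le[OF m mix_divide_mix_le[OF assms] A_nonneg]
  show "integrable P (\<lambda>y. mix h y / mix g y)" by (rule *(3))
  show "integrable P (\<lambda>y. (mix h y / mix g y)\<^sup>2)" by (rule *(1))
  show "(\<integral>y. (mix h y / mix g y)\<^sup>2 \<partial>P) \<le> A" by (rule *(2))
qed

text \<open>Concavity: the right-hand side is the directional derivative of \<open>ell\<close> at
  \<open>g\<close> towards \<open>h\<close>. Pointwise it is \<open>ln x \<le> x - 1\<close> for the
  ratio of the mixtures.\<close>

lemma ell_diff_le:
  assumes "dens g" "dens h"
  shows "ell h - ell g \<le> (\<integral>y. mix h y / mix g y \<partial>P) - 1"
proof -
  have "ell h - ell g = (\<integral>y. ln (mix h y) - ln (mix g y) \<partial>P)"
    unfolding ell_def using assms by (simp add: ln_mix_integrable)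
  also have "\<dots> \<le> (\<integral>y. mix h y / mix g y - 1 \<partial>P)"
  proof (rule integral_mono)
    fix y assume y: "y \<in> space P"
    then show "ln (mix h y) - ln (mix g y) \<le> mix h y / mix g y - 1"
      using ln_le_minus_one[of "mix h y / mix g y"] mix_pos[OF assms(1) y] mix_pos[OF assms(2) y]
      by (simp add: ln_div)
  qed (use assms in \<open>auto simp: ln_mix_integrable mix_ratio\<close>)
  also have "\<dots> = (\<integral>y. mix h y / mix g y \<partial>P) - 1"
    using assms by (simp add: mix_ratio prob_space)
  finally show ?thesis .
qed

lemma mix_ratio_le: 
  assumes "dens g" "dens h"
  shows "(\<integral>y. mix h y / mix g y \<partial>P) \<le> A + 1"
proof -
  have "(\<integral>y. mix h y / mix g y \<partial>P) \<le> (\<integral>y. (mix h y / mix g y)\<^sup>2 + 1 \<partial>P)"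
  proof (rule integral_mono)
    show "x \<le> x\<^sup>2 + 1" for x :: real
    proof -
      have "2 * x \<le> x\<^sup>2 + 1" using zero_le_power2[of "x - 1"] by (simp add: power2_diff)
      then show ?thesis using zero_le_power2[of x] by linarith
    qed
  qed (use assms in \<open>auto simp: mix_ratio\<close>)
  also have "\<dots> \<le> A + 1" using mix_ratio[OF assms] by (simp add: prob_space)
  finally show ?thesis .
qed

lemma dens_one: "dens (\<lambda>_. 1)"
  unfolding dens_def by (intro conjI allI exI[of _ 1]) (simp_all add: nu.prob_space)

lemma ell_bounded: "dens g \<Longrightarrow> ell g \<le> ell (\<lambda>_. 1) + A"
  using ell_diff_le[OF dens_one, of g] mix_ratio_le[OF dens_one, of g] by simp

lemma dens_combination:
  assumes g: "dens g" and h: "dens h" and w: "0 \<le> w" "w \<le> 1"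
  shows "dens (\<lambda>u. (1 - w) * g u + w * h u)"
proof -
  obtain B C where B: "\<And>u. g u \<le> B" and C: "\<And>u. h u \<le> C"
    using g h by (auto simp: dens_def)
  have "(1 - w) * g u + w * h u \<le> (1 - w) * B + w * C" for u
    using B[of u] C[of u] w by (intro add_mono mult_left_mono) auto
  then show ?thesis
    using g h w dens_integrable[OF g] dens_integrable[OF h] by (auto simp: dens_def)
qed

lemma mix_combination:
  assumes g: "dens g" and h: "dens h" and y: "y \<in> space P"
  shows "mix (\<lambda>u. (1 - w) * g u + w * h u) y = mix g y * (1 + w * (mix h y / mix g y - 1))"
proof -
  have "mix (\<lambda>u. (1 - w) * g u + w * h u) y = (\<integral>u. (1 - w) * (k u y * g u) + w * (k u y * h u) \<partial>\<nu>)"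
    unfolding mix_def by (intro Bochner_Integration.integral_cong) (auto simp: algebra_simps)
  also have "\<dots> = (1 - w) * mix g y + w * mix h y"
    unfolding mix_def using k_dens_integrable[OF g y] k_dens_integrable[OF h y] by simp
  finally have eq: "mix (\<lambda>u. (1 - w) * g u + w * h u) y = (1 - w) * mix g y + w * mix h y" .
  show ?thesis unfolding eq using mix_pos[OF g y] by (simp add: field_simps)
qed

text \<open>Quadratic lower counterpart of \<open>ell_diff_le\<close>: \<open>ln_one_plus_ge\<close>
  is integrated at the ratio minus one. As the ratio \<open>r\<close> is positive,
  \<open>(r - 1)\<^sup>2 \<le> r\<^sup>2 + 1\<close>, whence \<open>A + 1\<close>.\<close>

lemma ell_combination_ge:
  assumes g: "dens g" and h: "dens h" and w: "0 \<le> w" "w < 1"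
  shows "ell g + w * ((\<integral>y. mix h y / mix g y \<partial>P) - 1) - w\<^sup>2 / (1 - w) * (A + 1)
    \<le> ell (\<lambda>u. (1 - w) * g u + w * h u)"
proof -
  let ?c = "\<lambda>u. (1 - w) * g u + w * h u"
  let ?r = "\<lambda>y. mix h y / mix g y"
  note c = dens_combination[OF g h w(1) less_imp_le[OF w(2)]]
  have "w * ((\<integral>y. ?r y \<partial>P) - 1) - w\<^sup>2 / (1 - w) * (A + 1)
      \<le> w * ((\<integral>y. ?r y \<partial>P) - 1) - w\<^sup>2 / (1 - w) * ((\<integral>y. (?r y)\<^sup>2 \<partial>P) + 1)"
    using w mix_ratio[OF g h] by (intro diff_left_mono mult_left_mono) auto
  also have "\<dots> = (\<integral>y. w * (?r y - 1) - w\<^sup>2 / (1 - w) * ((?r y)\<^sup>2 + 1) \<partial>P)"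
    using mix_ratio[OF g h] by (simp add: prob_space)
  also have "\<dots> \<le> (\<integral>y. ln (mix ?c y) - ln (mix g y) \<partial>P)"
  proof (rule integral_mono)
    fix y assume y: "y \<in> space P"
    have r: "0 < ?r y" using mix_pos[OF g y] mix_pos[OF h y] by simp
    have "w * (?r y - 1) - w\<^sup>2 / (1 - w) * ((?r y)\<^sup>2 + 1) \<le> w * (?r y - 1) - w\<^sup>2 / (1 - w) * (?r y - 1)\<^sup>2"
      using w r by (intro diff_left_mono mult_left_mono) (auto simp: power2_diff)
    also have "\<dots> \<le> ln (1 + w * (?r y - 1))" using w r by (intro ln_one_plus_ge) auto
    also have "\<dots> = ln (mix ?c y) - ln (mix g y)"
    proof -
      have "1 + w * (?r y - 1) = mix ?c y / mix g y"
        using mix_combination[OF g h y, of w] mix_pos[OF g y] by simp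
      then show ?thesis using mix_pos[OF g y] mix_pos[OF c y] by (simp add: ln_div)
    qed
    finally show "w * (?r y - 1) - w\<^sup>2 / (1 - w) * ((?r y)\<^sup>2 + 1) \<le> ln (mix ?c y) - ln (mix g y)" .
  qed (use g c mix_ratio[OF g h] in \<open>auto simp: ln_mix_integrable\<close>)
  also have "\<dots> = ell ?c - ell g"
    unfolding ell_def using g c by (simp add: ln_mix_integrable)
  finally show ?thesis by simp
qed

text \<open>The posterior for the prior \<open>g\<close> after an observation \<open>y\<close>, as a
  density relative to \<open>\<nu>\<close>.\<close>

definition tilt :: "('u \<Rightarrow> real) \<Rightarrow> 'y \<Rightarrow> 'u \<Rightarrow> real" where
  "tilt g y u = k u y * g u / mix g y"

lemma dens_tilt:
  assumes g: "dens g" and y: "y \<in> space P"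
  shows "dens (tilt g y)"
proof -
  have [measurable]: "g \<in> borel_measurable \<nu>" "(\<lambda>u. k u y) \<in> borel_measurable \<nu>" using g y by auto
  note pos = mix_pos[OF g y]
  obtain B where B: "\<And>u. k u y * g u \<le> B" using k_dens_bounded[OF g y] by blast
  have "tilt g y \<in> borel_measurable \<nu>" unfolding tilt_def by measurable
  moreover have "0 \<le> tilt g y u" for u
    unfolding tilt_def using pos k_nonneg[OF y] dens_nonneg[OF g] by simp
  moreover have "tilt g y u \<le> B / mix g y" for u
    unfolding tilt_def using pos B by (simp add: divide_right_mono)
  moreover have "(\<integral>u. tilt g y u \<partial>\<nu>) = 1"
    unfolding tilt_def using pos by (simp add: mix_def[symmetric])
  ultimately show ?thesis unfolding dens_def by blast
qed

text \<open>\<open>affinity g z - 1\<close> is the directional derivative of \<open>ell\<close> at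
  \<open>g\<close> towards the Bayes update by \<open>z\<close>: the first-order gain of one step of
  the recursion per unit of weight.\<close>

definition affinity :: "('u \<Rightarrow> real) \<Rightarrow> 'y \<Rightarrow> real" where
  "affinity g z = (\<integral>y. mix (tilt g z) y / mix g y \<partial>P)"

lemma affinity_nonneg: "dens g \<Longrightarrow> z \<in> space P \<Longrightarrow> 0 \<le> affinity g z"
  unfolding affinity_def
  by (intro integral_nonneg_AE AE_I2 divide_nonneg_nonneg less_imp_le mix_pos dens_tilt)

lemma square_integral_le:
  fixes f :: "'y \<Rightarrow> real"
  assumes "integrable P f" "integrable P (\<lambda>y. (f y)\<^sup>2)"
  shows "(\<integral>y. f y \<partial>P)\<^sup>2 \<le> (\<integral>y. (f y)\<^sup>2 \<partial>P)"
  using variance_positive[of f] variance_eq[OF assms] by simp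

lemma square_affinity_le: "dens g \<Longrightarrow> z \<in> space P \<Longrightarrow> (affinity g z)\<^sup>2 \<le> A"
  unfolding affinity_def
  by (rule order_trans[OF square_integral_le]) (auto intro: mix_ratio dens_tilt)

lemma affinity_measurable:
  assumes g: "dens g" shows "affinity g \<in> borel_measurable P"
proof -
  have [measurable]: "g \<in> borel_measurable \<nu>" "mix g \<in> borel_measurable P"
    using g mix_measurable by auto
  have "(\<lambda>z. \<integral>y. (\<integral>u. k u y * (k u z * g u / mix g z) \<partial>\<nu>) / mix g y \<partial>P) \<in> borel_measurable P"
    by measurable
  then show ?thesis by (simp add: affinity_def[abs_def] mix_def[of "tilt g _"] tilt_def)
qed

text \<open>With \<open>\<phi> u = \<integral> k u y / mix g y dP\<close>, the mean affinity is \<open>\<integral> g \<phi>\<^sup>2 d\<nu>\<close>, and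
  \<open>\<integral> g \<phi> d\<nu> = 1\<close>.\<close>

lemma affinity_mean_ge:
  assumes g: "dens g"
  shows "integrable P (affinity g)" "1 \<le> (\<integral>z. affinity g z \<partial>P)"
proof -
  have [measurable]: "g \<in> borel_measurable \<nu>" "mix g \<in> borel_measurable P" "affinity g \<in> borel_measurable P"
    using g mix_measurable affinity_measurable by auto
  have "(\<integral>\<^sup>+z. ennreal ((affinity g z)\<^sup>2) \<partial>P) \<le> (\<integral>\<^sup>+z. ennreal A \<partial>P)"
    by (intro nn_integral_mono ennreal_leI square_affinity_le g)
  then have "(\<integral>\<^sup>+z. ennreal ((affinity g z)\<^sup>2) \<partial>P) \<le> ennreal A" by (simp add: emeasure_space_1)
  then show int: "integrable P (affinity g)" using A_nonneg by (intro square_integrable_le(3)) auto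
  define Q where "Q = density \<nu> (\<lambda>u. ennreal (g u))"
  interpret Q: prob_space Q unfolding Q_def by (rule prob_space_dens[OF g])
  interpret PQ: pair_sigma_finite P Q ..
  have setsQ [measurable_cong]: "sets Q = sets \<nu>" by (simp add: Q_def)
  define r where "r u y = ennreal (k u y / mix g y)" for u y
  have r_meas [measurable]: "(\<lambda>(u, y). r u y) \<in> borel_measurable (Q \<Otimes>\<^sub>M P)"
    unfolding r_def by (simp cong: measurable_cong_sets sets_pair_measure_cong add: setsQ) measurable
  define \<phi> where "\<phi> u = (\<integral>\<^sup>+y. r u y \<partial>P)" for u
  have [measurable]: "\<phi> \<in> borel_measurable Q" unfolding \<phi>_def by measurable
  \<comment> \<open>Averaging the product of two likelihood ratios over the prior gives one ratio of
    mixtures, with the posterior given \<open>z\<close> in the numerator.\<close>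
  have inner: "(\<integral>\<^sup>+u. r u y * r u z \<partial>Q) = ennreal (mix (tilt g z) y / mix g y)"
    if y: "y \<in> space P" and z: "z \<in> space P" for y z
  proof -
    have nn: "0 \<le> k u y * tilt g z u" for u
      using k_nonneg[OF y] dens_nonneg[OF dens_tilt[OF g z]] by simp
    have "(\<integral>\<^sup>+u. r u y * r u z \<partial>Q) = (\<integral>\<^sup>+u. ennreal (g u) * (r u y * r u z) \<partial>\<nu>)"
      unfolding Q_def using y z by (intro nn_integral_density) (auto simp: r_def)
    also have "\<dots> = (\<integral>\<^sup>+u. ennreal (k u y * tilt g z u / mix g y) \<partial>\<nu>)"
      using y z mix_pos[OF g y] mix_pos[OF g z] k_nonneg dens_nonneg[OF g]
      by (intro nn_integral_cong) (simp add: r_def tilt_def ennreal_mult[symmetric] field_simps)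
    also have "\<dots> = ennreal (\<integral>u. k u y * tilt g z u / mix g y \<partial>\<nu>)"
      using k_dens_integrable[OF dens_tilt[OF g z] y] nn mix_pos[OF g y]
      by (intro nn_integral_eq_integral) auto
    finally show ?thesis by (simp add: mix_def[of "tilt g z"])
  qed
  have one: "(\<integral>\<^sup>+u. r u y \<partial>Q) = 1" if y: "y \<in> space P" for y
  proof -
    have "(\<integral>\<^sup>+u. r u y \<partial>Q) = ennreal (\<integral>u. k u y / mix g y \<partial>Q)"
      unfolding r_def using mix_eq_integral_density(2)[OF g y] mix_pos[OF g y] k_nonneg[OF y]
      by (intro nn_integral_eq_integral) (auto simp: Q_def)
    then show ?thesis using mix_eq_integral_density(1)[OF g y] mix_pos[OF g y] by (simp add: Q_def)
  qed
  have "(\<integral>\<^sup>+u. \<phi> u \<partial>Q) = (\<integral>\<^sup>+y. \<integral>\<^sup>+u. r u y \<partial>Q \<partial>P)"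
    unfolding \<phi>_def by (rule PQ.Fubini') measurable
  also have "\<dots> = (\<integral>\<^sup>+y. 1 \<partial>P)" by (intro nn_integral_cong) (simp add: one)
  finally have \<phi>1: "(\<integral>\<^sup>+u. \<phi> u \<partial>Q) = 1" by (simp add: emeasure_space_1)
  \<comment> \<open>Cauchy-Schwarz without square roots: as \<open>\<phi>\<close> has integral 1
    under the probability \<open>Q\<close>, this pointwise inequality bounds its second moment below
    by 1.\<close>
  have "2 * x \<le> x * x + 1" for x :: ennreal
  proof (cases x)
    case (real a)
    have "2 * a \<le> a * a + 1" using zero_le_power2[of "a - 1"] by (simp add: power2_eq_square algebra_simps)
    then have "ennreal (2 * a) \<le> ennreal (a * a + 1)" by (rule ennreal_leI)
    then show ?thesis using real by (simp add: ennreal_mult)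
  qed (simp add: ennreal_top_mult)
  then have "(\<integral>\<^sup>+u. 2 * \<phi> u \<partial>Q) \<le> (\<integral>\<^sup>+u. \<phi> u * \<phi> u + 1 \<partial>Q)" by (intro nn_integral_mono)
  then have "1 + 1 \<le> 1 + (\<integral>\<^sup>+u. \<phi> u * \<phi> u \<partial>Q)"
    by (simp add: nn_integral_cmult nn_integral_add \<phi>1 Q.emeasure_space_1 add.commute)
  then have "1 \<le> (\<integral>\<^sup>+u. \<phi> u * \<phi> u \<partial>Q)"
    unfolding ennreal_add_left_cancel_le by simp
  also have "\<dots> = (\<integral>\<^sup>+u. \<integral>\<^sup>+z. \<integral>\<^sup>+y. r u y * r u z \<partial>P \<partial>P \<partial>Q)"
    by (intro nn_integral_cong) (simp add: nn_integral_multc nn_integral_cmult \<phi>_def)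
  also have "\<dots> = (\<integral>\<^sup>+z. \<integral>\<^sup>+u. \<integral>\<^sup>+y. r u y * r u z \<partial>P \<partial>Q \<partial>P)"
    by (rule PQ.Fubini') measurable
  also have "\<dots> = (\<integral>\<^sup>+z. \<integral>\<^sup>+y. \<integral>\<^sup>+u. r u y * r u z \<partial>Q \<partial>P \<partial>P)"
    by (intro nn_integral_cong PQ.Fubini') measurable
  also have "\<dots> = (\<integral>\<^sup>+z. \<integral>\<^sup>+y. ennreal (mix (tilt g z) y / mix g y) \<partial>P \<partial>P)"
    by (intro nn_integral_cong) (simp add: inner)
  also have "\<dots> = (\<integral>\<^sup>+z. ennreal (affinity g z) \<partial>P)"
    unfolding affinity_def
  proof (intro nn_integral_cong nn_integral_eq_integral)
    fix z assume z: "z \<in> space P"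
    show "integrable P (\<lambda>y. mix (tilt g z) y / mix g y)" by (rule mix_ratio(1)[OF g dens_tilt[OF g z]])
    show "AE y in P. 0 \<le> mix (tilt g z) y / mix g y"
      using mix_pos[OF g] mix_pos[OF dens_tilt[OF g z]] by (auto simp: less_imp_le)
  qed
  also have "\<dots> = ennreal (\<integral>z. affinity g z \<partial>P)"
    using int affinity_nonneg[OF g] by (intro nn_integral_eq_integral) auto
  finally show "1 \<le> (\<integral>z. affinity g z \<partial>P)"
    by (simp add: ennreal_ge_1)
qed

section \<open>Near-maximizers of the functional and the gradient bound\<close>

definition sup_ell :: real where
  "sup_ell = (SUP g\<in>{g. dens g}. ell g)"

lemma ell_le_sup_ell: "dens g \<Longrightarrow> ell g \<le> sup_ell"
  unfolding sup_ell_def by (rule cSUP_upper) (auto intro!: bdd_aboveI2 ell_bounded)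

lemma less_sup_ell_dens: "c < sup_ell \<Longrightarrow> \<exists>g. dens g \<and> c < ell g"
  unfolding sup_ell_def
  by (subst (asm) less_cSUP_iff) (use dens_one in \<open>auto intro!: bdd_aboveI2 ell_bounded\<close>)

text \<open>A step of length \<open>t\<close> from \<open>g\<close> towards \<open>h\<close> gains
  at least \<open>t * (?R - 1)\<close> minus a multiple of \<open>t\<^sup>2\<close>, but
  \<open>g\<close> is within \<open>t\<^sup>2\<close> of the supremum; dividing by \<open>t\<close>
  leaves \<open>?R - 1 \<le> t * C\<close>.\<close>

lemma near_maximizer:
  assumes "0 < \<delta>"
  shows "\<exists>g. dens g \<and> (\<forall>h. dens h \<longrightarrow> (\<integral>y. mix h y / mix g y \<partial>P) \<le> 1 + \<delta>)"
proof -
  \<comment> \<open>The 1 is the allowed gap \<open>t\<^sup>2\<close>; \<open>2 * (A + 1)\<close> is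
    the quadratic error with \<open>1 / (1 - t) \<le> 2\<close>.\<close>
  define C where "C = 1 + 2 * (A + 1)"
  have C: "0 < C" using A_nonneg by (simp add: C_def)
  define t where "t = min (1 / 2) (\<delta> / C)"
  have t: "0 < t" "t \<le> 1 / 2" "t * C \<le> \<delta>"
    using assms C by (auto simp: t_def min_def field_simps)
  obtain g where g: "dens g" "sup_ell - t\<^sup>2 < ell g"
    using less_sup_ell_dens[of "sup_ell - t\<^sup>2"] t by auto
  have "(\<integral>y. mix h y / mix g y \<partial>P) \<le> 1 + \<delta>" if h: "dens h" for h
  proof -
    let ?R = "\<integral>y. mix h y / mix g y \<partial>P"
    have arith: "a + b - c \<le> s \<Longrightarrow> c \<le> d \<Longrightarrow> s - q < a \<Longrightarrow> b \<le> q + d" for a b c d s q :: real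
      by linarith
    have "ell g + t * (?R - 1) - t\<^sup>2 / (1 - t) * (A + 1) \<le> sup_ell"
      using ell_combination_ge[OF g(1) h, of t] ell_le_sup_ell[OF dens_combination[OF g(1) h, of t]] t
      by simp
    moreover have "t\<^sup>2 / (1 - t) * (A + 1) \<le> t\<^sup>2 / (1 / 2) * (A + 1)"
      using t A_nonneg by (intro mult_right_mono divide_left_mono) auto
    ultimately have "t * (?R - 1) \<le> t\<^sup>2 + t\<^sup>2 / (1 / 2) * (A + 1)"
      using g(2) by (rule arith)
    then have "t * (?R - 1) \<le> t * (t * C)" by (simp add: C_def power2_eq_square algebra_simps)
    then have "?R - 1 \<le> t * C" using t by simp
    then show ?thesis using t by simp
  qed
  then show ?thesis using g by blast
qed

text \<open>One plus the derivative of \<open>ell\<close> at \<open>g\<close> towards the point mass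
  at \<open>u\<close>. As an \<open>ennreal\<close> integral it can be averaged over any mixing
  probability by Tonelli.\<close>

definition gradient :: "('u \<Rightarrow> real) \<Rightarrow> 'u \<Rightarrow> ennreal" where
  "gradient g u = (\<integral>\<^sup>+y. ennreal (k u y / mix g y) \<partial>P)"

lemma gradient_measurable: "dens g \<Longrightarrow> gradient g \<in> borel_measurable \<nu>"
  unfolding gradient_def[abs_def] using mix_measurable[of g] by measurable

lemma k_integrable:
  assumes "prob_space Q" "sets Q = sets \<nu>" "y \<in> space P"
  shows "integrable Q (\<lambda>u. k u y)"
proof -
  interpret Q: prob_space Q by fact
  have "(\<lambda>u. k u y) \<in> borel_measurable Q"
    using k_measurable_right[OF assms(3)] assms(2) by (simp cong: measurable_cong_sets)
  moreover obtain B where "\<And>u. k u y \<le> B" using k_bounded[OF assms(3)] by blast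
  ultimately show ?thesis
    using k_nonneg[OF assms(3)] by (intro Q.integrable_const_bound[of _ B]) auto
qed

text \<open>Makes the directional derivative towards an arbitrary \<open>Q\<close>, with or without
  a density, an integral linear in \<open>Q\<close>.\<close>

lemma nn_integral_gradient:
  assumes g: "dens g" and Q: "prob_space Q" "sets Q = sets \<nu>"
  shows "(\<integral>\<^sup>+u. gradient g u \<partial>Q) = (\<integral>\<^sup>+y. ennreal ((\<integral>u. k u y \<partial>Q) / mix g y) \<partial>P)"
proof -
  interpret Q: prob_space Q by fact
  interpret PQ: pair_sigma_finite P Q ..
  note [measurable_cong] = Q(2)
  have [measurable]: "mix g \<in> borel_measurable P" by (rule mix_measurable[OF g])
  have "(\<lambda>(u, y). k u y) \<in> borel_measurable (Q \<Otimes>\<^sub>M P)"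
    using k_measurable by (simp cong: measurable_cong_sets sets_pair_measure_cong add: Q(2))
  note [measurable] = this
  have "(\<integral>\<^sup>+u. gradient g u \<partial>Q) = (\<integral>\<^sup>+y. \<integral>\<^sup>+u. ennreal (k u y / mix g y) \<partial>Q \<partial>P)"
    unfolding gradient_def by (rule PQ.Fubini') measurable
  also have "\<dots> = (\<integral>\<^sup>+y. ennreal (\<integral>u. k u y / mix g y \<partial>Q) \<partial>P)"
    using k_integrable[OF Q] mix_pos[OF g] k_nonneg
    by (intro nn_integral_cong nn_integral_eq_integral) (auto simp: less_imp_le)
  finally show ?thesis by simp
qed

text \<open>Tests the hypothesis on the normalized indicator of the set where the bound fails, which
  is a bounded density if that set has positive measure.\<close>

lemma gradient_AE_le:
  assumes g: "dens g" and le: "\<And>h. dens h \<Longrightarrow> (\<integral>y. mix h y / mix g y \<partial>P) \<le> c" and "0 \<le> c"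
  shows "AE u in \<nu>. gradient g u \<le> ennreal c"
proof (rule ccontr)
  assume not_AE: "\<not> ?thesis"
  have [measurable]: "gradient g \<in> borel_measurable \<nu>" by (rule gradient_measurable[OF g])
  define B where "B = {u \<in> space \<nu>. ennreal c < gradient g u}"
  have [measurable]: "B \<in> sets \<nu>" unfolding B_def by measurable
  have "nu.prob B \<noteq> 0"
  proof
    assume "nu.prob B = 0"
    then have "AE u in \<nu>. u \<notin> B" by (simp add: nu.prob_eq_0)
    with not_AE show False by (auto simp: B_def not_less)
  qed
  then have b: "0 < nu.prob B" by (simp add: zero_less_measure_iff)
  define h where "h u = indicator B u / nu.prob B" for u
  have "dens h"
    unfolding dens_def
  proof (intro conjI allI exI)
    show "h u \<le> 1 / nu.prob B" for u unfolding h_def using b by (auto simp: divide_right_mono indicator_def)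
    show "(\<integral>u. h u \<partial>\<nu>) = 1" unfolding h_def using b by simp
  qed (auto simp: h_def[abs_def])
  have "(\<integral>\<^sup>+u. ennreal (h u) * gradient g u \<partial>\<nu>) = (\<integral>\<^sup>+u. gradient g u \<partial>density \<nu> (\<lambda>u. ennreal (h u)))"
    using \<open>dens h\<close> by (intro nn_integral_density[symmetric]) auto
  also have "\<dots> = (\<integral>\<^sup>+y. ennreal ((\<integral>u. k u y \<partial>density \<nu> (\<lambda>u. ennreal (h u))) / mix g y) \<partial>P)"
    by (rule nn_integral_gradient[OF g prob_space_dens[OF \<open>dens h\<close>]]) simp
  also have "\<dots> = (\<integral>\<^sup>+y. ennreal (mix h y / mix g y) \<partial>P)"
    by (intro nn_integral_cong) (simp add: mix_eq_integral_density(1)[OF \<open>dens h\<close>])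
  also have "\<dots> = ennreal (\<integral>y. mix h y / mix g y \<partial>P)"
    using mix_ratio(1)[OF g \<open>dens h\<close>] mix_pos[OF g] mix_pos[OF \<open>dens h\<close>]
    by (intro nn_integral_eq_integral) (auto simp: less_imp_le)
  also have "\<dots> \<le> ennreal c" by (intro ennreal_leI le \<open>dens h\<close>)
  finally have upper: "(\<integral>\<^sup>+u. ennreal (h u) * gradient g u \<partial>\<nu>) \<le> ennreal c" .
  have "(\<integral>\<^sup>+u. ennreal (h u) * ennreal c \<partial>\<nu>) = ennreal c"
    using \<open>dens h\<close> nn_integral_eq_integral[OF dens_integrable[OF \<open>dens h\<close>]]
    by (subst nn_integral_multc) (auto simp: dens_nonneg dens_integral)
  moreover have "(\<integral>\<^sup>+u. ennreal (h u) * ennreal c \<partial>\<nu>) < (\<integral>\<^sup>+u. ennreal (h u) * gradient g u \<partial>\<nu>)"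
  proof (rule nn_integral_less)
    show "AE u in \<nu>. ennreal (h u) * ennreal c \<le> ennreal (h u) * gradient g u"
      by (intro AE_I2) (auto simp: h_def B_def indicator_def intro!: mult_left_mono)
    show "\<not> (AE u in \<nu>. ennreal (h u) * gradient g u \<le> ennreal (h u) * ennreal c)"
    proof
      assume "AE u in \<nu>. ennreal (h u) * gradient g u \<le> ennreal (h u) * ennreal c"
      then have "AE u in \<nu>. u \<notin> B"
      proof eventually_elim
        case (elim u)
        show ?case
        proof
          assume u: "u \<in> B"
          then have hu: "ennreal (h u) \<noteq> 0" "ennreal (h u) \<noteq> \<top>" using b by (auto simp: h_def)
          have "ennreal (h u) * ennreal c < ennreal (h u) * gradient g u"
            using u hu by (intro ennreal_mult_strict_left_mono) (auto simp: B_def zero_less_iff_neq_zero less_top)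
          with elim show False by simp
        qed
      qed
      then show False using b by (simp add: nu.prob_eq_0[symmetric])
    qed
  qed (use \<open>dens h\<close> calculation in auto)
  ultimately show False using upper by simp
qed

end

section \<open>Convergence of predictive recursion\<close>

locale predictive_recursion = mixture_kernel P \<nu> k A
  for P :: "'y measure" and \<nu> :: "'u measure" and k :: "'u \<Rightarrow> 'y \<Rightarrow> real" and A :: real +
  fixes w :: "nat \<Rightarrow> real"
  assumes w_pos: "0 < w i" and w_less: "w i < 1"
    and w_diverges: "\<not> summable w" and w_square: "summable (\<lambda>i. (w i)\<^sup>2)"
begin

text \<open>Densities with respect to \<open>\<nu>\<close>, the initial guess. Observations and weights are indexed from 0
  here, and from 1 in \<^const>\<open>pr_density\<close>.\<close>

primrec G :: "(nat \<Rightarrow> 'y) \<Rightarrow> nat \<Rightarrow> 'u \<Rightarrow> real" where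
  "G z 0 = (\<lambda>_. 1)"
| "G z (Suc i) = (\<lambda>u. (1 - w i) * G z i u + w i * tilt (G z i) (z i) u)"

lemma component_space: "z \<in> space S \<Longrightarrow> z i \<in> space P"
  by (auto simp: space_PiM)

lemma G_dens: "z \<in> space S \<Longrightarrow> dens (G z i)"
proof (induction i)
  case (Suc i)
  then show ?case
    using dens_combination[OF Suc.IH dens_tilt[OF Suc.IH], of "z i" "w i"] w_pos[of i] w_less[of i]
    by (simp add: component_space)
qed (simp add: dens_one)

text \<open>Each step keeps at least the fraction \<open>1 - w i\<close> of the old density. With
  the bound from above, this makes \<open>ln (G z i u)\<close> bounded in \<open>u\<close>, hence
  integrable.\<close>

lemma G_lower_bound: "z \<in> space S \<Longrightarrow> \<exists>c>0. \<forall>u. c \<le> G z i u"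
proof (induction i)
  case 0
  then show ?case by (auto intro: exI[of _ 1])
next
  case (Suc i)
  then obtain c where c: "0 < c" "\<And>u. c \<le> G z i u" by auto
  have "(1 - w i) * c \<le> G z (Suc i) u" for u
  proof -
    have "0 \<le> tilt (G z i) (z i) u"
      using Suc.prems by (intro dens_nonneg dens_tilt G_dens component_space)
    then have "0 \<le> w i * tilt (G z i) (z i) u" using w_pos[of i] by simp
    moreover have "(1 - w i) * c \<le> (1 - w i) * G z i u"
      using c(2)[of u] w_less[of i] by (intro mult_left_mono) auto
    ultimately show ?thesis by simp
  qed
  moreover have "0 < (1 - w i) * c" using c w_less[of i] by simp
  ultimately show ?case by blast
qed

lemma G_pos: "z \<in> space S \<Longrightarrow> 0 < G z i u"
  using G_lower_bound[of z i] by (meson less_le_trans)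

lemma G_past: "depends_on_past i (\<lambda>z. G z i)"
proof (induction i)
  case 0
  show ?case by (simp add: depends_on_past_def)
next
  case (Suc i)
  show ?case
    unfolding depends_on_past_def
  proof (intro allI impI)
    fix z z' assume eq: "\<forall>j<Suc i. z j = (z' j :: 'y)"
    then have "G z i = G z' i" by (intro depends_on_pastD[OF Suc]) auto
    then show "G z (Suc i) = G z' (Suc i)" using eq by simp
  qed
qed

lemma G_measurable [measurable]: "(\<lambda>(z, u). G z i u) \<in> borel_measurable (S \<Otimes>\<^sub>M \<nu>)"
proof (induction i)
  case (Suc i)
  have [measurable]: "(\<lambda>(z, u). G z i u) \<in> borel_measurable (S \<Otimes>\<^sub>M \<nu>)" by (rule Suc)
  have "(\<lambda>(z, u). (1 - w i) * G z i u + w i * (k u (z i) * G z i u / (\<integral>v. k v (z i) * G z i v \<partial>\<nu>)))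
    \<in> borel_measurable (S \<Otimes>\<^sub>M \<nu>)"
    by measurable
  then show ?case by (simp add: tilt_def mix_def)
qed simp

lemma mix_G_measurable [measurable]: "(\<lambda>(z, y). mix (G z i) y) \<in> borel_measurable (S \<Otimes>\<^sub>M P)"
proof -
  have "(\<lambda>(z, y). \<integral>u. k u y * G z i u \<partial>\<nu>) \<in> borel_measurable (S \<Otimes>\<^sub>M P)"
    by measurable
  then show ?thesis by (simp add: mix_def)
qed

lemma affinity_G_measurable [measurable]:
  "(\<lambda>(z, y). affinity (G z i) y) \<in> borel_measurable (S \<Otimes>\<^sub>M P)"
proof -
  have "(\<lambda>(z, x). \<integral>y. (\<integral>u. k u y * (k u x * G z i u / mix (G z i) x) \<partial>\<nu>) / mix (G z i) y \<partial>P)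
    \<in> borel_measurable (S \<Otimes>\<^sub>M P)"
    by measurable
  then show ?thesis by (simp add: affinity_def mix_def[of "tilt (G _ _) _"] tilt_def)
qed

lemma G_past_comp: "depends_on_past i (\<lambda>z. f (G z i))"
  unfolding depends_on_past_def using depends_on_pastD[OF G_past] by metis

text \<open>Square summability forces \<open>w i < 1 / 2\<close> eventually, so the factor
  \<open>1 / (1 - w i)\<close> from the quadratic errors is eventually at most 2.\<close>

lemma w_square_ratio: "summable (\<lambda>i. (w i)\<^sup>2 / (1 - w i))" "\<And>i. 0 \<le> (w i)\<^sup>2 / (1 - w i)"
proof -
  show nonneg: "0 \<le> (w i)\<^sup>2 / (1 - w i)" for i using w_less[of i] by simp
  have "\<forall>\<^sub>F i in sequentially. (w i)\<^sup>2 < (1 / 2)\<^sup>2"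
    by (rule order_tendstoD(2)[OF summable_LIMSEQ_zero[OF w_square]]) simp
  then have "\<forall>\<^sub>F i in sequentially. norm ((w i)\<^sup>2 / (1 - w i)) \<le> 2 * (w i)\<^sup>2"
  proof eventually_elim
    case (elim i)
    then have "w i < 1 / 2" by (rule power_less_imp_less_base) simp
    then have "(w i)\<^sup>2 / (1 - w i) \<le> (w i)\<^sup>2 / (1 / 2)" by (intro divide_left_mono) auto
    then show ?case using nonneg[of i] w_less[of i] by simp
  qed
  then show "summable (\<lambda>i. (w i)\<^sup>2 / (1 - w i))"
    by (rule summable_comparison_test_ev) (intro summable_mult w_square)
qed

text \<open>The first-order gain splits into a centred part, whose series converges, and a mean
  part, which is nonnegative by \<open>affinity_mean_ge\<close>; the quadratic errors are summable
  and \<open>ell\<close> is bounded above.\<close>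

lemma ell_converges: "AE z in S. convergent (\<lambda>n. ell (G z n))"
proof -
  have "AE z in S. summable (\<lambda>i. w i * (affinity (G z i) (z i) - (\<integral>y. affinity (G z i) y \<partial>P)))"
  proof (rule centred_series_converges[where C=A])
    fix i z assume "z \<in> space S"
    then have "(\<integral>\<^sup>+y. ennreal ((affinity (G z i) y)\<^sup>2) \<partial>P) \<le> (\<integral>\<^sup>+y. ennreal A \<partial>P)"
      by (intro nn_integral_mono ennreal_leI square_affinity_le G_dens)
    then show "(\<integral>\<^sup>+y. ennreal ((affinity (G z i) y)\<^sup>2) \<partial>P) \<le> ennreal A"
      by (simp add: emeasure_space_1)
  qed (use w_square A_nonneg G_past_comp in auto)
  with AE_space show ?thesis
  proof eventually_elim
    case (elim z)
    note z = elim(1)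
    let ?a = "\<lambda>i. w i * (affinity (G z i) (z i) - (\<integral>y. affinity (G z i) y \<partial>P))"
    let ?v = "\<lambda>i. (w i)\<^sup>2 / (1 - w i) * (A + 1)"
    show ?case
    proof (rule convergent_of_increments)
      show "summable (\<lambda>i. ?a i - ?v i)"
        using elim(2) w_square_ratio(1) by (intro summable_diff summable_mult2)
      show "ell (G z i) \<le> ell (\<lambda>_. 1) + A" for i by (rule ell_bounded[OF G_dens[OF z]])
      show "?a i - ?v i \<le> ell (G z (Suc i)) - ell (G z i)" for i
      proof -
        have "w i * (affinity (G z i) (z i) - (\<integral>y. affinity (G z i) y \<partial>P)) \<le> w i * (affinity (G z i) (z i) - 1)"
          using affinity_mean_ge(2)[OF G_dens[OF z]] w_pos[of i] by (intro mult_left_mono) auto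
        moreover have "ell (G z i) + w i * (affinity (G z i) (z i) - 1) - ?v i \<le> ell (G z (Suc i))"
          using ell_combination_ge[OF G_dens[OF z] dens_tilt[OF G_dens[OF z] component_space[OF z]], of "w i" i i i]
            w_pos[of i] w_less[of i] by (simp add: affinity_def)
        ultimately show ?thesis by simp
      qed
    qed
  qed
qed

text \<open>The Lyapunov function is \<open>\<integral> h ln (G z n) d\<nu>\<close>, that is, up to constants, minus the
  Kullback-Leibler divergence of \<open>G z n\<close> from \<open>h\<close>.\<close>

lemma limit_ell_ge:
  assumes h: "dens h"
  shows "AE z in S. \<forall>L. (\<lambda>n. ell (G z n)) \<longlonglongrightarrow> L \<longrightarrow> ell h \<le> L"
proof -
  have [measurable]: "h \<in> borel_measurable \<nu>" "mix h \<in> borel_measurable P" using h mix_measurable by auto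
  obtain H where H: "\<And>u. h u \<le> H" using h by (auto simp: dens_def)
  define Q where "Q = density \<nu> (\<lambda>u. ennreal (h u))"
  interpret Q: prob_space Q unfolding Q_def by (rule prob_space_dens[OF h])
  have setsQ [measurable_cong]: "sets Q = sets \<nu>" by (simp add: Q_def)
  have intQ: "integrable Q f" if "f \<in> borel_measurable \<nu>" "\<And>u. \<bar>f u\<bar> \<le> B" for f :: "'u \<Rightarrow> real" and B
    using that by (intro Q.integrable_const_bound[of _ B]) (auto simp: Q_def)
  define r where "r z i y = mix h y / mix (G z i) y" for z i y
  \<comment> \<open>The second moment under \<open>h\<close> of the factor
    \<open>k u y / mix (G z i) y\<close>, whose first moment is \<open>r\<close>. Only the mean of
    \<open>V\<close> over \<open>y\<close> is bounded, so its series is handled by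
    \<open>nonneg_series_converges\<close>.\<close>
  define V where "V z i y = (\<integral>u. (k u y / mix (G z i) y)\<^sup>2 \<partial>Q)" for z i y
  have kQ: "(\<lambda>(u, y). k u y) \<in> borel_measurable (Q \<Otimes>\<^sub>M P)"
    using k_measurable by (simp cong: measurable_cong_sets sets_pair_measure_cong add: setsQ)
  note [measurable] = kQ
  have k_ratio_bounded: "\<exists>B. \<forall>u. \<bar>k u y / mix (G z i) y\<bar> \<le> B" if z: "z \<in> space S" and y: "y \<in> space P" for z i y
  proof -
    obtain B where "\<And>u. k u y \<le> B" using k_bounded[OF y] by blast
    then have "\<bar>k u y / mix (G z i) y\<bar> \<le> B / mix (G z i) y" for u
      using mix_pos[OF G_dens[OF z] y, of i] k_nonneg[OF y]
      by (simp add: divide_right_mono)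
    then show ?thesis by blast
  qed
  have "AE z in S. summable (\<lambda>i. w i * (r z i (z i) - (\<integral>y. r z i y \<partial>P)))"
  proof (rule centred_series_converges[where C=A])
    show "(\<lambda>(z, y). r z i y) \<in> borel_measurable (S \<Otimes>\<^sub>M P)" for i
      unfolding r_def by measurable
    show "depends_on_past i (\<lambda>z. r z i)" for i
      unfolding r_def by (rule G_past_comp)
    show "(\<integral>\<^sup>+y. ennreal ((r z i y)\<^sup>2) \<partial>P) \<le> ennreal A" if "z \<in> space S" for i z
      unfolding r_def by (rule mix_divide_mix_le[OF G_dens[OF that] h])
  qed (use w_square A_nonneg in auto)
  moreover have "AE z in S. summable (\<lambda>i. (w i)\<^sup>2 / (1 - w i) * (V z i (z i) + 1))"
  proof (rule nonneg_series_converges[where C="A + 1"])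
    show "(\<lambda>(z, y). V z i y + 1) \<in> borel_measurable (S \<Otimes>\<^sub>M P)" for i
      unfolding V_def by measurable
    show "depends_on_past i (\<lambda>z y. V z i y + 1)" for i
      unfolding V_def by (rule G_past_comp)
    show "0 \<le> V z i y + 1" for z i y
      unfolding V_def by (intro add_nonneg_nonneg integral_nonneg_AE) auto
    show "(\<integral>\<^sup>+y. ennreal (V z i y + 1) \<partial>P) \<le> ennreal (A + 1)" if z: "z \<in> space S" for i z
    proof -
      have [measurable]: "mix (G z i) \<in> borel_measurable P" by (rule mix_measurable[OF G_dens[OF z]])
      have "(\<integral>\<^sup>+y. ennreal (V z i y + 1) \<partial>P) = (\<integral>\<^sup>+y. (\<integral>\<^sup>+u. ennreal ((k u y / mix (G z i) y)\<^sup>2) \<partial>Q) + 1 \<partial>P)"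
      proof (rule nn_integral_cong)
        fix y assume y: "y \<in> space P"
        obtain B where B: "\<And>u. \<bar>k u y / mix (G z i) y\<bar> \<le> B" using k_ratio_bounded[OF z y] by blast
        have "integrable Q (\<lambda>u. (k u y / mix (G z i) y)\<^sup>2)"
        proof (rule intQ)
          show "\<bar>(k u y / mix (G z i) y)\<^sup>2\<bar> \<le> B\<^sup>2" for u
            using power_mono[OF B, of u 2] by (simp add: power_divide)
        qed (use y in measurable)
        then have "(\<integral>\<^sup>+u. ennreal ((k u y / mix (G z i) y)\<^sup>2) \<partial>Q) = ennreal (V z i y)"
          unfolding V_def by (rule nn_integral_eq_integral) simp
        moreover have "0 \<le> V z i y" unfolding V_def by simp
        ultimately show "ennreal (V z i y + 1) = (\<integral>\<^sup>+u. ennreal ((k u y / mix (G z i) y)\<^sup>2) \<partial>Q) + 1"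
          by simp
      qed
      also have "\<dots> = (\<integral>\<^sup>+y. \<integral>\<^sup>+u. ennreal ((k u y / mix (G z i) y)\<^sup>2) \<partial>Q \<partial>P) + 1"
        by (subst nn_integral_add) (auto simp: emeasure_space_1)
      also have "\<dots> \<le> ennreal A + 1"
        unfolding Q_def
        by (intro add_right_mono nn_integral_average_le[OF h] k_divide_mix_le G_dens z) measurable
      finally show ?thesis using A_nonneg by simp
    qed
  qed (use w_square_ratio A_nonneg in auto)
  ultimately show ?thesis
    using AE_space
  proof eventually_elim
    case (elim z)
    note z = elim(3)
    let ?s = "\<lambda>i. w i * (r z i (z i) - (\<integral>y. r z i y \<partial>P)) - (w i)\<^sup>2 / (1 - w i) * (V z i (z i) + 1)"
    define D where "D n = (\<integral>u. ln (G z n u) \<partial>Q)" for n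
    have Gm [measurable]: "G z n \<in> borel_measurable \<nu>" for n using G_dens[OF z] by auto
    have lnG: "integrable Q (\<lambda>u. ln (G z n u))" for n
    proof -
      obtain c where c: "0 < c" "\<And>u. c \<le> G z n u" using G_lower_bound[OF z, of n] by blast
      obtain C where C: "\<And>u. G z n u \<le> C" using G_dens[OF z, of n] by (auto simp: dens_def)
      have "\<bar>ln (G z n u)\<bar> \<le> \<bar>ln c\<bar> + \<bar>ln C\<bar>" for u
      proof -
        have "ln c \<le> ln (G z n u)" "ln (G z n u) \<le> ln C"
          using c(1) c(2)[of u] C[of u] G_pos[OF z, of n u] by (auto intro!: ln_mono)
        then show ?thesis by linarith
      qed
      then show ?thesis by (rule intQ[rotated]) simp
    qed
    \<comment> \<open>Here the bound on \<open>h\<close> is used: \<open>ln x \<le> x\<close>,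
      \<open>h u \<le> H\<close>, and \<open>G z n\<close> integrates to 1.\<close>
    have D_le: "D n \<le> H" for n
    proof -
      obtain C where C: "\<And>u. G z n u \<le> C" using G_dens[OF z, of n] by (auto simp: dens_def)
      have GQ: "integrable Q (G z n)"
      proof (rule intQ)
        show "\<bar>G z n u\<bar> \<le> C" for u using C[of u] G_pos[OF z, of n u] by simp
      qed simp
      have "D n \<le> (\<integral>u. G z n u \<partial>Q)"
        unfolding D_def
      proof (rule integral_mono[OF lnG GQ])
        show "ln (G z n u) \<le> G z n u" for u using ln_le_minus_one[OF G_pos[OF z, of n u]] by simp
      qed
      also have "\<dots> = (\<integral>u. h u * G z n u \<partial>\<nu>)"
        unfolding Q_def using h by (simp add: integral_density dens_nonneg)
      also have "\<dots> \<le> (\<integral>u. H * G z n u \<partial>\<nu>)"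
      proof (rule integral_mono)
        show "integrable \<nu> (\<lambda>u. H * G z n u)" using dens_integrable[OF G_dens[OF z]] by simp
        show le: "h u * G z n u \<le> H * G z n u" for u
          using H[of u] G_pos[OF z, of n u] by (intro mult_right_mono) auto
        show "integrable \<nu> (\<lambda>u. h u * G z n u)"
        proof (rule Bochner_Integration.integrable_bound[OF \<open>integrable \<nu> (\<lambda>u. H * G z n u)\<close>])
          show "AE u in \<nu>. norm (h u * G z n u) \<le> norm (H * G z n u)"
            using le dens_nonneg[OF h] G_pos[OF z] by (intro AE_I2) (smt (verit) mult_nonneg_nonneg real_norm_def)
        qed simp
      qed
      also have "\<dots> = H" using dens_integral[OF G_dens[OF z]] by simp
      finally show ?thesis .
    qed
    have D_inc: "?s i + w i * (ell h - ell (G z i)) \<le> D (Suc i) - D i" for i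
    proof -
      let ?q = "\<lambda>u. k u (z i) / mix (G z i) (z i)"
      note zi = component_space[OF z, of i]
      note pos = mix_pos[OF G_dens[OF z] zi, of i]
      have [measurable]: "(\<lambda>u. k u (z i)) \<in> borel_measurable \<nu>" using zi by simp
      obtain B where B: "\<And>u. \<bar>?q u\<bar> \<le> B" using k_ratio_bounded[OF z zi] by blast
      have q: "integrable Q ?q" using B by (rule intQ[rotated]) simp
      have q2: "integrable Q (\<lambda>u. (?q u)\<^sup>2)"
      proof (rule intQ)
        show "\<bar>(?q u)\<^sup>2\<bar> \<le> B\<^sup>2" for u using power_mono[OF B, of u 2] by (simp add: power_divide)
      qed simp
      have mean: "(\<integral>u. ?q u \<partial>Q) = r z i (z i)"
        using mix_eq_integral_density(1)[OF h zi] by (simp add: r_def Q_def)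
      \<comment> \<open>By concavity, the conditional mean of the first-order term dominates the gap
        in \<open>ell\<close>; this is the drift.\<close>
      have "ell h - ell (G z i) \<le> (\<integral>y. r z i y \<partial>P) - 1"
        unfolding r_def by (rule ell_diff_le[OF G_dens[OF z] h])
      then have "w i * (ell h - ell (G z i)) \<le> w i * ((\<integral>y. r z i y \<partial>P) - 1)"
        using w_pos[of i] by (intro mult_left_mono) auto
      then have "?s i + w i * (ell h - ell (G z i))
          \<le> w i * (r z i (z i) - 1) - (w i)\<^sup>2 / (1 - w i) * (V z i (z i) + 1)"
        by (simp add: algebra_simps)
      also have "\<dots> = (\<integral>u. w i * (?q u - 1) - (w i)\<^sup>2 / (1 - w i) * ((?q u)\<^sup>2 + 1) \<partial>Q)"
        using q q2 by (simp add: mean[symmetric] V_def Q.prob_space)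
      also have "\<dots> \<le> (\<integral>u. ln (G z (Suc i) u) - ln (G z i u) \<partial>Q)"
      proof (rule integral_mono)
        show "integrable Q (\<lambda>u. w i * (?q u - 1) - (w i)\<^sup>2 / (1 - w i) * ((?q u)\<^sup>2 + 1))"
          using q q2 by simp
        show "integrable Q (\<lambda>u. ln (G z (Suc i) u) - ln (G z i u))"
          using lnG by (rule Bochner_Integration.integrable_diff[OF _ lnG])
        fix u
        have q0: "0 \<le> ?q u" using pos k_nonneg[OF zi] by simp
        have "w i * (?q u - 1) - (w i)\<^sup>2 / (1 - w i) * ((?q u)\<^sup>2 + 1)
            \<le> w i * (?q u - 1) - (w i)\<^sup>2 / (1 - w i) * (?q u - 1)\<^sup>2"
          using w_square_ratio(2)[of i] q0 by (intro diff_left_mono mult_left_mono) (auto simp: power2_diff)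
        also have "\<dots> \<le> ln (1 + w i * (?q u - 1))"
          using w_pos[of i] w_less[of i] q0 by (intro ln_one_plus_ge) auto
        \<comment> \<open>One step multiplies the density at \<open>u\<close> by this factor, so its
          logarithm changes additively.\<close>
        also have "1 + w i * (?q u - 1) = G z (Suc i) u / G z i u"
          using G_pos[OF z, of i u] by (simp add: tilt_def field_simps)
        also have "ln \<dots> = ln (G z (Suc i) u) - ln (G z i u)"
          using G_pos[OF z, of i u] G_pos[OF z, of "Suc i" u] by (simp add: ln_div del: G.simps)
        finally show "w i * (?q u - 1) - (w i)\<^sup>2 / (1 - w i) * ((?q u)\<^sup>2 + 1)
            \<le> ln (G z (Suc i) u) - ln (G z i u)" .
      qed
      also have "\<dots> = D (Suc i) - D i"
        unfolding D_def by (rule Bochner_Integration.integral_diff[OF lnG lnG])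
      finally show ?thesis .
    qed
    show ?case
    proof (intro allI impI)
      fix L assume "(\<lambda>n. ell (G z n)) \<longlonglongrightarrow> L"
      then have "(\<lambda>n. ell h - ell (G z n)) \<longlonglongrightarrow> ell h - L" by (intro tendsto_diff tendsto_const)
      then have "ell h - L \<le> 0"
        using elim(1,2) D_inc D_le w_pos w_diverges
        by (intro drift_limit_nonpos[where s="?s" and D=D and w=w]) (auto intro: summable_diff less_imp_le)
      then show "ell h \<le> L" by simp
    qed
  qed
qed

text \<open>The null set in \<open>limit_ell_ge\<close> depends on \<open>h\<close>, so the supremum
  is approached along a sequence of densities.\<close>

lemma ell_tendsto_sup: "AE z in S. (\<lambda>n. ell (G z n)) \<longlonglongrightarrow> sup_ell"
proof -
  have "\<exists>g. dens g \<and> sup_ell - 1 / real (Suc j) < ell g" for j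
    by (rule less_sup_ell_dens) simp
  then obtain h where h: "\<And>j. dens (h j)" "\<And>j. sup_ell - 1 / real (Suc j) < ell (h j)" by metis
  have "AE z in S. \<forall>j. \<forall>L. (\<lambda>n. ell (G z n)) \<longlonglongrightarrow> L \<longrightarrow> ell (h j) \<le> L"
    unfolding AE_all_countable by (intro allI limit_ell_ge h)
  with ell_converges AE_space show ?thesis
  proof eventually_elim
    case (elim z)
    then obtain L where L: "(\<lambda>n. ell (G z n)) \<longlonglongrightarrow> L" by (auto simp: convergent_def)
    have "sup_ell \<le> L + e" if e: "0 < e" for e
    proof -
      obtain j where "1 / real (Suc j) < e" using nat_approx_posE[OF e] by blast
      then show ?thesis using h(2)[of j] elim(3) L by (smt (verit))
    qed
    then have "sup_ell \<le> L" by (rule field_le_epsilon)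
    moreover have "L \<le> sup_ell"
      using G_dens[OF elim(2)] by (intro LIMSEQ_le_const2[OF L]) (auto intro: ell_le_sup_ell)
    ultimately show ?case using L by simp
  qed
qed

text \<open>A strong law: the centred series with coefficients \<open>1 / real (Suc i)\<close>
  converges by the uniform second moments, and Kronecker's lemma turns it into averages. What
  remains is the Cesaro mean of \<open>ell (G z i)\<close>.\<close>

lemma log_likelihood_growth:
  "AE z in S. (\<lambda>n. (\<Sum>i<n. ln (mix (G z i) (z i))) / real n) \<longlonglongrightarrow> sup_ell"
proof -
  have "AE z in S. summable (\<lambda>i. 1 / real (Suc i) * (ln (mix (G z i) (z i)) - (\<integral>y. ln (mix (G z i) y) \<partial>P)))"
  proof (rule centred_series_converges[where C="2 * A"])
    show "(\<lambda>(z, y). ln (mix (G z i) y)) \<in> borel_measurable (S \<Otimes>\<^sub>M P)" for i by measurable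
    show "depends_on_past i (\<lambda>z y. ln (mix (G z i) y))" for i by (rule G_past_comp)
    show "(\<integral>\<^sup>+y. ennreal ((ln (mix (G z i) y))\<^sup>2) \<partial>P) \<le> ennreal (2 * A)" if "z \<in> space S" for i z
      by (rule square_ln_mix_le[OF G_dens[OF that]])
    have "summable (\<lambda>i. inverse (real (Suc i) ^ 2))"
      using inverse_power_summable[of 2, where 'a=real] by (subst summable_Suc_iff) simp
    then show "summable (\<lambda>i. (1 / real (Suc i))\<^sup>2)" by (simp add: divide_inverse power_inverse)
  qed (use A_nonneg in auto)
  with ell_tendsto_sup show ?thesis
  proof eventually_elim
    case (elim z)
    have "(\<lambda>n. (\<Sum>i<n. ln (mix (G z i) (z i)) - ell (G z i)) / real n) \<longlonglongrightarrow> 0"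
      using elim(2) by (intro kronecker_lemma) (simp add: ell_def)
    from tendsto_add[OF this cesaro_mean[OF elim(1)]] show ?case
      by (simp add: add_divide_distrib[symmetric] sum.distrib[symmetric])
  qed
qed

end

section \<open>The supremum over the weak closure\<close>

locale continuous_mixture_kernel = mixture_kernel P \<nu> k A
  for P :: "'y measure" and \<nu> :: "'u::{metric_space, second_countable_topology} measure"
    and k :: "'u \<Rightarrow> 'y \<Rightarrow> real" and A :: real +
  assumes sets_nu: "sets \<nu> = sets borel"
    and k_continuous: "y \<in> space P \<Longrightarrow> continuous_on UNIV (\<lambda>u. k u y)"
begin

text \<open>Truncating the integrand of \<open>gradient g\<close> at \<open>j\<close> gives a
  bounded function of \<open>u\<close>, continuous by dominated convergence, so the bound passes to
  \<open>Q\<close>; monotone convergence removes the truncation. \<open>transfer\<close> holds all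
  that is used about weak limits.\<close>

lemma nn_integral_gradient_le:
  assumes g: "dens g" and Q: "prob_space Q" "sets Q = sets borel"
    and le: "AE u in \<nu>. gradient g u \<le> ennreal c" and "0 \<le> c"
    and transfer: "\<And>\<psi>::'u \<Rightarrow> real. continuous_on UNIV \<psi> \<Longrightarrow> bounded (range \<psi>) \<Longrightarrow>
      AE u in \<nu>. \<psi> u \<le> c \<Longrightarrow> (\<integral>u. \<psi> u \<partial>Q) \<le> c"
  shows "(\<integral>\<^sup>+u. gradient g u \<partial>Q) \<le> ennreal c"
proof -
  interpret Q: prob_space Q by fact
  have gm [measurable]: "mix g \<in> borel_measurable P" by (rule mix_measurable[OF g])
  define \<rho> where "\<rho> j u y = min (k u y / mix g y) (real j)" for j u y
  have \<rho>_range: "0 \<le> \<rho> j u y" "\<rho> j u y \<le> real j" if "y \<in> space P" for j u y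
    using mix_pos[OF g that] k_nonneg[OF that] by (auto simp: \<rho>_def)
  have \<rho>m [measurable]: "\<rho> j u \<in> borel_measurable P" for j u
    unfolding \<rho>_def[abs_def] by measurable
  have \<rho>_int: "integrable P (\<rho> j u)" for j u
    using \<rho>_range by (intro integrable_const_bound[of _ "real j"]) auto
  define \<psi> where "\<psi> j u = (\<integral>y. \<rho> j u y \<partial>P)" for j u
  have \<psi>_range: "0 \<le> \<psi> j u" "\<psi> j u \<le> real j" for j u
  proof -
    show "0 \<le> \<psi> j u" unfolding \<psi>_def using \<rho>_range by (intro integral_nonneg_AE) auto
    have "\<psi> j u \<le> (\<integral>y. real j \<partial>P)"
      unfolding \<psi>_def using \<rho>_range \<rho>_int by (intro integral_mono) auto
    then show "\<psi> j u \<le> real j" by (simp add: prob_space)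
  qed
  have \<psi>_cont: "continuous_on UNIV (\<psi> j)" for j
    unfolding continuous_on_sequentially
  proof (intro allI ballI impI, elim conjE)
    fix x :: "nat \<Rightarrow> 'u" and a assume "x \<longlonglongrightarrow> a"
    then have "(\<lambda>n. \<rho> j (x n) y) \<longlonglongrightarrow> \<rho> j a y" if "y \<in> space P" for y
      unfolding \<rho>_def using mix_pos[OF g that] k_continuous[OF that]
      by (intro tendsto_intros continuous_on_tendsto_compose[where f="\<lambda>u. k u y" and s=UNIV]) auto
    then show "(\<psi> j \<circ> x) \<longlonglongrightarrow> \<psi> j a"
      unfolding \<psi>_def comp_def using \<rho>_range
      by (intro integral_dominated_convergence[where w="\<lambda>_. real j"]) auto
  qed
  have \<psi>_eq: "ennreal (\<psi> j u) = (\<integral>\<^sup>+y. ennreal (\<rho> j u y) \<partial>P)" for j u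
    unfolding \<psi>_def using \<rho>_int \<rho>_range by (intro nn_integral_eq_integral[symmetric]) auto
  have \<psi>_le: "ennreal (\<psi> j u) \<le> gradient g u" for j u
    unfolding \<psi>_eq gradient_def by (intro nn_integral_mono ennreal_leI) (simp add: \<rho>_def)
  have \<psi>m [measurable]: "\<psi> j \<in> borel_measurable Q" for j
    using \<psi>_cont[of j] Q(2) by (simp add: borel_measurable_continuous_onI cong: measurable_cong_sets)
  have \<psi>_Q: "(\<integral>\<^sup>+u. ennreal (\<psi> j u) \<partial>Q) \<le> ennreal c" for j
  proof -
    have "(\<integral>\<^sup>+u. ennreal (\<psi> j u) \<partial>Q) = ennreal (\<integral>u. \<psi> j u \<partial>Q)"
      using \<psi>_range by (intro nn_integral_eq_integral Q.integrable_const_bound[of _ "real j"]) auto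
    also have "\<dots> \<le> ennreal c"
    proof (intro ennreal_leI transfer \<psi>_cont)
      show "bounded (range (\<psi> j))"
        using \<psi>_range by (intro boundedI[of _ "real j"]) auto
      show "AE u in \<nu>. \<psi> j u \<le> c"
        using le
      proof eventually_elim
        case (elim u)
        then have "ennreal (\<psi> j u) \<le> ennreal c" using \<psi>_le[of j u] by (rule order_trans[rotated])
        then show ?case using \<open>0 \<le> c\<close> by simp
      qed
    qed
    finally show ?thesis .
  qed
  have "gradient g u = (SUP j. ennreal (\<psi> j u))" for u
  proof -
    have "(SUP j. ennreal (\<rho> j u y)) = ennreal (k u y / mix g y)" for y
    proof (rule antisym)
      show "(SUP j. ennreal (\<rho> j u y)) \<le> ennreal (k u y / mix g y)"
        by (intro SUP_least ennreal_leI) (simp add: \<rho>_def)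
      obtain j where "k u y / mix g y \<le> real j" using real_arch_simple by blast
      then show "ennreal (k u y / mix g y) \<le> (SUP j. ennreal (\<rho> j u y))"
        by (intro SUP_upper2[of j]) (auto simp: \<rho>_def)
    qed
    then have "gradient g u = (\<integral>\<^sup>+y. (SUP j. ennreal (\<rho> j u y)) \<partial>P)" by (simp add: gradient_def)
    also have "\<dots> = (SUP j. \<integral>\<^sup>+y. ennreal (\<rho> j u y) \<partial>P)"
      by (intro nn_integral_monotone_convergence_SUP)
        (auto simp: incseq_def le_fun_def \<rho>_def intro!: ennreal_leI)
    finally show ?thesis by (simp add: \<psi>_eq)
  qed
  then have "(\<integral>\<^sup>+u. gradient g u \<partial>Q) = (\<integral>\<^sup>+u. (SUP j. ennreal (\<psi> j u)) \<partial>Q)" by simp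
  also have "\<dots> = (SUP j. \<integral>\<^sup>+u. ennreal (\<psi> j u) \<partial>Q)"
  proof (intro nn_integral_monotone_convergence_SUP)
    show "incseq (\<lambda>j u. ennreal (\<psi> j u))"
    proof (intro incseq_SucI le_funI)
      show "ennreal (\<psi> j u) \<le> ennreal (\<psi> (Suc j) u)" for j u
        unfolding \<psi>_eq by (intro nn_integral_mono ennreal_leI) (auto simp: \<rho>_def)
    qed
  qed simp
  also have "\<dots> \<le> ennreal c" by (intro SUP_least \<psi>_Q)
  finally show ?thesis .
qed

text \<open>Compares \<open>Q\<close> with a near-maximizer \<open>g\<close>: by
  \<open>ln x \<le> x - 1\<close>, the excess over \<open>ell g\<close> is at most the gradient
  averaged over \<open>Q\<close> minus one, hence at most \<open>\<delta>\<close>.\<close>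

lemma expectation_ln_mixture_le_sup_ell:
  assumes Q: "prob_space Q" "sets Q = sets borel"
    and transfer: "\<And>(\<psi>::'u \<Rightarrow> real) c. continuous_on UNIV \<psi> \<Longrightarrow> bounded (range \<psi>) \<Longrightarrow>
      AE u in \<nu>. \<psi> u \<le> c \<Longrightarrow> (\<integral>u. \<psi> u \<partial>Q) \<le> c"
    and pos: "AE y in P. 0 < (\<integral>u. k u y \<partial>Q)"
    and int: "integrable P (\<lambda>y. ln (\<integral>u. k u y \<partial>Q))"
  shows "(\<integral>y. ln (\<integral>u. k u y \<partial>Q) \<partial>P) \<le> sup_ell"
proof (rule field_le_epsilon)
  interpret Q: prob_space Q by fact
  fix \<delta> :: real assume \<delta>: "0 < \<delta>"
  obtain g where g: "dens g" and le: "\<And>h. dens h \<Longrightarrow> (\<integral>y. mix h y / mix g y \<partial>P) \<le> 1 + \<delta>"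
    using near_maximizer[OF \<delta>] by blast
  let ?m = "\<lambda>y. \<integral>u. k u y \<partial>Q"
  have [measurable]: "mix g \<in> borel_measurable P" by (rule mix_measurable[OF g])
  have sQ: "sets Q = sets \<nu>" using Q(2) sets_nu by simp
  have "(\<lambda>(u, y). k u y) \<in> borel_measurable (Q \<Otimes>\<^sub>M P)"
    using k_measurable by (simp cong: measurable_cong_sets sets_pair_measure_cong add: sQ)
  note [measurable] = this
  have [measurable]: "?m \<in> borel_measurable P" by measurable
  have m0: "0 \<le> ?m y" if "y \<in> space P" for y
    using k_nonneg[OF that] by (intro integral_nonneg_AE) auto
  have nn: "(\<integral>\<^sup>+y. ennreal (?m y / mix g y) \<partial>P) \<le> ennreal (1 + \<delta>)"
    unfolding nn_integral_gradient[OF g Q(1) sQ, symmetric]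
    using gradient_AE_le[OF g le] \<delta> by (intro nn_integral_gradient_le[OF g Q] transfer) auto
  have r0: "AE y in P. 0 \<le> ?m y / mix g y"
    using m0 mix_pos[OF g] by (auto simp: less_imp_le)
  have ri: "integrable P (\<lambda>y. ?m y / mix g y)"
    using le_less_trans[OF nn] r0 by (intro integrableI_nonneg) auto
  have rle: "(\<integral>y. ?m y / mix g y \<partial>P) \<le> 1 + \<delta>"
    using nn nn_integral_eq_integral[OF ri r0] \<delta> by (simp del: ennreal_plus)
  have "(\<integral>y. ln (?m y) \<partial>P) - ell g = (\<integral>y. ln (?m y) - ln (mix g y) \<partial>P)"
    unfolding ell_def using int ln_mix_integrable[OF g] by simp
  also have "\<dots> \<le> (\<integral>y. ?m y / mix g y - 1 \<partial>P)"
  proof (rule integral_mono_AE)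
    show "AE y in P. ln (?m y) - ln (mix g y) \<le> ?m y / mix g y - 1"
      using pos AE_space
    proof eventually_elim
      case (elim y)
      then show ?case
        using ln_le_minus_one[of "?m y / mix g y"] mix_pos[OF g elim(2)] by (simp add: ln_div)
    qed
  qed (use int ri ln_mix_integrable[OF g] in auto)
  also have "\<dots> \<le> \<delta>" using ri rle by (simp add: prob_space)
  finally show "(\<integral>y. ln (?m y) \<partial>P) \<le> sup_ell + \<delta>"
    using ell_le_sup_ell[OF g] by simp
qed

end

section \<open>Joint measurability, finite divergences and the weak closure\<close>

lemma caratheodory_measurable:
  fixes k :: "'u::{metric_space, second_countable_topology} \<Rightarrow> 'y \<Rightarrow> real"
  assumes meas: "\<And>u. k u \<in> borel_measurable N"
    and cont: "\<And>y. y \<in> space N \<Longrightarrow> continuous_on UNIV (\<lambda>u. k u y)"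
  shows "(\<lambda>(u, y). k u y) \<in> borel_measurable (borel \<Otimes>\<^sub>M N)"
proof -
  obtain D :: "'u set" where D: "countable D" "\<And>U. open U \<Longrightarrow> U \<noteq> {} \<Longrightarrow> \<exists>d\<in>D. d \<in> U"
    using countable_dense_exists by blast
  have "D \<noteq> {}" using D(2)[of UNIV] by auto
  define e where "e = from_nat_into D"
  have e: "\<exists>j. dist u (e j) < r" if r: "0 < r" for u r
  proof -
    obtain d where "d \<in> D" "d \<in> ball u r" using D(2)[of "ball u r"] r by auto
    then show ?thesis
      using D(1) unfolding e_def by (auto intro!: exI[of _ "to_nat_on D d"])
  qed
  \<comment> \<open>The index of the first point of a dense sequence close to \<open>u\<close>. It
    takes countably many values, so the kernel at that point is jointly measurable, and continuity
    in \<open>u\<close> gives the limit.\<close>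
  define j where "j n u = (LEAST j. dist u (e j) < 1 / real (Suc n))" for n u
  have j: "dist u (e (j n u)) < 1 / real (Suc n)" for n u
    unfolding j_def by (rule LeastI_ex, rule e) simp
  have jm [measurable]: "j n \<in> borel \<rightarrow>\<^sub>M count_space UNIV" for n
    unfolding j_def[abs_def] by measurable
  have "(\<lambda>x. k (e (j n (fst x))) (snd x)) \<in> borel_measurable (borel \<Otimes>\<^sub>M N)" for n
  proof (rule measurable_compose_countable[of "\<lambda>i x. k (e i) (snd x)" _ _ "\<lambda>x. j n (fst x)"])
    show "(\<lambda>x. k (e i) (snd x)) \<in> borel_measurable (borel \<Otimes>\<^sub>M N)" for i
      using meas by measurable
  qed measurable
  moreover have "(\<lambda>n. k (e (j n (fst x))) (snd x)) \<longlonglongrightarrow> (\<lambda>(u, y). k u y) x"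
    if "x \<in> space (borel \<Otimes>\<^sub>M N)" for x
  proof -
    have y: "snd x \<in> space N" using that by (auto simp: space_pair_measure)
    have "(\<lambda>n. dist (e (j n (fst x))) (fst x)) \<longlonglongrightarrow> 0"
    proof (rule tendsto_sandwich[OF _ _ tendsto_const LIMSEQ_inverse_real_of_nat])
      show "\<forall>\<^sub>F n in sequentially. dist (e (j n (fst x))) (fst x) \<le> inverse (real (Suc n))"
        using j[of "fst x"] by (auto simp: dist_commute inverse_eq_divide less_imp_le)
    qed auto
    then have "(\<lambda>n. e (j n (fst x))) \<longlonglongrightarrow> fst x" by (rule iffD2[OF tendsto_dist_iff])
    then show ?thesis
      using cont[OF y] by (auto simp: case_prod_beta intro!: continuous_on_tendsto_compose[where f="\<lambda>u. k u (snd x)" and s=UNIV])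
  qed
  ultimately show ?thesis by (rule borel_measurable_LIMSEQ_real[rotated])
qed

text \<open>Integrated against \<open>a\<close>, the right-hand side is at most the total mass of
  the second density, so the negative part of a divergence is finite.\<close>

lemma neg_log_ratio_le:
  assumes "0 < a" "0 \<le> b"
  shows "e2ennreal (- log_ratio a b) \<le> ennreal (b / a)"
proof (cases "b = 0")
  case True
  then show ?thesis by (simp add: log_ratio_def e2ennreal_neg)
next
  case False
  then have "- ln (a / b) \<le> b / a"
    using ln_le_minus_one[of "b / a"] assms by (simp add: ln_div)
  then show ?thesis
    using False by (simp add: log_ratio_def e2ennreal_ereal ennreal_leI del: ln_div)
qed

text \<open>The negative part is finite by \<open>neg_log_ratio_le\<close>, so a divergence below
  infinity has a finite positive part as well; the log ratio is then integrable and \<open>q\<close>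
  is positive almost surely.\<close>

lemma kl_div_finite:
  fixes N :: "'y measure" and m q :: "'y \<Rightarrow> real"
  defines "P \<equiv> density N (\<lambda>y. ennreal (m y))"
  assumes m: "is_density N m" and [measurable]: "q \<in> borel_measurable N"
    and q: "\<And>y. y \<in> space N \<Longrightarrow> 0 \<le> q y" "(\<integral>\<^sup>+y. ennreal (q y / m y) \<partial>P) \<le> 1"
    and fin: "kl_div N m q < \<infinity>"
  shows "AE y in P. 0 < q y" "integrable P (\<lambda>y. ln (m y / q y))"
    "kl_div N m q = ereal (\<integral>y. ln (m y / q y) \<partial>P)"
proof -
  have [measurable]: "m \<in> borel_measurable N"
    using m by (auto simp: is_density_def)
  have [measurable]: "(\<lambda>y. log_ratio (m y) (q y)) \<in> borel_measurable N"
    unfolding log_ratio_def by measurable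
  have setsP [measurable_cong]: "sets P = sets N" by (simp add: P_def)
  let ?pos = "\<integral>\<^sup>+y. e2ennreal (log_ratio (m y) (q y)) \<partial>P"
  let ?neg = "\<integral>\<^sup>+y. e2ennreal (- log_ratio (m y) (q y)) \<partial>P"
  have kl: "kl_div N m q = enn2ereal ?pos - enn2ereal ?neg"
    unfolding kl_div_def P_def by (simp add: nn_integral_density mult.commute)
  have "AE y in P. 0 < m y \<and> 0 \<le> q y"
    unfolding P_def using q(1) by (simp add: AE_density)
  then have "?neg \<le> (\<integral>\<^sup>+y. ennreal (q y / m y) \<partial>P)"
    by (intro nn_integral_mono_AE, eventually_elim) (simp add: neg_log_ratio_le)
  also have "\<dots> \<le> 1" by (rule q)
  finally have neg: "?neg \<noteq> \<top>" by (auto simp: top_unique)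
  have pos: "?pos \<noteq> \<top>"
  proof
    assume "?pos = \<top>"
    then show False using fin neg unfolding kl by (cases ?neg) auto
  qed
  then have "AE y in P. e2ennreal (log_ratio (m y) (q y)) \<noteq> \<infinity>"
    by (intro nn_integral_PInf_AE) auto
  with AE_space show q_pos: "AE y in P. 0 < q y"
  proof eventually_elim
    case (elim y)
    then show ?case using q(1)[of y] by (cases "q y = 0") (auto simp: log_ratio_def P_def)
  qed
  have eq: "AE y in P. log_ratio (m y) (q y) = ereal (ln (m y / q y))"
    using q_pos by eventually_elim (simp add: log_ratio_def)
  have pos_eq: "?pos = (\<integral>\<^sup>+y. ennreal (ln (m y / q y)) \<partial>P)"
    by (intro nn_integral_cong_AE, use eq in eventually_elim) (simp add: e2ennreal_ereal)
  have neg_eq: "?neg = (\<integral>\<^sup>+y. ennreal (- ln (m y / q y)) \<partial>P)"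
    by (intro nn_integral_cong_AE, use eq in eventually_elim) (simp add: e2ennreal_ereal)
  show int: "integrable P (\<lambda>y. ln (m y / q y))"
    unfolding real_integrable_def using pos neg pos_eq neg_eq by simp
  have fin_eq: "enn2ereal x = ereal (enn2real x)" if "x \<noteq> \<top>" for x
    using that by (cases x) auto
  show "kl_div N m q = ereal (\<integral>y. ln (m y / q y) \<partial>P)"
    unfolding kl real_lebesgue_integral_def[OF int] pos_eq[symmetric] neg_eq[symmetric]
    using fin_eq[OF pos] fin_eq[OF neg] by simp
qed

lemma mixing_densities_subset_closure:
  fixes \<mu> :: "'u::topological_space measure"
  assumes "sets \<mu> = sets borel"
  shows "mixing_densities \<mu> \<subseteq> mixing_closure \<mu>"
proof -
  have "mixing_densities \<mu> \<subseteq> space (prob_algebra borel)"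
  proof
    fix Q assume "Q \<in> mixing_densities \<mu>"
    then obtain f where Q: "Q = density \<mu> (\<lambda>u. ennreal (f u))" and f: "is_density \<mu> f"
      by (auto simp: mixing_densities_def)
    have "prob_space Q"
      unfolding Q using f
      by (intro prob_spaceI) (simp add: emeasure_density is_density_def cong: nn_integral_cong)
    then show "Q \<in> space (prob_algebra borel)" using assms by (simp add: space_prob_algebra Q)
  qed
  also have "space (prob_algebra borel) \<subseteq> topspace (weak_topology :: 'u measure topology)"
  proof -
    \<comment> \<open>The subbasic set of the zero function with \<open>V = UNIV\<close> is the
      whole space; a closure only sees points of the \<open>topspace\<close>.\<close>
    have "space (prob_algebra borel) \<in>
        {{P \<in> space (prob_algebra borel). (\<integral>x. g x \<partial>P) \<in> V} | (g :: 'u \<Rightarrow> real) V.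
          continuous_on UNIV g \<and> bounded (range g) \<and> open V}"
      by (intro CollectI exI[of _ "\<lambda>_. 0"] exI[of _ UNIV]) (auto simp: bounded_def)
    then show ?thesis unfolding weak_topology_def topology_generated_by_topspace by blast
  qed
  finally show ?thesis unfolding mixing_closure_def by (rule closure_of_subset)
qed

lemma topspace_weak_topology_subset: "topspace weak_topology \<subseteq> space (prob_algebra borel)"
  unfolding weak_topology_def topology_generated_by_topspace by auto

lemma mixing_closure_prob:
  fixes \<mu> :: "'u::topological_space measure"
  assumes "Q \<in> mixing_closure \<mu>"
  shows "prob_space Q" "sets Q = sets borel"
proof -
  have "Q \<in> topspace weak_topology"
    using assms unfolding mixing_closure_def in_closure_of by blast
  then have "Q \<in> space (prob_algebra borel)" using topspace_weak_topology_subset by blast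
  then show "prob_space Q" "sets Q = sets borel" by (auto simp: space_prob_algebra)
qed

text \<open>Otherwise \<open>Q\<close> lies in the open set of measures whose integral of
  \<open>\<psi>\<close> exceeds \<open>c\<close>, which then contains a measure with a density; but
  such a measure gives no mass to \<open>\<mu>\<close>-null sets.\<close>

lemma mixing_closure_integral_le:
  fixes \<psi> :: "'u::topological_space \<Rightarrow> real"
  assumes Q: "Q \<in> mixing_closure \<mu>" and \<mu>: "sets \<mu> = sets borel"
    and \<psi>: "continuous_on UNIV \<psi>" "bounded (range \<psi>)" and le: "AE u in \<mu>. \<psi> u \<le> c"
  shows "(\<integral>u. \<psi> u \<partial>Q) \<le> c"
proof (rule ccontr)
  assume contra: "\<not> (\<integral>u. \<psi> u \<partial>Q) \<le> c"
  let ?U = "{P \<in> space (prob_algebra borel). (\<integral>x. \<psi> x \<partial>P) \<in> {c<..}}"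
  have "openin weak_topology ?U"
    unfolding weak_topology_def
  proof (rule topology_generated_by_Basis, rule CollectI)
    show "\<exists>(g :: 'u \<Rightarrow> real) V. ?U = {P \<in> space (prob_algebra borel). (\<integral>x. g x \<partial>P) \<in> V} \<and>
        continuous_on UNIV g \<and> bounded (range g) \<and> open V"
      by (rule exI[of _ \<psi>], rule exI[of _ "{c<..}"]) (simp add: \<psi>)
  qed
  moreover have "Q \<in> ?U"
    using mixing_closure_prob[OF Q] contra by (auto simp: space_prob_algebra)
  moreover have "\<forall>T. Q \<in> T \<and> openin weak_topology T \<longrightarrow> (\<exists>P. P \<in> mixing_densities \<mu> \<and> P \<in> T)"
    using Q unfolding mixing_closure_def in_closure_of by (rule conjunct2)
  ultimately have "\<exists>P. P \<in> mixing_densities \<mu> \<and> P \<in> ?U" by (elim allE[of _ ?U] impE conjI)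
  then obtain P where P: "P \<in> mixing_densities \<mu>" "P \<in> ?U" by (elim exE conjE)
  then obtain f where f: "P = density \<mu> (\<lambda>u. ennreal (f u))" "is_density \<mu> f"
    by (auto simp: mixing_densities_def)
  interpret P: prob_space P using P(2) by (simp add: space_prob_algebra)
  have sP: "sets P = sets borel" using P(2) by (simp add: space_prob_algebra)
  have "f \<in> borel_measurable \<mu>" using f by (simp add: is_density_def)
  then have leP: "AE u in P. \<psi> u \<le> c"
  proof -
    have "AE u in \<mu>. 0 < ennreal (f u) \<longrightarrow> \<psi> u \<le> c" using le by eventually_elim simp
    then show ?thesis
      unfolding f(1) using \<open>f \<in> borel_measurable \<mu>\<close> by (simp add: AE_density)
  qed
  obtain B where "\<And>u. \<bar>\<psi> u\<bar> \<le> B" using \<psi>(2) by (auto simp: bounded_iff)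
  moreover have "\<psi> \<in> borel_measurable P"
    using borel_measurable_continuous_onI[OF \<psi>(1)] sP by (simp cong: measurable_cong_sets)
  ultimately have "integrable P \<psi>" by (intro P.integrable_const_bound[of _ B]) auto
  then have "(\<integral>u. \<psi> u \<partial>P) \<le> (\<integral>u. c \<partial>P)" using leP by (intro integral_mono_AE) auto
  then show False using P(2) by (simp add: P.prob_space)
qed

section \<open>The marginal likelihood\<close>

lemma ennreal_ratio_cancel:
  assumes "0 < c" "0 \<le> a" "0 \<le> b"
  shows "ennreal (a / c) / ennreal (b / c) = ennreal a / ennreal b"
proof (cases "b = 0")
  case True
  then show ?thesis
    using assms by (cases "a = 0") (auto simp: divide_ennreal_def ennreal_mult_top)
next
  case False
  then show ?thesis using assms by (simp add: divide_ennreal)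
qed

lemma (in iid_sequence) nn_integral_swap_le:
  assumes Q: "prob_space Q" "sets Q = sets X"
    and F: "(\<lambda>(u, y). F u y) \<in> borel_measurable (X \<Otimes>\<^sub>M P)"
    and le: "\<And>u. (\<integral>\<^sup>+y. F u y \<partial>P) \<le> c"
  shows "(\<integral>\<^sup>+y. \<integral>\<^sup>+u. F u y \<partial>Q \<partial>P) \<le> c"
proof -
  interpret Q: prob_space Q by fact
  interpret QP: pair_sigma_finite Q P ..
  have "(\<lambda>(u, y). F u y) \<in> borel_measurable (Q \<Otimes>\<^sub>M P)"
    using F by (simp cong: measurable_cong_sets sets_pair_measure_cong add: Q(2))
  then have "(\<integral>\<^sup>+y. \<integral>\<^sup>+u. F u y \<partial>Q \<partial>P) = (\<integral>\<^sup>+u. \<integral>\<^sup>+y. F u y \<partial>P \<partial>Q)"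
    by (rule QP.Fubini')
  also have "\<dots> \<le> (\<integral>\<^sup>+u. c \<partial>Q)" by (intro nn_integral_mono le)
  also have "\<dots> = c" by (simp add: Q.emeasure_space_1)
  finally show ?thesis .
qed

text \<open>The kernels \<open>p \<theta>\<close> are divided by the mixture \<open>\<rho>\<close> of a reference parameter \<open>\<theta>\<^sub>0\<close>: the logarithm of
  a mixture itself need not be integrable, while ratios of mixtures are square-integrable by (5).\<close>

locale pr_model =
  fixes N :: "'y measure" and \<mu> :: "'u::{metric_space, second_countable_topology} measure"
    and \<Theta> :: "'t set" and p :: "'t \<Rightarrow> 'u \<Rightarrow> 'y \<Rightarrow> real" and m :: "'y \<Rightarrow> real"
    and w :: "nat \<Rightarrow> real" and f\<^sub>0 :: "'t \<Rightarrow> 'u \<Rightarrow> real" and \<theta>\<^sub>0 :: 't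
  assumes sets_mu: "sets \<mu> = sets borel"
    and kernel: "\<And>\<theta> u. \<theta> \<in> \<Theta> \<Longrightarrow> is_density N (p \<theta> u)"
    and weights: "\<And>n. n \<ge> 1 \<Longrightarrow> 0 < w n \<and> w n < 1"
    and initial: "\<And>\<theta>. \<theta> \<in> \<Theta> \<Longrightarrow> is_density \<mu> (f\<^sub>0 \<theta>)"
    and initial_pos: "\<And>\<theta>. \<theta> \<in> \<Theta> \<Longrightarrow> AE u in \<mu>. 0 < f\<^sub>0 \<theta> u"
    and m_density: "is_density N m"
    and kl_fin: "\<And>\<theta> Q. \<theta> \<in> \<Theta> \<Longrightarrow> Q \<in> mixing_closure \<mu> \<Longrightarrow> kl_div N m (mixture (p \<theta>) Q) < \<infinity>"
    and w_div: "\<not> summable (\<lambda>n. w (Suc n))" and w_sq: "summable (\<lambda>n. (w (Suc n))\<^sup>2)"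
    and regular: "\<And>\<theta> y. \<theta> \<in> \<Theta> \<Longrightarrow> y \<in> space N \<Longrightarrow>
               bounded (range (\<lambda>u. p \<theta> u y)) \<and> continuous_on UNIV (\<lambda>u. p \<theta> u y)"
    and ratio: "\<And>\<theta>\<^sub>1 \<theta>\<^sub>2. \<theta>\<^sub>1 \<in> \<Theta> \<Longrightarrow> \<theta>\<^sub>2 \<in> \<Theta> \<Longrightarrow> \<exists>A::real.
               (SUP u\<^sub>1. SUP u\<^sub>2. \<integral>\<^sup>+y. (ennreal (p \<theta>\<^sub>1 u\<^sub>1 y) / ennreal (p \<theta>\<^sub>2 u\<^sub>2 y))\<^sup>2 * ennreal (m y) \<partial>N)
                 \<le> ennreal A"
    and theta0: "\<theta>\<^sub>0 \<in> \<Theta>"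
begin

definition P :: "'y measure" where "P = density N (\<lambda>y. ennreal (m y))"

definition \<nu> :: "'t \<Rightarrow> 'u measure" where "\<nu> \<theta> = density \<mu> (\<lambda>u. ennreal (f\<^sub>0 \<theta> u))"

definition \<rho> :: "'y \<Rightarrow> real" where "\<rho> = mixture (p \<theta>\<^sub>0) (\<nu> \<theta>\<^sub>0)"

text \<open>The inner integral is the \<open>\<nu> \<theta>\<close>-measure of the points
  \<open>u\<close> at which the kernel is not positive; as an integral it is measurable in
  \<open>y\<close> by Tonelli.\<close>

definition good :: "'t \<Rightarrow> 'y set" where
  "good \<theta> = {y \<in> space N. 0 < \<rho> y \<and> (\<integral>\<^sup>+u. (if 0 < p \<theta> u y then 0 else 1) \<partial>\<nu> \<theta>) = 0}"

text \<open>The value 1 outside \<open>good \<theta>\<close>, on a null set, makes the mixtures positive at every point.\<close>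

definition nkernel :: "'t \<Rightarrow> 'u \<Rightarrow> 'y \<Rightarrow> real" where
  "nkernel \<theta> u y = (if y \<in> good \<theta> then p \<theta> u y / \<rho> y else 1)"

lemma m_measurable [measurable]: "m \<in> borel_measurable N"
  using m_density by (simp add: is_density_def)

lemma sets_P [measurable_cong]: "sets P = sets N" by (simp add: P_def)

lemma space_P: "space P = space N" by (simp add: P_def)

lemma prob_space_P: "prob_space P"
  using m_density
  by (intro prob_spaceI) (simp add: P_def emeasure_density is_density_def cong: nn_integral_cong)

sublocale iid_sequence P
  by (rule iid_sequence.intro, rule prob_space_P)

lemma space_mu: "space \<mu> = UNIV"
  using sets_eq_imp_space_eq[OF sets_mu] by simp

lemma sets_nu: "sets (\<nu> \<theta>) = sets borel"
  by (simp add: \<nu>_def sets_mu)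

lemma f0_measurable: "\<theta> \<in> \<Theta> \<Longrightarrow> f\<^sub>0 \<theta> \<in> borel_measurable \<mu>"
  using initial by (simp add: is_density_def)

lemma f0_nonneg: "\<theta> \<in> \<Theta> \<Longrightarrow> 0 \<le> f\<^sub>0 \<theta> u"
  using initial[of \<theta>] by (simp add: is_density_def space_mu)

lemma nu_closure: "\<theta> \<in> \<Theta> \<Longrightarrow> \<nu> \<theta> \<in> mixing_closure \<mu>"
  using mixing_densities_subset_closure[OF sets_mu] initial
  by (auto simp: mixing_densities_def \<nu>_def)

lemma prob_space_nu: "\<theta> \<in> \<Theta> \<Longrightarrow> prob_space (\<nu> \<theta>)"
  using nu_closure mixing_closure_prob by blast

lemma p_measurable_right: "\<theta> \<in> \<Theta> \<Longrightarrow> p \<theta> u \<in> borel_measurable P"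
  using kernel[of \<theta> u] by (simp add: is_density_def cong: measurable_cong_sets add: sets_P)

lemma p_measurable:
  assumes "\<theta> \<in> \<Theta>"
  shows "(\<lambda>(u, y). p \<theta> u y) \<in> borel_measurable (borel \<Otimes>\<^sub>M P)"
proof (rule caratheodory_measurable)
  show "continuous_on UNIV (\<lambda>u. p \<theta> u y)" if "y \<in> space P" for y
    using regular[OF assms, of y] that by (simp add: space_P)
qed (rule p_measurable_right[OF assms])

lemma p_nonneg: "\<theta> \<in> \<Theta> \<Longrightarrow> y \<in> space P \<Longrightarrow> 0 \<le> p \<theta> u y"
  using kernel[of \<theta> u] by (simp add: is_density_def space_P)

lemma p_integrable:
  assumes "\<theta> \<in> \<Theta>" "prob_space Q" "sets Q = sets borel" "y \<in> space P"
  shows "integrable Q (\<lambda>u. p \<theta> u y)"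
proof -
  interpret Q: prob_space Q by fact
  have reg: "bounded (range (\<lambda>u. p \<theta> u y))" "continuous_on UNIV (\<lambda>u. p \<theta> u y)"
    using regular[of \<theta> y] assms by (auto simp: space_P)
  obtain B where "\<And>u. \<bar>p \<theta> u y\<bar> \<le> B" using reg(1) by (auto simp: bounded_iff)
  moreover have "(\<lambda>u. p \<theta> u y) \<in> borel_measurable Q"
    using borel_measurable_continuous_onI[OF reg(2)] assms(3) by (simp cong: measurable_cong_sets)
  ultimately show ?thesis by (intro Q.integrable_const_bound[of _ B]) auto
qed

lemma mixture_measurable:
  assumes "\<theta> \<in> \<Theta>" "prob_space Q" "sets Q = sets borel"
  shows "mixture (p \<theta>) Q \<in> borel_measurable P"
proof -
  interpret Q: prob_space Q by fact
  have "(\<lambda>(u, y). p \<theta> u y) \<in> borel_measurable (Q \<Otimes>\<^sub>M P)"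
    using p_measurable[OF assms(1)]
    by (simp cong: measurable_cong_sets sets_pair_measure_cong add: assms(3))
  note [measurable] = this
  show ?thesis unfolding mixture_def[abs_def] by measurable
qed

lemma mixture_nonneg: "\<theta> \<in> \<Theta> \<Longrightarrow> y \<in> space P \<Longrightarrow> 0 \<le> mixture (p \<theta>) Q y"
  unfolding mixture_def by (intro integral_nonneg_AE AE_I2 p_nonneg)

lemma ratio_bound:
  assumes "\<theta>\<^sub>1 \<in> \<Theta>" "\<theta>\<^sub>2 \<in> \<Theta>"
  obtains A :: real where "0 \<le> A"
    and "\<And>u\<^sub>1 u\<^sub>2. (\<integral>\<^sup>+y. (ennreal (p \<theta>\<^sub>1 u\<^sub>1 y) / ennreal (p \<theta>\<^sub>2 u\<^sub>2 y))\<^sup>2 \<partial>P) \<le> ennreal A"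
proof -
  let ?I = "\<lambda>u\<^sub>1 u\<^sub>2. \<integral>\<^sup>+y. (ennreal (p \<theta>\<^sub>1 u\<^sub>1 y) / ennreal (p \<theta>\<^sub>2 u\<^sub>2 y))\<^sup>2 * ennreal (m y) \<partial>N"
  obtain A where A: "(SUP u\<^sub>1. SUP u\<^sub>2. ?I u\<^sub>1 u\<^sub>2) \<le> ennreal A" using ratio[OF assms] by blast
  have [measurable]: "p \<theta>\<^sub>1 u \<in> borel_measurable N" "p \<theta>\<^sub>2 u \<in> borel_measurable N" for u
    using kernel[OF assms(1), of u] kernel[OF assms(2), of u] by (auto simp: is_density_def)
  have "(\<integral>\<^sup>+y. (ennreal (p \<theta>\<^sub>1 u\<^sub>1 y) / ennreal (p \<theta>\<^sub>2 u\<^sub>2 y))\<^sup>2 \<partial>P) \<le> ennreal (max 0 A)" for u\<^sub>1 u\<^sub>2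
  proof -
    have "(\<integral>\<^sup>+y. (ennreal (p \<theta>\<^sub>1 u\<^sub>1 y) / ennreal (p \<theta>\<^sub>2 u\<^sub>2 y))\<^sup>2 \<partial>P) = ?I u\<^sub>1 u\<^sub>2"
      unfolding P_def by (simp add: nn_integral_density mult.commute)
    also have "\<dots> \<le> (SUP u\<^sub>2. ?I u\<^sub>1 u\<^sub>2)" by (rule SUP_upper) simp
    also have "\<dots> \<le> (SUP u\<^sub>1. SUP u\<^sub>2. ?I u\<^sub>1 u\<^sub>2)" by (rule SUP_upper) simp
    also note A
    also have "ennreal A \<le> ennreal (max 0 A)" by (rule ennreal_leI) simp
    finally show ?thesis .
  qed
  then show ?thesis by (rule that[rotated]) simp
qed

text \<open>Jensen for the square and Tonelli pass the ratio bound from kernels to mixtures in the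
  numerator. With the reference mixture on top it bounds the reciprocal of the normalized
  kernel.\<close>

lemma mixture_over_kernel:
  assumes th: "\<theta>\<^sub>1 \<in> \<Theta>" "\<theta>\<^sub>2 \<in> \<Theta>" and Q: "prob_space Q" "sets Q = sets borel"
    and le: "\<And>u\<^sub>1 u\<^sub>2. (\<integral>\<^sup>+y. (ennreal (p \<theta>\<^sub>1 u\<^sub>1 y) / ennreal (p \<theta>\<^sub>2 u\<^sub>2 y))\<^sup>2 \<partial>P) \<le> ennreal A"
  shows "(\<integral>\<^sup>+y. (ennreal (mixture (p \<theta>\<^sub>1) Q y) / ennreal (p \<theta>\<^sub>2 u\<^sub>2 y))\<^sup>2 \<partial>P) \<le> ennreal A"
proof -
  interpret Q: prob_space Q by fact
  note [measurable] = p_measurable_right[OF th(2)]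
  have sq: "(ennreal a / b)\<^sup>2 = ennreal (a\<^sup>2) * (inverse b)\<^sup>2" if "0 \<le> a" for a b
    using that by (simp add: divide_ennreal_def power_mult_distrib ennreal_power)
  have "(\<integral>\<^sup>+y. (ennreal (mixture (p \<theta>\<^sub>1) Q y) / ennreal (p \<theta>\<^sub>2 u\<^sub>2 y))\<^sup>2 \<partial>P)
      \<le> (\<integral>\<^sup>+y. \<integral>\<^sup>+u. (ennreal (p \<theta>\<^sub>1 u y) / ennreal (p \<theta>\<^sub>2 u\<^sub>2 y))\<^sup>2 \<partial>Q \<partial>P)"
  proof (rule nn_integral_mono)
    fix y assume y: "y \<in> space P"
    note int = p_integrable[OF th(1) Q y]
    have "(ennreal (mixture (p \<theta>\<^sub>1) Q y) / ennreal (p \<theta>\<^sub>2 u\<^sub>2 y))\<^sup>2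
        \<le> (\<integral>\<^sup>+u. ennreal ((p \<theta>\<^sub>1 u y)\<^sup>2) \<partial>Q) * (inverse (ennreal (p \<theta>\<^sub>2 u\<^sub>2 y)))\<^sup>2"
      unfolding sq[OF mixture_nonneg[OF th(1) y]]
      unfolding mixture_def by (intro mult_right_mono Q.square_expectation_le int) simp
    also have "\<dots> = (\<integral>\<^sup>+u. ennreal ((p \<theta>\<^sub>1 u y)\<^sup>2) * (inverse (ennreal (p \<theta>\<^sub>2 u\<^sub>2 y)))\<^sup>2 \<partial>Q)"
      using borel_measurable_integrable[OF int] by (intro nn_integral_multc[symmetric]) measurable
    finally show "(ennreal (mixture (p \<theta>\<^sub>1) Q y) / ennreal (p \<theta>\<^sub>2 u\<^sub>2 y))\<^sup>2
        \<le> (\<integral>\<^sup>+u. (ennreal (p \<theta>\<^sub>1 u y) / ennreal (p \<theta>\<^sub>2 u\<^sub>2 y))\<^sup>2 \<partial>Q)"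
      by (simp add: sq p_nonneg[OF th(1) y])
  qed
  also
  note p_measurable[OF th(1), measurable]
  have "(\<integral>\<^sup>+y. \<integral>\<^sup>+u. (ennreal (p \<theta>\<^sub>1 u y) / ennreal (p \<theta>\<^sub>2 u\<^sub>2 y))\<^sup>2 \<partial>Q \<partial>P) \<le> ennreal A"
    by (rule nn_integral_swap_le[OF Q _ le]) measurable
  finally show ?thesis .
qed

text \<open>Jensen for the inverse square does the same in the denominator; it bounds the normalized
  kernel itself.\<close>

lemma kernel_over_mixture:
  assumes th: "\<theta>\<^sub>1 \<in> \<Theta>" "\<theta>\<^sub>2 \<in> \<Theta>" and Q: "prob_space Q" "sets Q = sets borel"
    and le: "\<And>u\<^sub>1 u\<^sub>2. (\<integral>\<^sup>+y. (ennreal (p \<theta>\<^sub>1 u\<^sub>1 y) / ennreal (p \<theta>\<^sub>2 u\<^sub>2 y))\<^sup>2 \<partial>P) \<le> ennreal A"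
  shows "(\<integral>\<^sup>+y. (ennreal (p \<theta>\<^sub>1 u\<^sub>1 y) / ennreal (mixture (p \<theta>\<^sub>2) Q y))\<^sup>2 \<partial>P) \<le> ennreal A"
proof -
  interpret Q: prob_space Q by fact
  note [measurable] = p_measurable[OF th(2)] p_measurable_right[OF th(1)]
  have "(\<integral>\<^sup>+y. (ennreal (p \<theta>\<^sub>1 u\<^sub>1 y) / ennreal (mixture (p \<theta>\<^sub>2) Q y))\<^sup>2 \<partial>P)
      \<le> (\<integral>\<^sup>+y. \<integral>\<^sup>+u. (ennreal (p \<theta>\<^sub>1 u\<^sub>1 y) / ennreal (p \<theta>\<^sub>2 u y))\<^sup>2 \<partial>Q \<partial>P)"
    unfolding mixture_def
    by (intro nn_integral_mono Q.square_divide_expectation_le p_integrable[OF th(2) Q] AE_I2 p_nonneg[OF th(2)])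
  also have "\<dots> \<le> ennreal A"
    by (rule nn_integral_swap_le[OF Q _ le]) measurable
  finally show ?thesis .
qed

text \<open>Kernels have total mass 1, so integrating a mixture over \<open>m\<close> against
  \<open>P\<close> gives at most 1, as \<open>kl_div_finite\<close> requires; that the divergence is
  finite is \<open>kl_fin\<close>.\<close>

lemma kl_mixture:
  assumes th: "\<theta> \<in> \<Theta>" and Q: "Q \<in> mixing_closure \<mu>"
  shows "AE y in P. 0 < mixture (p \<theta>) Q y" "integrable P (\<lambda>y. ln (m y / mixture (p \<theta>) Q y))"
    "kl_div N m (mixture (p \<theta>) Q) = ereal (\<integral>y. ln (m y / mixture (p \<theta>) Q y) \<partial>P)"
proof -
  note prob = mixing_closure_prob[OF Q]
  interpret Q: prob_space Q by fact
  note [measurable] = p_measurable[OF th]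
  have m0: "0 \<le> m y" if "y \<in> space P" for y
    using m_density that by (simp add: is_density_def space_P)
  have mix: "mixture (p \<theta>) Q \<in> borel_measurable N"
    using mixture_measurable[OF th prob] by (simp cong: measurable_cong_sets add: sets_P)
  have one: "(\<integral>\<^sup>+y. ennreal (p \<theta> u y / m y) \<partial>P) \<le> 1" for u
  proof -
    have [measurable]: "p \<theta> u \<in> borel_measurable N" using kernel[OF th, of u] by (simp add: is_density_def)
    have "(\<integral>\<^sup>+y. ennreal (p \<theta> u y / m y) \<partial>P) = (\<integral>\<^sup>+y. ennreal (m y) * ennreal (p \<theta> u y / m y) \<partial>N)"
      unfolding P_def by (simp add: nn_integral_density)
    also have "\<dots> \<le> (\<integral>\<^sup>+y. ennreal (p \<theta> u y) \<partial>N)"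
    proof (rule nn_integral_mono)
      fix y assume "y \<in> space N"
      then have "0 \<le> m y" "0 \<le> p \<theta> u y" using m0 p_nonneg[OF th] by (auto simp: space_P)
      then show "ennreal (m y) * ennreal (p \<theta> u y / m y) \<le> ennreal (p \<theta> u y)"
        by (cases "m y = 0") (auto simp: ennreal_mult[symmetric])
    qed
    also have "\<dots> = 1" using kernel[OF th, of u] by (simp add: is_density_def)
    finally show ?thesis .
  qed
  have "(\<integral>\<^sup>+y. ennreal (mixture (p \<theta>) Q y / m y) \<partial>P) = (\<integral>\<^sup>+y. \<integral>\<^sup>+u. ennreal (p \<theta> u y / m y) \<partial>Q \<partial>P)"
  proof (rule nn_integral_cong)
    fix y assume y: "y \<in> space P"
    have "(\<integral>\<^sup>+u. ennreal (p \<theta> u y / m y) \<partial>Q) = ennreal (\<integral>u. p \<theta> u y / m y \<partial>Q)"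
      using p_integrable[OF th prob y] p_nonneg[OF th y] m0[OF y] by (intro nn_integral_eq_integral) auto
    then show "ennreal (mixture (p \<theta>) Q y / m y) = (\<integral>\<^sup>+u. ennreal (p \<theta> u y / m y) \<partial>Q)"
      by (simp add: mixture_def)
  qed
  also have "\<dots> \<le> 1"
    by (rule nn_integral_swap_le[OF prob _ one]) measurable
  finally have le: "(\<integral>\<^sup>+y. ennreal (mixture (p \<theta>) Q y / m y) \<partial>density N (\<lambda>y. ennreal (m y))) \<le> 1"
    by (simp add: P_def)
  have nonneg: "0 \<le> mixture (p \<theta>) Q y" if "y \<in> space N" for y
    using mixture_nonneg[OF th] that by (simp add: space_P)
  note * = kl_div_finite[OF m_density mix nonneg le kl_fin[OF th Q], folded P_def]
  show "AE y in P. 0 < mixture (p \<theta>) Q y" by (rule *(1))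
  show "integrable P (\<lambda>y. ln (m y / mixture (p \<theta>) Q y))" by (rule *(2))
  show "kl_div N m (mixture (p \<theta>) Q) = ereal (\<integral>y. ln (m y / mixture (p \<theta>) Q y) \<partial>P)"
    by (rule *(3))
qed

lemma rho_measurable [measurable]: "\<rho> \<in> borel_measurable P"
  unfolding \<rho>_def by (rule mixture_measurable[OF theta0 prob_space_nu[OF theta0] sets_nu])

lemma p_measurable_nu: "\<theta> \<in> \<Theta> \<Longrightarrow> (\<lambda>(u, y). p \<theta> u y) \<in> borel_measurable (\<nu> \<theta> \<Otimes>\<^sub>M P)"
  using p_measurable by (simp cong: measurable_cong_sets sets_pair_measure_cong add: sets_nu)

lemma good_measurable: 
  assumes "\<theta> \<in> \<Theta>" shows "good \<theta> \<in> sets P"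
proof -
  interpret nu: prob_space "\<nu> \<theta>" by (rule prob_space_nu[OF assms])
  note [measurable] = p_measurable_nu[OF assms]
  have "{y \<in> space P. 0 < \<rho> y \<and> (\<integral>\<^sup>+u. (if 0 < p \<theta> u y then 0 else 1) \<partial>\<nu> \<theta>) = 0} \<in> sets P"
    by measurable
  then show ?thesis by (simp add: good_def space_P)
qed

lemma good_pos:
  assumes "\<theta> \<in> \<Theta>" "y \<in> good \<theta>"
  shows "AE u in \<nu> \<theta>. 0 < p \<theta> u y"
proof -
  have y: "y \<in> space P" using assms by (simp add: good_def space_P)
  have [measurable]: "(\<lambda>u. p \<theta> u y) \<in> borel_measurable (\<nu> \<theta>)"
    using measurable_Pair1[OF p_measurable_nu[OF assms(1)] y] by simp
  have "(\<integral>\<^sup>+u. (if 0 < p \<theta> u y then 0 else 1) \<partial>\<nu> \<theta>) = 0" using assms by (simp add: good_def)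
  then have "AE u in \<nu> \<theta>. (if 0 < p \<theta> u y then 0 else 1 :: ennreal) = 0"
    by (subst (asm) nn_integral_0_iff_AE) simp_all
  then show ?thesis by eventually_elim (simp split: if_splits)
qed

text \<open>For each \<open>u\<close>, the finite second moment of mixture over kernel excludes
  zeros of the kernel for almost all \<open>y\<close>, since the mixture is positive almost surely.
  Tonelli exchanges the quantifiers: for almost all \<open>y\<close>, the kernel is positive at
  almost all \<open>u\<close>.\<close>

lemma good_AE:
  assumes th: "\<theta> \<in> \<Theta>"
  shows "AE y in P. y \<in> good \<theta>"
proof -
  note [measurable] = p_measurable[OF th] p_measurable_right[OF th]
  note nu = prob_space_nu[OF th] sets_nu[of \<theta>]
  obtain A where A: "0 \<le> A"
    "\<And>u\<^sub>1 u\<^sub>2. (\<integral>\<^sup>+y. (ennreal (p \<theta> u\<^sub>1 y) / ennreal (p \<theta> u\<^sub>2 y))\<^sup>2 \<partial>P) \<le> ennreal A"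
    using ratio_bound[OF th th] by blast
  have mm [measurable]: "mixture (p \<theta>) (\<nu> \<theta>) \<in> borel_measurable P" by (rule mixture_measurable[OF th nu])
  have "(\<integral>\<^sup>+y. (if 0 < p \<theta> u y then 0 else 1) \<partial>P) \<le> 0" for u
  proof -
    have "(\<integral>\<^sup>+y. (ennreal (mixture (p \<theta>) (\<nu> \<theta>) y) / ennreal (p \<theta> u y))\<^sup>2 \<partial>P) < \<infinity>"
      using mixture_over_kernel[OF th th nu A(2), of u] by (rule le_less_trans) simp
    then have "AE y in P. (ennreal (mixture (p \<theta>) (\<nu> \<theta>) y) / ennreal (p \<theta> u y))\<^sup>2 \<noteq> \<infinity>"
      by (intro nn_integral_PInf_AE) auto
    with kl_mixture(1)[OF th nu_closure[OF th]] AE_space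
    have "AE y in P. 0 < p \<theta> u y"
    proof eventually_elim
      case (elim y)
      then show ?case
        using p_nonneg[OF th elim(2), of u]
        by (cases "p \<theta> u y = 0") (auto simp: divide_ennreal_def ennreal_mult_top power2_eq_square)
    qed
    then have "(\<integral>\<^sup>+y. (if 0 < p \<theta> u y then 0 else 1 :: ennreal) \<partial>P) = (\<integral>\<^sup>+y. 0 \<partial>P)"
      by (intro nn_integral_cong_AE) (auto elim: eventually_mono)
    then show ?thesis by simp
  qed
  then have "(\<integral>\<^sup>+y. \<integral>\<^sup>+u. (if 0 < p \<theta> u y then 0 else 1) \<partial>\<nu> \<theta> \<partial>P) \<le> 0"
    by (intro nn_integral_swap_le[OF nu]) measurable
  then have zero: "(\<integral>\<^sup>+y. \<integral>\<^sup>+u. (if 0 < p \<theta> u y then 0 else 1) \<partial>\<nu> \<theta> \<partial>P) = 0" by simp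
  interpret nu: prob_space "\<nu> \<theta>" by fact
  note p_measurable_nu[OF th, measurable]
  have "AE y in P. (\<integral>\<^sup>+u. (if 0 < p \<theta> u y then 0 else 1) \<partial>\<nu> \<theta>) = 0"
    using zero by (subst (asm) nn_integral_0_iff_AE) simp_all
  with kl_mixture(1)[OF theta0 nu_closure[OF theta0]] AE_space show ?thesis
    by eventually_elim (simp add: good_def \<rho>_def space_P)
qed

lemma rho_pos: "y \<in> good \<theta> \<Longrightarrow> 0 < \<rho> y"
  by (simp add: good_def)

lemma nkernel_measurable:
  assumes th: "\<theta> \<in> \<Theta>" and Q: "sets Q = sets borel"
  shows "(\<lambda>(u, y). nkernel \<theta> u y) \<in> borel_measurable (Q \<Otimes>\<^sub>M P)"
proof -
  have pm: "(\<lambda>(u, y). p \<theta> u y) \<in> borel_measurable (Q \<Otimes>\<^sub>M P)"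
    using p_measurable[OF th] by (simp cong: measurable_cong_sets sets_pair_measure_cong add: Q)
  note [measurable] = pm good_measurable[OF th]
  show ?thesis unfolding nkernel_def by measurable
qed

lemma nkernel_locale:
  assumes th: "\<theta> \<in> \<Theta>"
  shows "\<exists>A. continuous_mixture_kernel P (\<nu> \<theta>) (nkernel \<theta>) A"
proof -
  \<comment> \<open>Three pairs of parameters enter: \<open>A1\<close> is for ratios within
    \<open>\<theta>\<close>, \<open>A2\<close> for the kernel over the reference, \<open>A3\<close>
    for the reference over the kernel.\<close>
  obtain A1 where A1: "0 \<le> A1"
    "\<And>u\<^sub>1 u\<^sub>2. (\<integral>\<^sup>+y. (ennreal (p \<theta> u\<^sub>1 y) / ennreal (p \<theta> u\<^sub>2 y))\<^sup>2 \<partial>P) \<le> ennreal A1"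
    using ratio_bound[OF th th] by blast
  obtain A2 where A2: "0 \<le> A2"
    "\<And>u\<^sub>1 u\<^sub>2. (\<integral>\<^sup>+y. (ennreal (p \<theta> u\<^sub>1 y) / ennreal (p \<theta>\<^sub>0 u\<^sub>2 y))\<^sup>2 \<partial>P) \<le> ennreal A2"
    using ratio_bound[OF th theta0] by blast
  obtain A3 where A3: "0 \<le> A3"
    "\<And>u\<^sub>1 u\<^sub>2. (\<integral>\<^sup>+y. (ennreal (p \<theta>\<^sub>0 u\<^sub>1 y) / ennreal (p \<theta> u\<^sub>2 y))\<^sup>2 \<partial>P) \<le> ennreal A3"
    using ratio_bound[OF theta0 th] by blast
  define A where "A = A1 + A2 + A3"
  have le: "ennreal A1 \<le> ennreal A" "ennreal A2 \<le> ennreal A" "ennreal A3 \<le> ennreal A"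
    using A1(1) A2(1) A3(1) by (auto simp: A_def intro!: ennreal_leI)
  note nu0 = prob_space_nu[OF theta0] sets_nu[of \<theta>\<^sub>0]
  interpret nu: prob_space "\<nu> \<theta>" by (rule prob_space_nu[OF th])
  have "mixture_kernel P (\<nu> \<theta>) (nkernel \<theta>) A"
  proof unfold_locales
    show "(\<lambda>(u, y). nkernel \<theta> u y) \<in> borel_measurable (\<nu> \<theta> \<Otimes>\<^sub>M P)"
      by (rule nkernel_measurable[OF th sets_nu])
    show "0 \<le> nkernel \<theta> u y" if "y \<in> space P" for u y
      using p_nonneg[OF th that] rho_pos[of y \<theta>] by (auto simp: nkernel_def)
    show "\<exists>B. \<forall>u. nkernel \<theta> u y \<le> B" if y: "y \<in> space P" for y
    proof -
      have "bounded (range (\<lambda>u. p \<theta> u y))" using regular[OF th, of y] y by (simp add: space_P)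
      then obtain B where B: "\<And>u. p \<theta> u y \<le> B" by (auto simp: bounded_iff abs_le_iff)
      have "nkernel \<theta> u y \<le> max 1 (B / \<rho> y)" for u
        using B[of u] rho_pos[of y \<theta>] by (auto simp: nkernel_def divide_right_mono le_max_iff_disj)
      then show ?thesis by blast
    qed
    show "AE u in \<nu> \<theta>. 0 < nkernel \<theta> u y" if "y \<in> space P" for y
    proof (cases "y \<in> good \<theta>")
      case True
      from good_pos[OF th True] show ?thesis
        by eventually_elim (use True rho_pos[of y \<theta>] in \<open>simp add: nkernel_def\<close>)
    qed (simp add: nkernel_def)
    show "(\<integral>\<^sup>+y. (ennreal (nkernel \<theta> u\<^sub>1 y) / ennreal (nkernel \<theta> u\<^sub>2 y))\<^sup>2 \<partial>P) \<le> ennreal A" for u\<^sub>1 u\<^sub>2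
    proof -
      have "(\<integral>\<^sup>+y. (ennreal (nkernel \<theta> u\<^sub>1 y) / ennreal (nkernel \<theta> u\<^sub>2 y))\<^sup>2 \<partial>P)
          = (\<integral>\<^sup>+y. (ennreal (p \<theta> u\<^sub>1 y) / ennreal (p \<theta> u\<^sub>2 y))\<^sup>2 \<partial>P)"
      proof (rule nn_integral_cong_AE, use good_AE[OF th] AE_space in eventually_elim)
        fix y assume y: "y \<in> good \<theta>" "y \<in> space P"
        show "(ennreal (nkernel \<theta> u\<^sub>1 y) / ennreal (nkernel \<theta> u\<^sub>2 y))\<^sup>2
          = (ennreal (p \<theta> u\<^sub>1 y) / ennreal (p \<theta> u\<^sub>2 y))\<^sup>2"
          using ennreal_ratio_cancel[OF rho_pos[OF y(1)] p_nonneg[OF th y(2), of u\<^sub>1] p_nonneg[OF th y(2), of u\<^sub>2]] y(1)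
          by (simp add: nkernel_def)
      qed
      then show ?thesis using A1(2)[of u\<^sub>1 u\<^sub>2] le(1) by (simp add: order_trans)
    qed
    show "(\<integral>\<^sup>+y. ennreal ((nkernel \<theta> u y)\<^sup>2) \<partial>P) \<le> ennreal A" for u
    proof -
      have "(\<integral>\<^sup>+y. ennreal ((nkernel \<theta> u y)\<^sup>2) \<partial>P)
          = (\<integral>\<^sup>+y. (ennreal (p \<theta> u y) / ennreal (mixture (p \<theta>\<^sub>0) (\<nu> \<theta>\<^sub>0) y))\<^sup>2 \<partial>P)"
      proof (rule nn_integral_cong_AE, use good_AE[OF th] AE_space in eventually_elim)
        fix y assume y: "y \<in> good \<theta>" "y \<in> space P"
        show "ennreal ((nkernel \<theta> u y)\<^sup>2)
          = (ennreal (p \<theta> u y) / ennreal (mixture (p \<theta>\<^sub>0) (\<nu> \<theta>\<^sub>0) y))\<^sup>2"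
          using rho_pos[OF y(1)] p_nonneg[OF th y(2), of u] y(1)
          unfolding \<rho>_def[symmetric] by (simp add: nkernel_def divide_ennreal ennreal_power)
      qed
      also have "\<dots> \<le> ennreal A2" by (rule kernel_over_mixture[OF th theta0 nu0 A2(2)])
      finally show ?thesis using le(2) by (rule order_trans)
    qed
    show "(\<integral>\<^sup>+y. (1 / ennreal (nkernel \<theta> u y))\<^sup>2 \<partial>P) \<le> ennreal A" for u
    proof -
      have "(\<integral>\<^sup>+y. (1 / ennreal (nkernel \<theta> u y))\<^sup>2 \<partial>P)
          = (\<integral>\<^sup>+y. (ennreal (mixture (p \<theta>\<^sub>0) (\<nu> \<theta>\<^sub>0) y) / ennreal (p \<theta> u y))\<^sup>2 \<partial>P)"
      proof (rule nn_integral_cong_AE, use good_AE[OF th] AE_space in eventually_elim)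
        fix y assume y: "y \<in> good \<theta>" "y \<in> space P"
        have r: "0 < \<rho> y" by (rule rho_pos[OF y(1)])
        show "(1 / ennreal (nkernel \<theta> u y))\<^sup>2
          = (ennreal (mixture (p \<theta>\<^sub>0) (\<nu> \<theta>\<^sub>0) y) / ennreal (p \<theta> u y))\<^sup>2"
          using ennreal_ratio_cancel[OF r less_imp_le[OF r] p_nonneg[OF th y(2), of u]] y(1) r
          unfolding \<rho>_def[symmetric] by (simp add: nkernel_def)
      qed
      also have "\<dots> \<le> ennreal A3"
        by (rule mixture_over_kernel[OF theta0 th nu0 A3(2)])
      finally show ?thesis using le(3) by (rule order_trans)
    qed
    show "0 \<le> A" using A1(1) A2(1) A3(1) by (simp add: A_def)
    show "space (\<nu> \<theta>) = UNIV" using sets_eq_imp_space_eq[OF sets_nu] by simp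
  qed
  moreover have "continuous_on UNIV (\<lambda>u. nkernel \<theta> u y)" if "y \<in> space P" for y
    using regular[OF th, of y] that
    by (cases "y \<in> good \<theta>") (auto simp: nkernel_def space_P intro!: continuous_intros dest: rho_pos)
  ultimately have "continuous_mixture_kernel P (\<nu> \<theta>) (nkernel \<theta>) A"
    unfolding continuous_mixture_kernel_def continuous_mixture_kernel_axioms_def by (simp add: sets_nu)
  then show ?thesis by blast
qed

section \<open>Divergences in terms of the normalized kernel\<close>

lemma mixture_eq_nkernel:
  assumes "y \<in> good \<theta>"
  shows "mixture (p \<theta>) Q y = \<rho> y * (\<integral>u. nkernel \<theta> u y \<partial>Q)"
  using assms rho_pos[OF assms] by (simp add: mixture_def nkernel_def)

definition kl_reference :: real where
  "kl_reference = (\<integral>y. ln (m y / \<rho> y) \<partial>P)"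

text \<open>Both divergences are finite, so their integrals can be subtracted; \<open>m\<close>
  cancels and only the logarithm of the normalized mixture is left.\<close>

lemma kl_nkernel:
  assumes th: "\<theta> \<in> \<Theta>" and Q: "Q \<in> mixing_closure \<mu>"
  defines "I \<equiv> \<lambda>y. \<integral>u. nkernel \<theta> u y \<partial>Q"
  shows "AE y in P. 0 < I y" "integrable P (\<lambda>y. ln (I y))"
    "kl_div N m (mixture (p \<theta>) Q) = ereal (kl_reference - (\<integral>y. ln (I y) \<partial>P))"
proof -
  note prob = mixing_closure_prob[OF Q]
  interpret Q: prob_space Q by fact
  note [measurable] = nkernel_measurable[OF th prob(2)]
  have [measurable]: "I \<in> borel_measurable P" unfolding I_def by measurable
  have [measurable]: "m \<in> borel_measurable P" by measurable
  note klQ = kl_mixture[OF th Q] and kl0 = kl_mixture[OF theta0 nu_closure[OF theta0], folded \<rho>_def]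
  have m_pos: "AE y in P. 0 < m y"
    unfolding P_def by (simp add: AE_density)
  show I_pos: "AE y in P. 0 < I y"
    using klQ(1) good_AE[OF th]
    by eventually_elim (auto simp: mixture_eq_nkernel I_def zero_less_mult_iff dest: rho_pos)
  have eq: "AE y in P. ln (m y / \<rho> y) - ln (m y / mixture (p \<theta>) Q y) = ln (I y)"
    using klQ(1) good_AE[OF th] I_pos m_pos
  proof eventually_elim
    case (elim y)
    have "mixture (p \<theta>) Q y = \<rho> y * I y" by (simp add: mixture_eq_nkernel[OF elim(2)] I_def)
    then show ?case using elim rho_pos[OF elim(2)] by (simp add: ln_div ln_mult)
  qed
  have int: "integrable P (\<lambda>y. ln (m y / \<rho> y) - ln (m y / mixture (p \<theta>) Q y))"
    using klQ(2) kl0(2) by (rule Bochner_Integration.integrable_diff[rotated])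
  show "integrable P (\<lambda>y. ln (I y))"
    by (rule integrable_cong_AE_imp[OF int]) (use eq in \<open>auto elim: eventually_mono\<close>)
  have "(\<integral>y. ln (I y) \<partial>P) = (\<integral>y. ln (m y / \<rho> y) - ln (m y / mixture (p \<theta>) Q y) \<partial>P)"
    using eq int by (intro integral_cong_AE) (auto elim: eventually_mono)
  also have "\<dots> = kl_reference - (\<integral>y. ln (m y / mixture (p \<theta>) Q y) \<partial>P)"
    unfolding kl_reference_def using kl0(2) klQ(2) by (rule Bochner_Integration.integral_diff)
  finally show "kl_div N m (mixture (p \<theta>) Q) = ereal (kl_reference - (\<integral>y. ln (I y) \<partial>P))"
    using klQ(3) by simp
qed

text \<open>The limit of the log-likelihood per observation, after division of the likelihood by the
  product of the values of \<open>\<rho>\<close>.\<close>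

definition rate :: "'t \<Rightarrow> real" where
  "rate \<theta> = mixture_kernel.sup_ell P (\<nu> \<theta>) (nkernel \<theta>)"

text \<open>One inequality holds because no weak limit exceeds \<open>sup_ell\<close>; the other
  because a bounded \<open>\<nu> \<theta>\<close>-density, multiplied by the initial guess, is
  itself a mixing density.\<close>

lemma min_kl_eq:
  assumes th: "\<theta> \<in> \<Theta>"
  shows "min_kl N \<mu> m (p \<theta>) = ereal (kl_reference - rate \<theta>)"
proof -
  obtain A where "continuous_mixture_kernel P (\<nu> \<theta>) (nkernel \<theta>) A" using nkernel_locale[OF th] by blast
  then interpret K: continuous_mixture_kernel P "\<nu> \<theta>" "nkernel \<theta>" A .
  have rate: "rate \<theta> = K.sup_ell" by (simp add: rate_def)
  note [measurable] = f0_measurable[OF th]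
  show ?thesis
  proof (rule antisym)
    show "ereal (kl_reference - rate \<theta>) \<le> min_kl N \<mu> m (p \<theta>)"
      unfolding min_kl_def
    proof (rule INF_greatest)
      fix Q assume Q: "Q \<in> mixing_closure \<mu>"
      have "(\<integral>y. ln (\<integral>u. nkernel \<theta> u y \<partial>Q) \<partial>P) \<le> K.sup_ell"
      proof (rule K.expectation_ln_mixture_le_sup_ell[OF mixing_closure_prob[OF Q] _ kl_nkernel(1,2)[OF th Q]])
        fix \<psi> :: "'u \<Rightarrow> real" and c
        assume \<psi>: "continuous_on UNIV \<psi>" "bounded (range \<psi>)" and le: "AE u in \<nu> \<theta>. \<psi> u \<le> c"
        \<comment> \<open>The bound is known up to \<open>\<nu> \<theta>\<close>-null sets;
          positivity of the initial guess makes them \<open>\<mu>\<close>-null, as limits of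
          arbitrary mixing densities require.\<close>
        have "AE u in \<mu>. 0 < ennreal (f\<^sub>0 \<theta> u) \<longrightarrow> \<psi> u \<le> c"
          using le unfolding \<nu>_def by (simp add: AE_density)
        with initial_pos[OF th] have "AE u in \<mu>. \<psi> u \<le> c" by eventually_elim simp
        then show "(\<integral>u. \<psi> u \<partial>Q) \<le> c" by (rule mixing_closure_integral_le[OF Q sets_mu \<psi>])
      qed
      then show "ereal (kl_reference - rate \<theta>) \<le> kl_div N m (mixture (p \<theta>) Q)"
        by (simp add: kl_nkernel(3)[OF th Q] rate)
    qed
    show "min_kl N \<mu> m (p \<theta>) \<le> ereal (kl_reference - rate \<theta>)"
    proof (rule ereal_le_epsilon2)
      fix e :: real assume e: "0 < e"
      then obtain g where g: "K.dens g" "K.sup_ell - e < K.ell g"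
        using K.less_sup_ell_dens[of "K.sup_ell - e"] by auto
      define Q where "Q = density (\<nu> \<theta>) (\<lambda>u. ennreal (g u))"
      have gm [measurable]: "g \<in> borel_measurable \<mu>"
        using K.dens_measurable[OF g(1)] by (simp cong: measurable_cong_sets add: sets_nu sets_mu)
      have Q_eq: "Q = density \<mu> (\<lambda>u. ennreal (f\<^sub>0 \<theta> u * g u))"
        unfolding Q_def \<nu>_def using f0_nonneg[OF th] K.dens_nonneg[OF g(1)]
        by (subst density_density_eq) (auto simp: ennreal_mult)
      interpret Q: prob_space Q unfolding Q_def by (rule K.prob_space_dens[OF g(1)])
      have "(\<integral>\<^sup>+u. ennreal (f\<^sub>0 \<theta> u * g u) \<partial>\<mu>) = emeasure Q (space Q)"
        unfolding Q_eq by (simp add: emeasure_density cong: nn_integral_cong)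
      then have "is_density \<mu> (\<lambda>u. f\<^sub>0 \<theta> u * g u)"
        using f0_nonneg[OF th] K.dens_nonneg[OF g(1)] by (simp add: is_density_def Q.emeasure_space_1)
      then have "Q \<in> mixing_densities \<mu>" unfolding mixing_densities_def Q_eq
        by (intro CollectI exI[of _ "\<lambda>u. f\<^sub>0 \<theta> u * g u"] conjI refl)
      then have Q: "Q \<in> mixing_closure \<mu>" using mixing_densities_subset_closure[OF sets_mu] by blast
      have "(\<integral>y. ln (\<integral>u. nkernel \<theta> u y \<partial>Q) \<partial>P) = K.ell g"
        unfolding K.ell_def Q_def
        by (intro Bochner_Integration.integral_cong) (simp_all add: K.mix_eq_integral_density(1)[OF g(1)])
      then have "kl_div N m (mixture (p \<theta>) Q) = ereal (kl_reference - K.ell g)"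
        by (simp add: kl_nkernel(3)[OF th Q])
      moreover have "min_kl N \<mu> m (p \<theta>) \<le> kl_div N m (mixture (p \<theta>) Q)"
        unfolding min_kl_def by (rule INF_lower[OF Q])
      ultimately have "min_kl N \<mu> m (p \<theta>) \<le> ereal (kl_reference - K.ell g)" by simp
      also have "\<dots> \<le> ereal (kl_reference - rate \<theta>) + ereal e" using g(2) by (simp add: rate)
      finally show "min_kl N \<mu> m (p \<theta>) \<le> ereal (kl_reference - rate \<theta>) + ereal e" .
    qed
  qed
qed

text \<open>The data \<open>y\<close> is any sequence whose entries from index 1 on form
  \<open>z\<close>, its entry at 0 being free. The product of the \<open>\<rho>\<close> values is
  positive and the same for all parameters, so only \<open>l\<close> matters in comparisons.\<close>

lemma likelihood_growth:
  assumes th: "\<theta> \<in> \<Theta>"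
  shows "AE z in S. (\<forall>i. 0 < \<rho> (z i)) \<and> (\<exists>l. (\<lambda>n. l n / real n) \<longlonglongrightarrow> rate \<theta> \<and>
    (\<forall>y. (\<forall>i. y (Suc i) = z i) \<longrightarrow> (\<forall>n. pr_marginal_likelihood \<mu> (p \<theta>) w (f\<^sub>0 \<theta>) y n
        = (\<Prod>i<n. \<rho> (z i)) * exp (l n))))"
proof -
  obtain A where K: "continuous_mixture_kernel P (\<nu> \<theta>) (nkernel \<theta>) A" using nkernel_locale[OF th] by blast
  interpret R: predictive_recursion P "\<nu> \<theta>" "nkernel \<theta>" A "\<lambda>i. w (Suc i)"
    by (intro predictive_recursion.intro predictive_recursion_axioms.intro
        continuous_mixture_kernel.axioms(1)[OF K]) (use weights w_div w_sq in auto)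
  note [measurable] = f0_measurable[OF th]
  have "AE z in S. \<forall>i. z i \<in> good \<theta>"
    unfolding AE_all_countable
    by (intro allI AE_PiM_component) (auto intro: prob_space_P good_AE[OF th])
  with R.log_likelihood_growth AE_space show ?thesis
  proof eventually_elim
    case (elim z)
    note z = elim(2) and good = elim(3)[rule_format]
    have zP: "z i \<in> space P" for i by (rule R.component_space[OF z])
    have integral_G: "(\<integral>u. p \<theta> u (z i) * (R.G z i u * f\<^sub>0 \<theta> u) \<partial>\<mu>) = \<rho> (z i) * R.mix (R.G z i) (z i)" for i
    proof -
      have meas: "(\<lambda>u. nkernel \<theta> u (z i) * R.G z i u) \<in> borel_measurable (\<nu> \<theta>)"
        by (rule borel_measurable_integrable[OF R.k_dens_integrable[OF R.G_dens[OF z] zP]])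
      then have [measurable]: "(\<lambda>u. nkernel \<theta> u (z i) * R.G z i u) \<in> borel_measurable \<mu>"
        by (simp cong: measurable_cong_sets add: sets_nu sets_mu)
      have dens: "(\<integral>u. h u \<partial>\<nu> \<theta>) = (\<integral>u. f\<^sub>0 \<theta> u * h u \<partial>\<mu>)" if "h \<in> borel_measurable \<mu>" for h
        unfolding \<nu>_def using f0_nonneg[OF th] that by (subst integral_density) auto
      have "R.mix (R.G z i) (z i) = (\<integral>u. f\<^sub>0 \<theta> u * (nkernel \<theta> u (z i) * R.G z i u) \<partial>\<mu>)"
        unfolding R.mix_def by (rule dens) measurable
      also have "\<dots> = (\<integral>u. (p \<theta> u (z i) * (R.G z i u * f\<^sub>0 \<theta> u)) / \<rho> (z i) \<partial>\<mu>)"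
        using good by (intro Bochner_Integration.integral_cong) (simp_all add: nkernel_def)
      finally show ?thesis using rho_pos[OF good, of i] by simp
    qed
    \<comment> \<open>The recursion for \<open>\<mu>\<close>-densities is
      \<open>f\<^sub>0 \<theta>\<close> times the one for \<open>G\<close>: the factor
      \<open>\<rho> (z i)\<close> cancels between the Bayes numerator and its normalizing
      integral.\<close>
    have G_eq: "pr_density \<mu> (p \<theta>) w (f\<^sub>0 \<theta>) y i = (\<lambda>u. R.G z i u * f\<^sub>0 \<theta> u)"
      if y: "\<forall>i. y (Suc i) = z i" for y i
    proof (induction i)
      case (Suc i)
      have "p \<theta> u (z i) * (R.G z i u * f\<^sub>0 \<theta> u) / (\<rho> (z i) * R.mix (R.G z i) (z i))
          = R.tilt (R.G z i) (z i) u * f\<^sub>0 \<theta> u" for u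
        using good[of i] by (simp add: R.tilt_def nkernel_def mult_ac)
      then show ?case
        unfolding pr_density.simps Suc using y by (simp add: integral_G fun_eq_iff distrib_right mult.assoc)
    qed simp
    have mix_eq: "pr_mixture \<mu> (p \<theta>) w (f\<^sub>0 \<theta>) y i (y (Suc i)) = \<rho> (z i) * R.mix (R.G z i) (z i)"
      if y: "\<forall>i. y (Suc i) = z i" for y i
      unfolding pr_mixture_def G_eq[OF y] using y by (simp add: integral_G)
    define l where "l n = (\<Sum>i<n. ln (R.mix (R.G z i) (z i)))" for n
    have "pr_marginal_likelihood \<mu> (p \<theta>) w (f\<^sub>0 \<theta>) y n = (\<Prod>i<n. \<rho> (z i)) * exp (l n)"
      if y: "\<forall>i. y (Suc i) = z i" for y n
    proof -
      have "pr_marginal_likelihood \<mu> (p \<theta>) w (f\<^sub>0 \<theta>) y n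
          = (\<Prod>i<n. pr_mixture \<mu> (p \<theta>) w (f\<^sub>0 \<theta>) y i (y (Suc i)))"
        unfolding pr_marginal_likelihood_def by (induction n) (simp_all add: prod.nat_ivl_Suc')
      also have "\<dots> = (\<Prod>i<n. \<rho> (z i) * exp (ln (R.mix (R.G z i) (z i))))"
        using R.mix_pos[OF R.G_dens[OF z] zP] by (simp add: mix_eq[OF y])
      finally show ?thesis by (simp add: prod.distrib l_def exp_sum)
    qed
    moreover have "(\<lambda>n. l n / real n) \<longlonglongrightarrow> rate \<theta>"
      unfolding l_def rate_def using elim(1) by simp
    ultimately show ?case using rho_pos[OF good] by blast
  qed
qed

end

section \<open>Eventual optimality of the maximizers\<close>

theorem theorem3:
  fixes M :: "'w measure"
    and N :: "'y measure"
    and \<mu> :: "'u::{metric_space, second_countable_topology} measure"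
    and \<Theta> :: "'t::topological_space set"
    and p :: "'t \<Rightarrow> 'u \<Rightarrow> 'y \<Rightarrow> real"
    and m :: "'y \<Rightarrow> real"
    and Y :: "nat \<Rightarrow> 'w \<Rightarrow> 'y"
    and w :: "nat \<Rightarrow> real"
    and f\<^sub>0 :: "'t \<Rightarrow> 'u \<Rightarrow> real"
    and \<theta>hat :: "nat \<Rightarrow> 'w \<Rightarrow> 't"
  assumes "prob_space M"
    and "sets \<mu> = sets borel" and "sigma_finite_measure \<mu>"
    and "finite \<Theta>"
    and kernel: "\<And>\<theta> u. \<theta> \<in> \<Theta> \<Longrightarrow> is_density N (p \<theta> u)"
    and weights: "\<And>n. n \<ge> 1 \<Longrightarrow> 0 < w n \<and> w n < 1"
    and initial: "\<And>\<theta>. \<theta> \<in> \<Theta> \<Longrightarrow> is_density \<mu> (f\<^sub>0 \<theta>)"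
    and initial_pos: "\<And>\<theta>. \<theta> \<in> \<Theta> \<Longrightarrow> AE u in \<mu>. 0 < f\<^sub>0 \<theta> u"
    and A1_density: "is_density N m"
    and A1_indep: "prob_space.indep_vars M (\<lambda>_. N) Y {1..}"
    and A1_distr: "\<And>i. i \<ge> 1 \<Longrightarrow> distributed M N (Y i) (\<lambda>y. ennreal (m y))"
    and A1_kl: "\<And>\<theta> Q. \<theta> \<in> \<Theta> \<Longrightarrow> Q \<in> mixing_closure \<mu> \<Longrightarrow> kl_div N m (mixture (p \<theta>) Q) < \<infinity>"
    and A2: "\<not> summable (\<lambda>n. w (Suc n))" "summable (\<lambda>n. (w (Suc n))\<^sup>2)"
    and A3: "compactin weak_topology (mixing_closure \<mu>)"
    and A4: "\<And>\<theta> y. \<theta> \<in> \<Theta> \<Longrightarrow> y \<in> space N \<Longrightarrow>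
               bounded (range (\<lambda>u. p \<theta> u y)) \<and> continuous_on UNIV (\<lambda>u. p \<theta> u y)"
    and A5: "\<And>\<theta>\<^sub>1 \<theta>\<^sub>2. \<theta>\<^sub>1 \<in> \<Theta> \<Longrightarrow> \<theta>\<^sub>2 \<in> \<Theta> \<Longrightarrow> \<exists>A::real.
               (SUP u\<^sub>1. SUP u\<^sub>2. \<integral>\<^sup>+y. (ennreal (p \<theta>\<^sub>1 u\<^sub>1 y) / ennreal (p \<theta>\<^sub>2 u\<^sub>2 y))\<^sup>2 * ennreal (m y) \<partial>N)
                 \<le> ennreal A"
    and A6: "\<And>\<theta>. \<theta> \<in> \<Theta> \<Longrightarrow> \<exists>B::real. \<forall>Q\<in>mixing_closure \<mu>.
               kl_div N m (mixture (p \<theta>) Q) = min_kl N \<mu> m (p \<theta>) \<longrightarrow>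
               (\<integral>\<^sup>+y. e2ennreal ((log_ratio (m y) (mixture (p \<theta>) Q y))\<^sup>2) * ennreal (m y) \<partial>N) \<le> ennreal B"
    and maximizer: "\<And>n \<omega>. \<omega> \<in> space M \<Longrightarrow>
               is_arg_max (\<lambda>\<theta>. pr_marginal_likelihood \<mu> (p \<theta>) w (f\<^sub>0 \<theta>) (\<lambda>i. Y i \<omega>) n)
                 (\<lambda>\<theta>. \<theta> \<in> \<Theta>) (\<theta>hat n \<omega>)"
  shows "(AE \<omega> in M. \<forall>\<^sub>F n in sequentially. \<theta>hat n \<omega> \<in> best_params N \<mu> m p \<Theta>) \<and>
         (\<forall>\<theta>star. best_params N \<mu> m p \<Theta> = {\<theta>star} \<longrightarrow>
            (AE \<omega> in M. (\<lambda>n. \<theta>hat n \<omega>) \<longlonglongrightarrow> \<theta>star))"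
proof -
  interpret M: prob_space M by fact
  obtain \<omega>\<^sub>0 where "\<omega>\<^sub>0 \<in> space M" using M.not_empty by blast
  have hat_in: "\<theta>hat n \<omega> \<in> \<Theta>" if "\<omega> \<in> space M" for n \<omega>
    using maximizer[OF that, of n] by (simp add: is_arg_max_def)
  \<comment> \<open>Any parameter can serve as reference; a maximizer at an arbitrary sample point
    provides one.\<close>
  interpret R: pr_model N \<mu> \<Theta> p m w f\<^sub>0 "\<theta>hat 0 \<omega>\<^sub>0"
    by (unfold_locales; fact assms hat_in[OF \<open>\<omega>\<^sub>0 \<in> space M\<close>])
  have distr: "distr M N (Y i) = R.P" if "i \<ge> 1" for i
    using distributed_distr_eq_density[OF A1_distr[OF that]] by (simp add: R.P_def)
  define Z where "Z = (\<lambda>\<omega> i. Y (Suc i) \<omega>)"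
  have sets_S: "sets R.S = sets (\<Pi>\<^sub>M i\<in>(UNIV :: nat set). N)"
    by (intro sets_PiM_cong) (simp_all add: R.sets_P)
  have Z: "Z \<in> M \<rightarrow>\<^sub>M R.S" "distr M R.S Z = R.S"
    using M.distr_shift_eq_PiM[OF A1_indep distr] sets_S
    unfolding Z_def by (simp_all cong: measurable_cong_sets distr_cong)
  have "AE z in R.S. \<forall>\<theta>\<in>\<Theta>. (\<forall>i. 0 < R.\<rho> (z i)) \<and> (\<exists>l. (\<lambda>n. l n / real n) \<longlonglongrightarrow> R.rate \<theta> \<and>
      (\<forall>y. (\<forall>i. y (Suc i) = z i) \<longrightarrow> (\<forall>n. pr_marginal_likelihood \<mu> (p \<theta>) w (f\<^sub>0 \<theta>) y n
        = (\<Prod>i<n. R.\<rho> (z i)) * exp (l n))))"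
    by (intro AE_finite_allI \<open>finite \<Theta>\<close> R.likelihood_growth)
  then have growth: "AE \<omega> in M. \<forall>\<theta>\<in>\<Theta>. (\<forall>i. 0 < R.\<rho> (Z \<omega> i)) \<and> (\<exists>l. (\<lambda>n. l n / real n) \<longlonglongrightarrow> R.rate \<theta> \<and>
      (\<forall>y. (\<forall>i. y (Suc i) = Z \<omega> i) \<longrightarrow> (\<forall>n. pr_marginal_likelihood \<mu> (p \<theta>) w (f\<^sub>0 \<theta>) y n
        = (\<Prod>i<n. R.\<rho> (Z \<omega> i)) * exp (l n))))"
    by (intro AE_distrD[OF Z(1)]) (simp only: Z(2))
  have "\<Theta> \<noteq> {}" using R.theta0 by blast
  have "Max (R.rate ` \<Theta>) \<in> R.rate ` \<Theta>"
    using \<open>finite \<Theta>\<close> \<open>\<Theta> \<noteq> {}\<close> by (intro Max_in) auto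
  then obtain \<theta>m where max: "\<theta>m \<in> \<Theta>" "Max (R.rate ` \<Theta>) = R.rate \<theta>m" by blast
  have \<theta>m: "\<theta>m \<in> \<Theta>" "\<And>\<theta>. \<theta> \<in> \<Theta> \<Longrightarrow> R.rate \<theta> \<le> R.rate \<theta>m"
    using max Max_ge[of "R.rate ` \<Theta>"] \<open>finite \<Theta>\<close> by auto
  \<comment> \<open>Minimal divergence and rate add up to the constant \<open>kl_reference\<close>,
    so a maximal rate means a best parameter.\<close>
  have best: "\<theta> \<in> best_params N \<mu> m p \<Theta>" if "\<theta> \<in> \<Theta>" "R.rate \<theta>m \<le> R.rate \<theta>" for \<theta>
  proof -
    have "min_kl N \<mu> m (p \<theta>) \<le> (INF \<theta>\<in>\<Theta>. min_kl N \<mu> m (p \<theta>))"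
    proof (rule INF_greatest)
      fix \<theta>' assume "\<theta>' \<in> \<Theta>"
      then show "min_kl N \<mu> m (p \<theta>) \<le> min_kl N \<mu> m (p \<theta>')"
        using that \<theta>m(2)[of \<theta>'] by (simp add: R.min_kl_eq)
    qed
    moreover have "(INF \<theta>\<in>\<Theta>. min_kl N \<mu> m (p \<theta>)) \<le> min_kl N \<mu> m (p \<theta>)"
      by (rule INF_lower[OF that(1)])
    ultimately show ?thesis using that(1) by (simp add: best_params_def)
  qed
  have ev: "AE \<omega> in M. \<forall>\<^sub>F n in sequentially. \<theta>hat n \<omega> \<in> best_params N \<mu> m p \<Theta>"
    using growth AE_space
  proof eventually_elim
    case (elim \<omega>)
    define L where "L \<theta> n = pr_marginal_likelihood \<mu> (p \<theta>) w (f\<^sub>0 \<theta>) (\<lambda>i. Y i \<omega>) n" for \<theta> n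
    have "\<exists>l. (\<lambda>n. l n / real n) \<longlonglongrightarrow> R.rate \<theta> \<and> (\<forall>n. L \<theta> n = (\<Prod>i<n. R.\<rho> (Z \<omega> i)) * exp (l n))"
      if th: "\<theta> \<in> \<Theta>" for \<theta>
    proof -
      obtain l where l: "(\<lambda>n. l n / real n) \<longlonglongrightarrow> R.rate \<theta>"
        "\<forall>y. (\<forall>i. y (Suc i) = Z \<omega> i) \<longrightarrow> (\<forall>n. pr_marginal_likelihood \<mu> (p \<theta>) w (f\<^sub>0 \<theta>) y n
          = (\<Prod>i<n. R.\<rho> (Z \<omega> i)) * exp (l n))"
        using bspec[OF elim(1) th, THEN conjunct2] by (elim exE conjE)
      have "\<forall>n. L \<theta> n = (\<Prod>i<n. R.\<rho> (Z \<omega> i)) * exp (l n)"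
        unfolding L_def using l(2)[rule_format, of "\<lambda>i. Y i \<omega>"] by (simp add: Z_def)
      then show ?thesis using l(1) by blast
    qed
    then obtain l where l: "\<And>\<theta>. \<theta> \<in> \<Theta> \<Longrightarrow> (\<lambda>n. l \<theta> n / real n) \<longlonglongrightarrow> R.rate \<theta>"
      "\<And>\<theta> n. \<theta> \<in> \<Theta> \<Longrightarrow> L \<theta> n = (\<Prod>i<n. R.\<rho> (Z \<omega> i)) * exp (l \<theta> n)" by metis
    have \<rho>: "0 < (\<Prod>i<n. R.\<rho> (Z \<omega> i))" for n
      using bspec[OF elim(1) \<theta>m(1), THEN conjunct1] by (intro prod_pos) simp
    \<comment> \<open>Finiteness of \<open>\<Theta>\<close> gives one index from which
      \<open>\<theta>m\<close> beats all parameters of smaller rate at once.\<close>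
    have "\<forall>\<^sub>F n in sequentially. \<forall>\<theta>\<in>{\<theta> \<in> \<Theta>. R.rate \<theta> < R.rate \<theta>m}. L \<theta> n < L \<theta>m n"
    proof (rule eventually_ball_finite)
      show "finite {\<theta> \<in> \<Theta>. R.rate \<theta> < R.rate \<theta>m}" using \<open>finite \<Theta>\<close> by simp
      show "\<forall>\<theta>\<in>{\<theta> \<in> \<Theta>. R.rate \<theta> < R.rate \<theta>m}. \<forall>\<^sub>F n in sequentially. L \<theta> n < L \<theta>m n"
      proof
        fix \<theta> assume \<theta>: "\<theta> \<in> {\<theta> \<in> \<Theta>. R.rate \<theta> < R.rate \<theta>m}"
        then have "(\<lambda>n. l \<theta>m n / real n - l \<theta> n / real n) \<longlonglongrightarrow> R.rate \<theta>m - R.rate \<theta>"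
          using \<theta>m(1) by (intro tendsto_diff l) auto
        then have "\<forall>\<^sub>F n in sequentially. 0 < l \<theta>m n / real n - l \<theta> n / real n"
          using \<theta> by (intro order_tendstoD(1)) auto
        then show "\<forall>\<^sub>F n in sequentially. L \<theta> n < L \<theta>m n"
          using eventually_gt_at_top[of 0]
        proof eventually_elim
          case (elim n)
          then have "l \<theta> n < l \<theta>m n" by (simp add: diff_divide_distrib[symmetric] zero_less_divide_iff)
          then show ?case using \<theta> \<theta>m(1) \<rho>[of n] by (simp add: l(2))
        qed
      qed
    qed
    then show ?case
    proof eventually_elim
      case (elim n)
      \<comment> \<open>A maximizer is never beaten by \<open>\<theta>m\<close>, so its rate is
        eventually maximal.\<close>
      have "\<not> L (\<theta>hat n \<omega>) n < L \<theta>m n"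
        using maximizer[OF \<open>\<omega> \<in> space M\<close>, of n] \<theta>m(1) by (auto simp: is_arg_max_def L_def)
      then have "\<not> R.rate (\<theta>hat n \<omega>) < R.rate \<theta>m"
        using elim hat_in[OF \<open>\<omega> \<in> space M\<close>, of n] by blast
      then show ?case using best hat_in[OF \<open>\<omega> \<in> space M\<close>, of n] by simp
    qed
  qed
  show ?thesis
  proof (intro conjI allI impI ev)
    fix \<theta>star assume "best_params N \<mu> m p \<Theta> = {\<theta>star}"
    with ev show "AE \<omega> in M. (\<lambda>n. \<theta>hat n \<omega>) \<longlonglongrightarrow> \<theta>star"
      by (auto elim!: eventually_mono intro: tendsto_eventually)
  qed
qed

end
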